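(* Grant (Lip-Conv), (Conv) and (Inl') from the context, and assume $|\mathcal O|\le3N/7$. Let $\gamma=1/(768L)$ and $K\in[7|\mathcal O|/3,N]$. Then the minmax MOM estimator $\hat f$ satisfies, with probability at least $1-\exp(-K/2016)$, $P\mathcal L_{\hat f}\le\bar r_2^2(\gamma)$.
   Context: Setting: $\mathcal X,\mathcal Y$ measurable spaces, $\bar{\mathcal Y}\subset\mathbb R$ convex containing all values $f(x)$, $F$ a class of measurable functions $\mathcal X\to\bar{\mathcal Y}$, $\bar\ell:\bar{\mathcal Y}\times\mathcal Y\to\mathbb R$, $\ell_f(x,y)=\bar\ell(f(x),y)$. $(X,Y)\sim P$, $X\sim\mu$, $Pg=\mathbb Eg(X,Y)$. $R(f)=P\ell_f$ has unique minimizer $f^*$ over $F$; $\mathcal L_f=\ell_f-\ell_{f^*}$. (Lip-Conv): there is $L>0$ with $u\mapsto\bar\ell(u,y)$ convex and $L$-Lipschitz for all $y$. (Conv): $F$ convex. Data $(X_i,Y_i)_{i=1}^N$ with unknown partition $\{1,\dots,N\}=\mathcal O\cup\mathcal I$, no assumption on $i\in\mathcal O$. (Inl'): $(X_i,Y_i)_{i\in\mathcal I}$ are independent, $(X_i,Y_i)\sim P_i$, $X_i\sim\mu_i$, $F\subset L_2(\mu_i)$ and $P_i\mathcal L_f=P\mathcal L_f$ for all $f\in F$, $i\in\mathcal I$. MOM: $K$ divides $N$, $B_1,\dots,B_K$ partition $\{1,\dots,N\}$ into blocks of size $N/K$, $P_{B_k}g=\frac KN\sum_{i\in B_k}g(X_i,Y_i)$,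 $\mathrm{MOM}_K(g)$ the median of $(P_{B_k}g)_k$; $\hat f\in\operatorname{argmin}_{f\in F}\sup_{g\in F}\mathrm{MOM}_K(\ell_f-\ell_g)$. Complexity: with i.i.d. Rademacher $(\sigma_i)$ independent of the data, let $E(r)=\sup_{J\subset\mathcal I:|J|\ge N/2}\mathbb E\sup_{f\in F:P\mathcal L_f\le r^2}|\frac1{|J|}\sum_{i\in J}\sigma_i(f-f^* )(X_i)|$ and $V_K(r)=\max_{i\in\mathcal I}\sup_{f\in F:P\mathcal L_f\le r^2}\sqrt{\mathrm{Var}_{P_i}(\mathcal L_f)}\sqrt{K/N}$. $\bar r_2(\gamma)$ is a positive number with $\bar r_2(\gamma)\ge\inf\{r>0:\max(E(r)/\gamma,\sqrt{1536}V_K(r))\le r^2\}$. *)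

theory Defs
  imports "HOL-Probability.Probability"
begin

text \<open>Median of a finite list of reals: the element of index (length div 2) of the
  sorted list (for an odd number of entries this is the unique median; for an even number
  it is the upper median).\<close>
definition median_list :: "real list \<Rightarrow> real" where
  "median_list xs = sort xs ! (length xs div 2)"

definition loss :: "(real \<Rightarrow> 'y \<Rightarrow> real) \<Rightarrow> ('x \<Rightarrow> real) \<Rightarrow> 'x \<times> 'y \<Rightarrow> real" where
  "loss lb f = (\<lambda>(x, y). lb (f x) y)"

definition excess_risk :: "('x \<times> 'y) measure \<Rightarrow> (real \<Rightarrow> 'y \<Rightarrow> real) \<Rightarrow> ('x \<Rightarrow> real)
    \<Rightarrow> ('x \<Rightarrow> real) \<Rightarrow> real" where
  "excess_risk Q lb fstar f = (\<integral>z. loss lb f z - loss lb fstar z \<partial>Q)"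

definition MOM :: "nat \<Rightarrow> nat \<Rightarrow> (nat \<Rightarrow> nat set) \<Rightarrow> (nat \<Rightarrow> 'w \<Rightarrow> 'x \<times> 'y)
    \<Rightarrow> ('x \<times> 'y \<Rightarrow> real) \<Rightarrow> 'w \<Rightarrow> real" where
  "MOM K N B Z g w = median_list (map (\<lambda>k. real K / real N * (\<Sum>i\<in>B k. g (Z i w))) [0..<K])"

definition minmax_obj :: "(real \<Rightarrow> 'y \<Rightarrow> real) \<Rightarrow> ('x \<Rightarrow> real) set \<Rightarrow> nat \<Rightarrow> nat
    \<Rightarrow> (nat \<Rightarrow> nat set) \<Rightarrow> (nat \<Rightarrow> 'w \<Rightarrow> 'x \<times> 'y) \<Rightarrow> ('x \<Rightarrow> real) \<Rightarrow> 'w \<Rightarrow> ereal" where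
  "minmax_obj lb F K N B Z f w =
     (SUP g\<in>F. ereal (MOM K N B Z (\<lambda>z. loss lb f z - loss lb g z) w))"

definition is_minmax_MOM :: "(real \<Rightarrow> 'y \<Rightarrow> real) \<Rightarrow> ('x \<Rightarrow> real) set \<Rightarrow> nat \<Rightarrow> nat
    \<Rightarrow> (nat \<Rightarrow> nat set) \<Rightarrow> (nat \<Rightarrow> 'w \<Rightarrow> 'x \<times> 'y) \<Rightarrow> ('x \<Rightarrow> real) \<Rightarrow> 'w \<Rightarrow> bool" where
  "is_minmax_MOM lb F K N B Z fh w \<longleftrightarrow>
     fh \<in> F \<and> (\<forall>f\<in>F. minmax_obj lb F K N B Z fh w \<le> minmax_obj lb F K N B Z f w)"

text \<open>Outer expectation (the sup inside the expectation need not be measurable).\<close>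
definition outer_nn_integral :: "'a measure \<Rightarrow> ('a \<Rightarrow> ennreal) \<Rightarrow> ennreal" where
  "outer_nn_integral Q h =
     (INF g \<in> {g \<in> borel_measurable Q. \<forall>w\<in>space Q. h w \<le> g w}. \<integral>\<^sup>+ w. g w \<partial>Q)"

definition rademacher :: "real measure" where
  "rademacher = measure_pmf (pmf_of_set {-1, 1})"

definition complexity_E :: "('x \<times> 'y) measure \<Rightarrow> (real \<Rightarrow> 'y \<Rightarrow> real) \<Rightarrow> ('x \<Rightarrow> real) set
    \<Rightarrow> ('x \<Rightarrow> real) \<Rightarrow> nat set \<Rightarrow> nat \<Rightarrow> (nat \<Rightarrow> 'x measure) \<Rightarrow> real \<Rightarrow> ennreal" where
  "complexity_E Q lb F fstar Inls N mu r =
     (SUP J \<in> {J. J \<subseteq> Inls \<and> real N \<le> 2 * real (card J)}.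
        outer_nn_integral (PiM J (\<lambda>i. mu i \<Otimes>\<^sub>M rademacher))
          (\<lambda>w. SUP f \<in> {f \<in> F. excess_risk Q lb fstar f \<le> r\<^sup>2}.
                 ennreal \<bar>(1 / real (card J)) *
                   (\<Sum>i\<in>J. snd (w i) * (f (fst (w i)) - fstar (fst (w i))))\<bar>))"

definition complexity_V :: "('x \<times> 'y) measure \<Rightarrow> (real \<Rightarrow> 'y \<Rightarrow> real) \<Rightarrow> ('x \<Rightarrow> real) set
    \<Rightarrow> ('x \<Rightarrow> real) \<Rightarrow> nat set \<Rightarrow> nat \<Rightarrow> nat \<Rightarrow> (nat \<Rightarrow> ('x \<times> 'y) measure) \<Rightarrow> real \<Rightarrow> ennreal" where
  "complexity_V Q lb F fstar Inls N K Ps r =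
     (SUP i \<in> Inls. SUP f \<in> {f \<in> F. excess_risk Q lb fstar f \<le> r\<^sup>2}.
        ennreal (sqrt (\<integral>z. ((loss lb f z - loss lb fstar z)
                     - (\<integral>z'. loss lb f z' - loss lb fstar z' \<partial>Ps i))\<^sup>2 \<partial>Ps i)))
     * ennreal (sqrt (real K / real N))"

end

theory Submission
  imports Defs
begin

text \<open>
  Fix a radius \<open>r\<close> and let \<open>T\<close> be the functions of excess risk at most \<open>r\<^sup>2\<close>. On the blocks
  without outliers, the number of blocks whose empirical excess loss deviates by more than
  \<open>r\<^sup>2 / 4\<close> is at most a sum of ramps of the normalized deviations. The expected ramps are small
  because the ramp lies below the square. The supremum over \<open>T\<close> of the centred sum is
  bounded in mean by symmetrization over blocks, contraction (ramp), symmetrization over data and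
  contraction (loss), which leads to the Rademacher complexity, and it concentrates because it has
  bounded differences in the blocks. Thus with large probability more than \<open>K / 2\<close> blocks are
  accurate for every \<open>f \<in> T\<close>. Convexity carries this to functions of larger risk along the
  segment to \<open>fstar\<close>, and comparing medians shows that the minmax estimator lies in \<open>T\<close>.

  Suprema over the class need not be measurable, so they are replaced by measurable majorants.
  Two ideas make the classical arguments survive: majorants of the signed suprema cut out a
  measurable random polytope in which the contraction principle can be applied pointwise, and a
  majorant of least integral inherits bounded differences almost everywhere.
\<close>

text \<open>The constants come from one count. At most 3/7 of the blocks contain an outlier, so at
  least 4/7 are clean. Among the clean blocks a fraction of at most 11/96 may deviate: 1/96 from
  Chebyshev (16/1536), 1/24 from the Rademacher complexity (32/768, where 32 = 2 * 8 * 2 stands for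
  two symmetrizations and the slope 8 / r^2 of the rescaled ramp), and 1/16 from concentration.
  Since 85/96 * 4/7 = 340/672 exceeds 1/2, a strict majority of all blocks is accurate. The accuracy
  r^2 / 4 separates two medians: at least 3/4 r^2 for a function outside \<open>T\<close> against
  \<open>fstar\<close>, at most r^2 / 4 for \<open>fstar\<close> against any function. Deviating
  blocks are counted by a ramp because contraction needs a Lipschitz function, which an indicator is
  not. Outer expectations obey no Fubini theorem. Signs therefore enter as finite sums over subsets,
  and a second sample enters only through measurable majorants composed with measurable
  maps.\<close>

section \<open>Outer integrals and least measurable majorants\<close>

lemma ennreal_add_le: "ennreal (a + b) \<le> ennreal a + ennreal b"
proof (cases "0 \<le> a \<and> 0 \<le> b")
  case False
  then have "a + b \<le> a \<and> b < 0 \<or> a + b \<le> b \<and> a < 0" by linarith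
  then show ?thesis using ennreal_leI[of "a + b" a] ennreal_leI[of "a + b" b] by (auto simp: ennreal_neg)
qed auto

lemma outer_nn_integral_le:
  assumes "g \<in> borel_measurable Q" "\<And>w. w \<in> space Q \<Longrightarrow> h w \<le> g w"
  shows "outer_nn_integral Q h \<le> (\<integral>\<^sup>+ w. g w \<partial>Q)"
  unfolding outer_nn_integral_def by (rule INF_lower) (use assms in auto)

text \<open>The pointwise infimum of a minimizing sequence of majorants is again a measurable
  majorant. Every later argument replaces a supremum by this least majorant without losing anything
  in the mean.\<close>

lemma outer_nn_integral_attained:
  obtains g where "g \<in> borel_measurable Q" "\<And>w. w \<in> space Q \<Longrightarrow> h w \<le> g w"
    "(\<integral>\<^sup>+ w. g w \<partial>Q) = outer_nn_integral Q h"
proof -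
  define S where "S = {g \<in> borel_measurable Q. \<forall>w\<in>space Q. h w \<le> g w}"
  have "(\<lambda>_. \<infinity>) \<in> S" by (auto simp: S_def)
  then have "(\<lambda>g. \<integral>\<^sup>+ w. g w \<partial>Q) ` S \<noteq> {}" by auto
  from ennreal_Inf_countable_INF[OF this] obtain f :: "nat \<Rightarrow> ennreal"
    where f: "range f \<subseteq> (\<lambda>g. \<integral>\<^sup>+ w. g w \<partial>Q) ` S" "Inf ((\<lambda>g. \<integral>\<^sup>+ w. g w \<partial>Q) ` S) = (INF i. f i)"
    by auto
  then have "\<forall>i. \<exists>g\<in>S. f i = (\<integral>\<^sup>+ w. g w \<partial>Q)" by auto
  then obtain G where G: "\<And>i. G i \<in> S" "\<And>i. f i = (\<integral>\<^sup>+ w. G i w \<partial>Q)" by metis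
  define g where "g w = (INF i. G i w)" for w
  have Gm [measurable]: "G i \<in> borel_measurable Q" for i using G(1)[of i] by (auto simp: S_def)
  have g1: "g \<in> borel_measurable Q" unfolding g_def by measurable
  have g2: "h w \<le> g w" if "w \<in> space Q" for w
    unfolding g_def by (rule INF_greatest) (use G(1) that in \<open>auto simp: S_def\<close>)
  have "(\<integral>\<^sup>+ w. g w \<partial>Q) \<le> (\<integral>\<^sup>+ w. G i w \<partial>Q)" for i
    by (rule nn_integral_mono) (auto simp: g_def intro: INF_lower)
  then have "(\<integral>\<^sup>+ w. g w \<partial>Q) \<le> (INF i. f i)" by (intro INF_greatest) (simp add: G)
  then have "(\<integral>\<^sup>+ w. g w \<partial>Q) \<le> outer_nn_integral Q h"
    unfolding outer_nn_integral_def f(2)[symmetric] S_def .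
  with outer_nn_integral_le[OF g1 g2] have "(\<integral>\<^sup>+ w. g w \<partial>Q) = outer_nn_integral Q h"
    by (intro antisym) auto
  with g1 g2 show ?thesis using that by blast
qed

lemma outer_nn_integral_mono:
  assumes "\<And>w. w \<in> space Q \<Longrightarrow> h w \<le> h' w"
  shows "outer_nn_integral Q h \<le> outer_nn_integral Q h'"
proof -
  obtain g where g: "g \<in> borel_measurable Q" "\<And>w. w \<in> space Q \<Longrightarrow> h' w \<le> g w"
    "(\<integral>\<^sup>+ w. g w \<partial>Q) = outer_nn_integral Q h'" using outer_nn_integral_attained by blast
  show ?thesis unfolding g(3)[symmetric]
    by (rule outer_nn_integral_le) (use g assms in \<open>auto intro: order_trans\<close>)
qed

lemma outer_nn_integral_cong:
  assumes "\<And>w. w \<in> space Q \<Longrightarrow> h w = h' w"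
  shows "outer_nn_integral Q h = outer_nn_integral Q h'"
  by (intro antisym outer_nn_integral_mono) (simp_all add: assms)

lemma outer_nn_integral_cmult_le:
  assumes "\<And>w. w \<in> space Q \<Longrightarrow> h w \<le> c * h' w"
  shows "outer_nn_integral Q h \<le> c * outer_nn_integral Q h'"
proof -
  obtain g where g: "g \<in> borel_measurable Q" "\<And>w. w \<in> space Q \<Longrightarrow> h' w \<le> g w"
    "(\<integral>\<^sup>+ w. g w \<partial>Q) = outer_nn_integral Q h'" using outer_nn_integral_attained by blast
  have "outer_nn_integral Q h \<le> (\<integral>\<^sup>+ w. c * g w \<partial>Q)"
  proof (rule outer_nn_integral_le)
    fix w assume "w \<in> space Q"
    then show "h w \<le> c * g w" using assms g(2) by (meson mult_left_mono order_trans zero_le)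
  qed (use g(1) in measurable)
  also have "\<dots> = c * outer_nn_integral Q h'" using g by (simp add: nn_integral_cmult)
  finally show ?thesis .
qed

text \<open>Pulling a majorant back along \<open>T\<close> gives a majorant. A majorant on the
  source need not factor through \<open>T\<close>, so in general only an inequality holds.\<close>

lemma outer_nn_integral_distr:
  assumes T: "T \<in> measurable Q Q'" and d: "distr Q Q' T = R"
    and h: "\<And>w. w \<in> space Q \<Longrightarrow> h w \<le> h' (T w)"
  shows "outer_nn_integral Q h \<le> outer_nn_integral R h'"
proof -
  have RQ: "sets R = sets Q'" "space R = space Q'" unfolding d[symmetric] by simp_all
  obtain g where g: "g \<in> borel_measurable R" "\<And>w. w \<in> space R \<Longrightarrow> h' w \<le> g w"
    "(\<integral>\<^sup>+ w. g w \<partial>R) = outer_nn_integral R h'" using outer_nn_integral_attained by blast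
  have gm: "g \<in> borel_measurable Q'" using g(1) RQ by (simp cong: measurable_cong_sets)
  have "outer_nn_integral Q h \<le> (\<integral>\<^sup>+ w. g (T w) \<partial>Q)"
  proof (rule outer_nn_integral_le)
    fix w assume w: "w \<in> space Q"
    then have "T w \<in> space R" using T RQ by (auto dest: measurable_space)
    then show "h w \<le> g (T w)" using h[OF w] g(2) by (meson order_trans)
  qed (use gm T in measurable)
  also have "\<dots> = outer_nn_integral R h'"
    using g(3) T gm by (simp add: d[symmetric] nn_integral_distr)
  finally show ?thesis .
qed

section \<open>Rademacher signs and the contraction principle\<close>

text \<open>A sign vector is encoded by the set of coordinates with sign -1. A Rademacher average
  over \<open>I\<close> is then a finite sum over \<open>Pow I\<close> divided by
  \<open>2 ^ card I\<close>.\<close>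

definition sign_on :: "'i set \<Rightarrow> 'i \<Rightarrow> real" where
  "sign_on A i = (if i \<in> A then -1 else 1)"

lemma sum_Pow_insert:
  assumes "finite I" "x \<notin> I"
  shows "(\<Sum>A\<in>Pow (insert x I). f A) = (\<Sum>A\<in>Pow I. f A + f (insert x A))"
proof -
  have "(\<Sum>A\<in>Pow (insert x I). f A) = (\<Sum>A\<in>Pow I. f A) + (\<Sum>A\<in>insert x ` Pow I. f A)"
    unfolding Pow_insert by (rule sum.union_disjoint) (use assms in auto)
  also have "(\<Sum>A\<in>insert x ` Pow I. f A) = (\<Sum>A\<in>Pow I. f (insert x A))"
    by (rule sum.reindex_cong[of "insert x"]) (use assms in \<open>auto simp: inj_on_def\<close>)
  finally show ?thesis by (simp add: sum.distrib)
qed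

text \<open>With maximizers t and t' on the left, the left side is u t + u t' + (a t - a t'). The
  last difference is at most that of \<open>b\<close> in one of the two orders, and t, t' are
  admissible on the right in either order.\<close>

lemma contraction_step:
  fixes u a b :: "'t \<Rightarrow> real"
  assumes T: "finite T" "T \<noteq> {}"
    and ab: "\<And>t t'. t \<in> T \<Longrightarrow> t' \<in> T \<Longrightarrow> \<bar>a t - a t'\<bar> \<le> \<bar>b t - b t'\<bar>"
  shows "Max ((\<lambda>t. u t + a t) ` T) + Max ((\<lambda>t. u t - a t) ` T)
    \<le> Max ((\<lambda>t. u t + b t) ` T) + Max ((\<lambda>t. u t - b t) ` T)"
proof -
  have "Max ((\<lambda>t. u t + a t) ` T) \<in> (\<lambda>t. u t + a t) ` T"
    "Max ((\<lambda>t. u t - a t) ` T) \<in> (\<lambda>t. u t - a t) ` T"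
    using T by (intro Max_in; simp)+
  then obtain t t' where t: "t \<in> T" "Max ((\<lambda>t. u t + a t) ` T) = u t + a t"
    and t': "t' \<in> T" "Max ((\<lambda>t. u t - a t) ` T) = u t' - a t'" by auto
  have M1: "u s + b s \<le> Max ((\<lambda>t. u t + b t) ` T)" if "s \<in> T" for s
    using T that by (intro Max_ge) auto
  have M2: "u s - b s \<le> Max ((\<lambda>t. u t - b t) ` T)" if "s \<in> T" for s
    using T that by (intro Max_ge) auto
  show ?thesis
    using t t' ab[OF t(1) t'(1)] M1[OF t(1)] M1[OF t'(1)] M2[OF t(1)] M2[OF t'(1)] by linarith
qed

text \<open>Coordinates are exchanged one at a time, pairing the two signs of the new coordinate.
  The free term \<open>u\<close> absorbs the coordinates that are currently held fixed, hence the
  induction for all \<open>u\<close>.\<close>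

lemma contraction_Max:
  fixes a b :: "'i \<Rightarrow> 't \<Rightarrow> real"
  assumes "finite I" and T: "finite T" "T \<noteq> {}"
    and ab: "\<And>i t t'. i \<in> I \<Longrightarrow> t \<in> T \<Longrightarrow> t' \<in> T \<Longrightarrow> \<bar>a i t - a i t'\<bar> \<le> \<bar>b i t - b i t'\<bar>"
  shows "(\<Sum>A\<in>Pow I. Max ((\<lambda>t. u t + (\<Sum>i\<in>I. sign_on A i * a i t)) ` T))
    \<le> (\<Sum>A\<in>Pow I. Max ((\<lambda>t. u t + (\<Sum>i\<in>I. sign_on A i * b i t)) ` T))"
  using assms(1) ab
proof (induction I arbitrary: u rule: finite_induct)
  case (insert x I)
  have s: "(\<Sum>i\<in>insert x I. sign_on A i * c i) = c x + (\<Sum>i\<in>I. sign_on A i * c i)"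
    "(\<Sum>i\<in>insert x I. sign_on (insert x A) i * c i) = - c x + (\<Sum>i\<in>I. sign_on A i * c i)"
    if "A \<in> Pow I" for A and c :: "'i \<Rightarrow> real"
  proof -
    have "(\<Sum>i\<in>I. sign_on (insert x A) i * c i) = (\<Sum>i\<in>I. sign_on A i * c i)"
      by (rule sum.cong) (use insert that in \<open>auto simp: sign_on_def\<close>)
    then show "(\<Sum>i\<in>insert x I. sign_on A i * c i) = c x + (\<Sum>i\<in>I. sign_on A i * c i)"
      "(\<Sum>i\<in>insert x I. sign_on (insert x A) i * c i) = - c x + (\<Sum>i\<in>I. sign_on A i * c i)"
      using insert that by (auto simp: sign_on_def)
  qed
  have "(\<Sum>A\<in>Pow (insert x I). Max ((\<lambda>t. u t + (\<Sum>i\<in>insert x I. sign_on A i * a i t)) ` T))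
    = (\<Sum>A\<in>Pow I. Max ((\<lambda>t. u t + (a x t + (\<Sum>i\<in>I. sign_on A i * a i t))) ` T)
        + Max ((\<lambda>t. u t + (- a x t + (\<Sum>i\<in>I. sign_on A i * a i t))) ` T))"
    unfolding sum_Pow_insert[OF insert(1,2)] by (intro sum.cong refl) (simp only: s)
  also have "\<dots> = (\<Sum>A\<in>Pow I. Max ((\<lambda>t. (u t + a x t) + (\<Sum>i\<in>I. sign_on A i * a i t)) ` T))
        + (\<Sum>A\<in>Pow I. Max ((\<lambda>t. (u t - a x t) + (\<Sum>i\<in>I. sign_on A i * a i t)) ` T))"
    by (simp add: sum.distrib algebra_simps)
  also have "\<dots> \<le> (\<Sum>A\<in>Pow I. Max ((\<lambda>t. (u t + a x t) + (\<Sum>i\<in>I. sign_on A i * b i t)) ` T))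
        + (\<Sum>A\<in>Pow I. Max ((\<lambda>t. (u t - a x t) + (\<Sum>i\<in>I. sign_on A i * b i t)) ` T))"
    by (intro add_mono insert.IH) (use insert.prems in auto)
  also have "\<dots> = (\<Sum>A\<in>Pow I. Max ((\<lambda>t. (u t + (\<Sum>i\<in>I. sign_on A i * b i t)) + a x t) ` T)
        + Max ((\<lambda>t. (u t + (\<Sum>i\<in>I. sign_on A i * b i t)) - a x t) ` T))"
    by (simp add: sum.distrib algebra_simps)
  also have "\<dots> \<le> (\<Sum>A\<in>Pow I. Max ((\<lambda>t. (u t + (\<Sum>i\<in>I. sign_on A i * b i t)) + b x t) ` T)
        + Max ((\<lambda>t. (u t + (\<Sum>i\<in>I. sign_on A i * b i t)) - b x t) ` T))"
    by (intro sum_mono contraction_step T insert.prems) auto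
  also have "\<dots> = (\<Sum>A\<in>Pow I. Max ((\<lambda>t. u t + (b x t + (\<Sum>i\<in>I. sign_on A i * b i t))) ` T)
        + Max ((\<lambda>t. u t + (- b x t + (\<Sum>i\<in>I. sign_on A i * b i t))) ` T))"
    by (simp add: algebra_simps)
  also have "\<dots> = (\<Sum>A\<in>Pow (insert x I). Max ((\<lambda>t. u t + (\<Sum>i\<in>insert x I. sign_on A i * b i t)) ` T))"
    unfolding sum_Pow_insert[OF insert(1,2)] by (intro sum.cong refl) (simp only: s)
  finally show ?case .
qed simp

text \<open>Suprema with separate indices can be approached by simultaneous choices, which reduces
  contraction over any set to finitely many points. In the induction \<open>c\<close> collects the
  terms already chosen.\<close>

lemma sum_SUP_ennreal_le:
  fixes f :: "'x \<Rightarrow> 't \<Rightarrow> ennreal"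
  assumes "finite X" "T \<noteq> {}"
    and "\<And>\<tau>. (\<And>x. x \<in> X \<Longrightarrow> \<tau> x \<in> T) \<Longrightarrow> c + (\<Sum>x\<in>X. f x (\<tau> x)) \<le> C"
  shows "c + (\<Sum>x\<in>X. SUP t\<in>T. f x t) \<le> C"
  using assms(1,3)
proof (induction X arbitrary: c rule: finite_induct)
  case (insert x X)
  have *: "(c + f x t) + (\<Sum>x\<in>X. SUP t\<in>T. f x t) \<le> C" if t: "t \<in> T" for t
  proof (rule insert.IH)
    fix \<tau> assume \<tau>: "\<And>x. x \<in> X \<Longrightarrow> \<tau> x \<in> T"
    have "c + (\<Sum>y\<in>insert x X. f y ((\<tau>(x := t)) y)) \<le> C"
      by (rule insert.prems) (use t \<tau> in auto)
    moreover have "(\<Sum>y\<in>X. f y ((\<tau>(x := t)) y)) = (\<Sum>y\<in>X. f y (\<tau> y))"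
      by (rule sum.cong) (use insert in auto)
    ultimately show "c + f x t + (\<Sum>x\<in>X. f x (\<tau> x)) \<le> C"
      using insert by (simp add: add.assoc)
  qed
  have "c + (\<Sum>x\<in>insert x X. SUP t\<in>T. f x t) = (c + (\<Sum>x\<in>X. SUP t\<in>T. f x t)) + (SUP t\<in>T. f x t)"
    using insert by (simp add: ac_simps)
  also have "\<dots> = (SUP t\<in>T. (c + (\<Sum>x\<in>X. SUP t\<in>T. f x t)) + f x t)"
    using assms(2) by (simp add: ennreal_SUP_add_right)
  also have "\<dots> \<le> C" by (rule SUP_least) (use * in \<open>simp add: ac_simps\<close>)
  finally show ?case .
qed (use assms(2) in auto)

lemma contraction_ennreal:
  fixes a b :: "'i \<Rightarrow> 't \<Rightarrow> real"
  assumes "finite I" and t0: "t0 \<in> T" "\<And>i. i \<in> I \<Longrightarrow> a i t0 = 0" "\<And>i. i \<in> I \<Longrightarrow> b i t0 = 0"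
    and ab: "\<And>i t t'. i \<in> I \<Longrightarrow> t \<in> T \<Longrightarrow> t' \<in> T \<Longrightarrow> \<bar>a i t - a i t'\<bar> \<le> \<bar>b i t - b i t'\<bar>"
  shows "(\<Sum>A\<in>Pow I. SUP t\<in>T. ennreal (\<Sum>i\<in>I. sign_on A i * a i t))
    \<le> (\<Sum>A\<in>Pow I. SUP t\<in>T. ennreal (\<Sum>i\<in>I. sign_on A i * b i t))"
proof -
  have "0 + (\<Sum>A\<in>Pow I. SUP t\<in>T. ennreal (\<Sum>i\<in>I. sign_on A i * a i t))
    \<le> (\<Sum>A\<in>Pow I. SUP t\<in>T. ennreal (\<Sum>i\<in>I. sign_on A i * b i t))"
  proof (rule sum_SUP_ennreal_le)
    fix \<tau> assume \<tau>: "\<And>A. A \<in> Pow I \<Longrightarrow> \<tau> A \<in> T"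
    \<comment> \<open>Finitely many chosen points together with \<open>t0\<close>. The latter makes
      every maximum nonnegative, so \<open>ennreal\<close> commutes with the sum.\<close>
    define S where "S = insert t0 (\<tau> ` Pow I)"
    have S: "finite S" "S \<noteq> {}" "S \<subseteq> T" "t0 \<in> S" using assms(1) t0 \<tau> by (auto simp: S_def)
    define m where "m c A = Max ((\<lambda>t. 0 + (\<Sum>i\<in>I. sign_on A i * c i t)) ` S)" for c :: "'i \<Rightarrow> 't \<Rightarrow> real" and A
    have m: "(\<Sum>i\<in>I. sign_on A i * c i t) \<le> m c A" if "t \<in> S" for c A t
      unfolding m_def using S that by (intro Max_ge) auto
    have m0: "0 \<le> m c A" if "\<And>i. i \<in> I \<Longrightarrow> c i t0 = 0" for c A
      using m[OF S(4), of A c] that by simp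
    have "(\<Sum>A\<in>Pow I. ennreal (\<Sum>i\<in>I. sign_on A i * a i (\<tau> A))) \<le> (\<Sum>A\<in>Pow I. ennreal (m a A))"
      by (intro sum_mono ennreal_leI m) (auto simp: S_def)
    also have "\<dots> = ennreal (\<Sum>A\<in>Pow I. m a A)" using m0 t0 by (intro sum_ennreal) auto
    also have "\<dots> \<le> ennreal (\<Sum>A\<in>Pow I. m b A)"
      unfolding m_def by (intro ennreal_leI contraction_Max assms S ab) (use S in auto)
    also have "\<dots> = (\<Sum>A\<in>Pow I. ennreal (m b A))" using m0 t0 by (intro sum_ennreal[symmetric]) auto
    also have "\<dots> \<le> (\<Sum>A\<in>Pow I. SUP t\<in>T. ennreal (\<Sum>i\<in>I. sign_on A i * b i t))"
    proof (intro sum_mono)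
      fix A
      have "m b A \<in> (\<lambda>t. 0 + (\<Sum>i\<in>I. sign_on A i * b i t)) ` S"
        unfolding m_def using S by (intro Max_in) auto
      then obtain t where "t \<in> T" "m b A = (\<Sum>i\<in>I. sign_on A i * b i t)" using S by auto
      then show "ennreal (m b A) \<le> (SUP t\<in>T. ennreal (\<Sum>i\<in>I. sign_on A i * b i t))"
        by (auto intro: SUP_upper2)
    qed
    finally show "0 + (\<Sum>A\<in>Pow I. ennreal (\<Sum>i\<in>I. sign_on A i * a i (\<tau> A)))
      \<le> (\<Sum>A\<in>Pow I. SUP t\<in>T. ennreal (\<Sum>i\<in>I. sign_on A i * b i t))" by simp
  qed (use assms(1) t0 in auto)
  then show ?thesis by simp
qed

text \<open>Contraction holds for each \<open>w\<close>, but the left side needs a measurable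
  majorant. It is built from the majorants \<open>H A\<close> of the right side: they confine the
  vectors to a polytope, and the supremum of the contracted sums over its rational points is
  measurable. This is why \<open>\<phi>\<close> must be Lipschitz on the whole line and not only at
  the values of \<open>v\<close>.\<close>

lemma outer_contraction:
  fixes Q :: "'w measure" and \<phi> :: "'i \<Rightarrow> 'w \<Rightarrow> real \<Rightarrow> real"
  assumes "prob_space Q" and I: "finite I" and L: "0 \<le> L"
    and lip: "\<And>i w u v. i \<in> I \<Longrightarrow> w \<in> space Q \<Longrightarrow> \<bar>\<phi> i w u - \<phi> i w v\<bar> \<le> L * \<bar>u - v\<bar>"
    and zero: "\<And>i w. i \<in> I \<Longrightarrow> w \<in> space Q \<Longrightarrow> \<phi> i w 0 = 0"
    and meas: "\<And>i u. i \<in> I \<Longrightarrow> (\<lambda>w. \<phi> i w u) \<in> borel_measurable Q"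
  shows "(\<Sum>A\<in>Pow I. outer_nn_integral Q (\<lambda>w. SUP t\<in>T. ennreal (\<Sum>i\<in>I. sign_on A i * \<phi> i w (v t i w))))
    \<le> ennreal L * (\<Sum>A\<in>Pow I. outer_nn_integral Q (\<lambda>w. SUP t\<in>T. ennreal (\<Sum>i\<in>I. sign_on A i * v t i w)))"
proof -
  interpret Q: prob_space Q by fact
  let ?h = "\<lambda>A w. SUP t\<in>T. ennreal (\<Sum>i\<in>I. sign_on A i * v t i w)"
  have "\<exists>g. g \<in> borel_measurable Q \<and> (\<forall>w\<in>space Q. ?h A w \<le> g w) \<and> (\<integral>\<^sup>+ w. g w \<partial>Q) = outer_nn_integral Q (?h A)" for A
    by (rule outer_nn_integral_attained[of Q "?h A"]) blast
  then obtain H where HH: "\<And>A. H A \<in> borel_measurable Q \<and> (\<forall>w\<in>space Q. ?h A w \<le> H A w) \<and> (\<integral>\<^sup>+ w. H A w \<partial>Q) = outer_nn_integral Q (?h A)"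
    by (rule that[OF someI_ex])
  have Hm [measurable]: "H A \<in> borel_measurable Q" for A using HH by blast
  have H: "?h A w \<le> H A w" if "w \<in> space Q" for A w using HH that by blast
  have HI: "(\<integral>\<^sup>+ w. H A w \<partial>Q) = outer_nn_integral Q (?h A)" for A using HH by blast
  define R where "R = PiE I (\<lambda>_. \<rat> :: real set)"
  have R: "countable R" unfolding R_def using I by (intro countable_PiE) (auto simp: countable_rat)
  have PI: "finite (Pow I)" using I by simp
  have main: "(\<Sum>A\<in>Pow I. outer_nn_integral Q (\<lambda>w. SUP t\<in>T. ennreal (\<Sum>i\<in>I. sign_on A i * \<phi> i w (v t i w))))
      \<le> ennreal L * (\<Sum>A\<in>Pow I. \<integral>\<^sup>+ w. H A w \<partial>Q) + ennreal (2 * L * 2 ^ card I * e)"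
    if e: "e > 0" for e
  proof -
    \<comment> \<open>The random polytope cut out by the majorants is a measurable superset of the
      (possibly non-measurable) set of vectors \<open>v t\<close>.\<close>
    define cond where "cond q w \<longleftrightarrow> (\<forall>A\<in>Pow I. ennreal (\<Sum>i\<in>I. sign_on A i * q i) \<le> H A w + ennreal e)" for q w
    define G where "G A w = (SUP q\<in>R. if cond q w then ennreal (\<Sum>i\<in>I. sign_on A i * \<phi> i w (q i)) else 0)" for A w
    have condm [measurable]: "Measurable.pred Q (cond q)" for q
      unfolding cond_def using PI by (intro pred_intros_finite) measurable
    have Gm [measurable]: "G A \<in> borel_measurable Q" for A
      unfolding G_def
      by (rule borel_measurable_SUP[OF R]) (use meas in measurable)
    have cl1: "(SUP t\<in>T. ennreal (\<Sum>i\<in>I. sign_on A i * \<phi> i w (v t i w))) \<le> G A w + ennreal (L * e)"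
      if w: "w \<in> space Q" for A w
    proof (rule SUP_least)
      fix t assume t: "t \<in> T"
      \<comment> \<open>Rounding each of \<open>card I\<close> coordinates by at most
        \<open>d\<close> costs at most \<open>e\<close> in every signed sum. The added 1 covers
        empty \<open>I\<close>.\<close>
      define d where "d = e / (real (card I) + 1)"
      have d: "d > 0" "real (card I) * d \<le> e" using e by (auto simp: d_def field_simps)
      have "\<exists>q\<in>\<rat>. \<bar>q - v t i w\<bar> \<le> d" for i
      proof -
        obtain q where "q \<in> \<rat>" "v t i w < q" "q < v t i w + d"
          using Rats_dense_in_real[of "v t i w" "v t i w + d"] d by auto
        then show ?thesis by (intro bexI[of _ q]) auto
      qed
      then obtain q0 where q0: "\<And>i. q0 i \<in> \<rat>" "\<And>i. \<bar>q0 i - v t i w\<bar> \<le> d" by metis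
      define q where "q = restrict q0 I"
      have q: "q \<in> R" "\<And>i. i \<in> I \<Longrightarrow> \<bar>q i - v t i w\<bar> \<le> d" using q0 by (auto simp: q_def R_def)
      have sgn: "\<bar>sign_on A i\<bar> = 1" for A and i :: 'i by (simp add: sign_on_def)
      have dist1: "(\<Sum>i\<in>I. sign_on B i * q i) \<le> (\<Sum>i\<in>I. sign_on B i * v t i w) + e" for B
      proof -
        have "(\<Sum>i\<in>I. sign_on B i * q i) - (\<Sum>i\<in>I. sign_on B i * v t i w) = (\<Sum>i\<in>I. sign_on B i * (q i - v t i w))"
          by (simp add: sum_subtractf algebra_simps)
        also have "\<dots> \<le> (\<Sum>i\<in>I. d)"
        proof (rule sum_mono)
          fix i assume "i \<in> I"
          have "sign_on B i * (q i - v t i w) \<le> \<bar>sign_on B i * (q i - v t i w)\<bar>" by simp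
          also have "\<dots> \<le> d" using q(2)[OF \<open>i \<in> I\<close>] by (simp add: abs_mult sgn)
          finally show "sign_on B i * (q i - v t i w) \<le> d" .
        qed
        finally show ?thesis using d by simp
      qed
      have dist2: "(\<Sum>i\<in>I. sign_on A i * \<phi> i w (v t i w)) \<le> (\<Sum>i\<in>I. sign_on A i * \<phi> i w (q i)) + L * e"
      proof -
        have "(\<Sum>i\<in>I. sign_on A i * \<phi> i w (v t i w)) - (\<Sum>i\<in>I. sign_on A i * \<phi> i w (q i))
          = (\<Sum>i\<in>I. sign_on A i * (\<phi> i w (v t i w) - \<phi> i w (q i)))"
          by (simp add: sum_subtractf algebra_simps)
        also have "\<dots> \<le> (\<Sum>i\<in>I. L * d)"
        proof (rule sum_mono)
          fix i assume i: "i \<in> I"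
          have "sign_on A i * (\<phi> i w (v t i w) - \<phi> i w (q i)) \<le> \<bar>sign_on A i * (\<phi> i w (v t i w) - \<phi> i w (q i))\<bar>" by simp
          also have "\<dots> \<le> L * \<bar>v t i w - q i\<bar>" using lip[OF i w] by (simp add: abs_mult sgn)
          also have "\<dots> \<le> L * d" using q(2)[OF i] L by (intro mult_left_mono) (auto simp: abs_minus_commute)
          finally show "sign_on A i * (\<phi> i w (v t i w) - \<phi> i w (q i)) \<le> L * d" .
        qed
        also have "\<dots> = L * (real (card I) * d)" by simp
        also have "\<dots> \<le> L * e" using d L by (intro mult_left_mono) auto
        finally show ?thesis by simp
      qed
      have "cond q w" unfolding cond_def
      proof
        fix B
        have "ennreal (\<Sum>i\<in>I. sign_on B i * q i) \<le> ennreal ((\<Sum>i\<in>I. sign_on B i * v t i w) + e)"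
          using dist1 by (rule ennreal_leI)
        also have "\<dots> \<le> ennreal (\<Sum>i\<in>I. sign_on B i * v t i w) + ennreal e"
          by (rule ennreal_add_le)
        also have "\<dots> \<le> H B w + ennreal e"
          by (intro add_right_mono order_trans[OF SUP_upper H[OF w]] t)
        finally show "ennreal (\<Sum>i\<in>I. sign_on B i * q i) \<le> H B w + ennreal e" .
      qed
      have "ennreal (\<Sum>i\<in>I. sign_on A i * \<phi> i w (v t i w)) \<le> ennreal ((\<Sum>i\<in>I. sign_on A i * \<phi> i w (q i)) + L * e)"
        using dist2 by (rule ennreal_leI)
      also have "\<dots> \<le> ennreal (\<Sum>i\<in>I. sign_on A i * \<phi> i w (q i)) + ennreal (L * e)"
        by (rule ennreal_add_le)
      also have "ennreal (\<Sum>i\<in>I. sign_on A i * \<phi> i w (q i)) \<le> G A w"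
        unfolding G_def using \<open>cond q w\<close> by (intro SUP_upper2[OF q(1)]) auto
      finally show "ennreal (\<Sum>i\<in>I. sign_on A i * \<phi> i w (v t i w)) \<le> G A w + ennreal (L * e)"
        by (simp add: add_right_mono)
    qed
    have cl2: "(\<Sum>A\<in>Pow I. G A w) \<le> ennreal L * (\<Sum>A\<in>Pow I. H A w + ennreal e)"
      if w: "w \<in> space Q" for w
    proof -
      define C where "C = {q \<in> R. cond q w}"
      \<comment> \<open>The zero vector lies in every such polytope and is the base point at which
        both contracted and uncontracted terms vanish.\<close>
      define q0 where "q0 = (\<lambda>i\<in>I. 0 :: real)"
      have q0: "q0 \<in> C" by (auto simp: C_def cond_def R_def q0_def)
      have "(\<Sum>A\<in>Pow I. G A w) \<le> (\<Sum>A\<in>Pow I. SUP q\<in>C. ennreal (\<Sum>i\<in>I. sign_on A i * \<phi> i w (q i)))"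
        unfolding G_def by (intro sum_mono SUP_least) (auto simp: C_def intro: SUP_upper)
      also have "\<dots> \<le> (\<Sum>A\<in>Pow I. SUP q\<in>C. ennreal (\<Sum>i\<in>I. sign_on A i * (L * q i)))"
        using lip[OF _ w] L
        by (intro contraction_ennreal[OF I q0])
           (auto simp: q0_def zero w abs_mult right_diff_distrib[symmetric])
      also have "\<dots> \<le> (\<Sum>A\<in>Pow I. ennreal L * (H A w + ennreal e))"
      proof (intro sum_mono SUP_least)
        fix A q assume A: "A \<in> Pow I" and q: "q \<in> C"
        have "(\<Sum>i\<in>I. sign_on A i * (L * q i)) = L * (\<Sum>i\<in>I. sign_on A i * q i)"
          by (simp add: sum_distrib_left ac_simps)
        then have "ennreal (\<Sum>i\<in>I. sign_on A i * (L * q i)) = ennreal L * ennreal (\<Sum>i\<in>I. sign_on A i * q i)"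
          using L by (simp add: ennreal_mult')
        also have "\<dots> \<le> ennreal L * (H A w + ennreal e)"
          using q A by (intro mult_left_mono) (auto simp: C_def cond_def)
        finally show "ennreal (\<Sum>i\<in>I. sign_on A i * (L * q i)) \<le> ennreal L * (H A w + ennreal e)" .
      qed
      finally show ?thesis by (simp add: sum_distrib_left)
    qed
    have "(\<Sum>A\<in>Pow I. outer_nn_integral Q (\<lambda>w. SUP t\<in>T. ennreal (\<Sum>i\<in>I. sign_on A i * \<phi> i w (v t i w))))
      \<le> (\<Sum>A\<in>Pow I. \<integral>\<^sup>+ w. G A w + ennreal (L * e) \<partial>Q)"
      by (intro sum_mono outer_nn_integral_le cl1) measurable
    also have "\<dots> = (\<Sum>A\<in>Pow I. \<integral>\<^sup>+ w. G A w \<partial>Q) + (\<Sum>A\<in>Pow I. ennreal (L * e))"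
      by (simp add: nn_integral_add Q.emeasure_space_1 sum.distrib)
    also have "\<dots> \<le> ennreal L * ((\<Sum>A\<in>Pow I. \<integral>\<^sup>+ w. H A w \<partial>Q) + (\<Sum>A\<in>Pow I. ennreal e))
        + (\<Sum>A\<in>Pow I. ennreal (L * e))"
    proof (rule add_right_mono)
      have "(\<Sum>A\<in>Pow I. \<integral>\<^sup>+ w. G A w \<partial>Q) = (\<integral>\<^sup>+ w. (\<Sum>A\<in>Pow I. G A w) \<partial>Q)"
        by (simp add: nn_integral_sum)
      also have "\<dots> \<le> (\<integral>\<^sup>+ w. ennreal L * (\<Sum>A\<in>Pow I. H A w + ennreal e) \<partial>Q)"
        by (intro nn_integral_mono cl2)
      also have "\<dots> = ennreal L * ((\<Sum>A\<in>Pow I. \<integral>\<^sup>+ w. H A w \<partial>Q) + (\<Sum>A\<in>Pow I. ennreal e))"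
        by (simp add: nn_integral_cmult nn_integral_sum nn_integral_add Q.emeasure_space_1 sum.distrib)
      finally show "(\<Sum>A\<in>Pow I. \<integral>\<^sup>+ w. G A w \<partial>Q)
        \<le> ennreal L * ((\<Sum>A\<in>Pow I. \<integral>\<^sup>+ w. H A w \<partial>Q) + (\<Sum>A\<in>Pow I. ennreal e))" .
    qed
    \<comment> \<open>One \<open>L * e\<close> pays for rounding to rationals, the other for
      widening the polytope by \<open>e\<close>. Both occur once per sign pattern.\<close>
    also have "\<dots> = ennreal L * (\<Sum>A\<in>Pow I. \<integral>\<^sup>+ w. H A w \<partial>Q) + ennreal (2 * L * 2 ^ card I * e)"
    proof -
      have c: "(\<Sum>A\<in>Pow I. ennreal x) = ennreal (2 ^ card I * x)" if "x \<ge> 0" for x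
        using that I by (subst sum_ennreal) (auto simp: card_Pow)
      have "ennreal L * ennreal (2 ^ card I * e) + ennreal (2 ^ card I * (L * e)) = ennreal (2 * L * 2 ^ card I * e)"
        using e L by (simp add: ennreal_mult[symmetric] ennreal_plus[symmetric] algebra_simps del: ennreal_plus)
      then show ?thesis using e L by (simp only: c distrib_left add.assoc mult_nonneg_nonneg less_imp_le)
    qed
    finally show ?thesis .
  qed
  show ?thesis unfolding HI[symmetric]
  proof (rule ennreal_le_epsilon)
    fix e :: real assume e: "0 < e"
    define d where "d = e / (2 * L * 2 ^ card I + 1)"
    have pos: "2 * L * 2 ^ card I + 1 > 0" using L by (simp add: add_nonneg_pos)
    have d: "d > 0" "2 * L * 2 ^ card I * d \<le> e"
      using e pos L by (auto simp: d_def field_simps)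
    have "(\<Sum>A\<in>Pow I. outer_nn_integral Q (\<lambda>w. SUP t\<in>T. ennreal (\<Sum>i\<in>I. sign_on A i * \<phi> i w (v t i w))))
      \<le> ennreal L * (\<Sum>A\<in>Pow I. \<integral>\<^sup>+ w. H A w \<partial>Q) + ennreal (2 * L * 2 ^ card I * d)" by (rule main[OF d(1)])
    also have "\<dots> \<le> ennreal L * (\<Sum>A\<in>Pow I. \<integral>\<^sup>+ w. H A w \<partial>Q) + ennreal e"
      using d by (intro add_left_mono ennreal_leI)
    finally show "(\<Sum>A\<in>Pow I. outer_nn_integral Q (\<lambda>w. SUP t\<in>T. ennreal (\<Sum>i\<in>I. sign_on A i * \<phi> i w (v t i w))))
      \<le> ennreal L * (\<Sum>A\<in>Pow I. \<integral>\<^sup>+ w. H A w \<partial>Q) + ennreal e" .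
  qed
qed

section \<open>Symmetrization on product spaces\<close>

lemma override_on_measurable [measurable]:
  "(\<lambda>p. override_on (fst p) (snd p) U) \<in> measurable (PiM J M \<Otimes>\<^sub>M PiM J M) (PiM J M)"
proof (rule measurable_PiM_single')
  fix i assume i: "i \<in> J"
  show "(\<lambda>p. override_on (fst p) (snd p) U i) \<in> measurable (PiM J M \<Otimes>\<^sub>M PiM J M) (M i)"
    using i by (cases "i \<in> U") simp_all
qed (auto simp: space_pair_measure space_PiM PiE_iff override_on_def extensional_def)

lemma override_on_space:
  "z \<in> space (PiM J M) \<Longrightarrow> z' \<in> space (PiM J M) \<Longrightarrow> override_on z z' U \<in> space (PiM J M)"
  by (auto simp: space_PiM PiE_iff override_on_def extensional_def)

text \<open>Resampling the coordinates in \<open>U\<close> from an independent copy preserves a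
  product law. On a box this is a factorization: the preimage is a box of constraints on the first
  copy times one on the second.\<close>

lemma (in product_prob_space) distr_override_on:
  assumes "finite J"
  shows "distr (PiM J M \<Otimes>\<^sub>M PiM J M) (PiM J M) (\<lambda>p. override_on (fst p) (snd p) U) = PiM J M"
proof (rule PiM_eqI)
  interpret J: finite_product_prob_space M J by standard fact
  fix A assume A: "\<And>i. i \<in> J \<Longrightarrow> A i \<in> sets (M i)"
  define A1 where "A1 i = (if i \<in> U then space (M i) else A i)" for i
  define A2 where "A2 i = (if i \<in> U then A i else space (M i))" for i
  have A12: "A1 i \<in> sets (M i)" "A2 i \<in> sets (M i)" if "i \<in> J" for i
    using A[OF that] by (auto simp: A1_def A2_def)
  have As: "A i \<subseteq> space (M i)" if "i \<in> J" for i using sets.sets_into_space[OF A[OF that]] .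
  have "(\<lambda>p. override_on (fst p) (snd p) U) -` PiE J A \<inter> space (PiM J M \<Otimes>\<^sub>M PiM J M) = PiE J A1 \<times> PiE J A2"
    (is "?L = ?R")
  proof (intro equalityI subsetI)
    fix p assume "p \<in> ?L"
    then have p: "fst p \<in> PiE J (\<lambda>i. space (M i))" "snd p \<in> PiE J (\<lambda>i. space (M i))"
      "\<forall>i\<in>J. override_on (fst p) (snd p) U i \<in> A i"
      by (simp_all add: space_pair_measure space_PiM PiE_iff mem_Times_iff)
    then have "fst p \<in> PiE J A1" "snd p \<in> PiE J A2"
      by (auto simp: PiE_iff A1_def A2_def override_on_def split: if_splits)
    then show "p \<in> ?R" by (simp add: mem_Times_iff)
  next
    fix p assume "p \<in> ?R"
    then have "fst p \<in> PiE J A1" "snd p \<in> PiE J A2" by auto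
    then have p: "fst p \<in> extensional J" "snd p \<in> extensional J"
      "\<And>i. i \<in> J \<Longrightarrow> fst p i \<in> A1 i \<and> snd p i \<in> A2 i" by (auto simp: PiE_iff)
    have "fst p i \<in> space (M i) \<and> snd p i \<in> space (M i) \<and> override_on (fst p) (snd p) U i \<in> A i" if "i \<in> J" for i
      using p(3)[OF that] As[OF that] by (auto simp: A1_def A2_def override_on_def split: if_splits)
    then show "p \<in> ?L"
      using p(1,2) by (auto simp: space_pair_measure space_PiM PiE_iff extensional_def override_on_def mem_Times_iff)
  qed
  moreover have "PiE J A \<in> sets (PiM J M)" using A by (rule sets_PiM_I_finite[OF assms])
  moreover have "emeasure (PiM J M \<Otimes>\<^sub>M PiM J M) (PiE J A1 \<times> PiE J A2)
    = emeasure (PiM J M) (PiE J A1) * emeasure (PiM J M) (PiE J A2)"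
    by (rule J.emeasure_pair_measure_Times; rule sets_PiM_I_finite[OF assms A12(1)] sets_PiM_I_finite[OF assms A12(2)])
  moreover have "\<dots> = (\<Prod>i\<in>J. emeasure (M i) (A1 i)) * (\<Prod>i\<in>J. emeasure (M i) (A2 i))"
    by (simp add: emeasure_PiM[OF assms A12(1)] emeasure_PiM[OF assms A12(2)])
  moreover have "\<dots> = (\<Prod>i\<in>J. emeasure (M i) (A i))"
    unfolding prod.distrib[symmetric]
    by (intro prod.cong refl) (auto simp: A1_def A2_def M.emeasure_space_1)
  ultimately show "emeasure (distr (PiM J M \<Otimes>\<^sub>M PiM J M) (PiM J M) (\<lambda>p. override_on (fst p) (snd p) U)) (PiE J A)
    = (\<Prod>i\<in>J. emeasure (M i) (A i))"
    by (simp add: emeasure_distr)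
qed (use assms in simp_all)

lemma (in product_prob_space) nn_integral_override_on:
  assumes J: "finite J" and H [measurable]: "H \<in> borel_measurable (PiM J M)"
  shows "(\<integral>\<^sup>+ p. H (override_on (fst p) (snd p) U) \<partial>(PiM J M \<Otimes>\<^sub>M PiM J M)) = (\<integral>\<^sup>+ z. H z \<partial>PiM J M)"
  by (subst (2) distr_override_on[OF J, of U, symmetric]) (simp add: nn_integral_distr)

text \<open>Jensen's inequality for the positive part, since \<open>ennreal\<close> truncates at
  0.\<close>

lemma ennreal_integral_le_nn_integral:
  assumes "integrable M f"
  shows "ennreal (\<integral>x. f x \<partial>M) \<le> (\<integral>\<^sup>+ x. ennreal (f x) \<partial>M)"
proof -
  have "ennreal (\<integral>x. f x \<partial>M) \<le> ennreal (\<integral>x. max 0 (f x) \<partial>M)"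
    using assms by (intro ennreal_leI integral_mono) auto
  also have "\<dots> = (\<integral>\<^sup>+ x. ennreal (max 0 (f x)) \<partial>M)"
    using assms by (intro nn_integral_eq_integral[symmetric]) auto
  also have "\<dots> = (\<integral>\<^sup>+ x. ennreal (f x) \<partial>M)"
    by (intro nn_integral_cong) (auto simp: max_def ennreal_neg)
  finally show ?thesis .
qed

text \<open>For each sign set A, exchanging the blocks of A between z and a second sample z' splits
  the difference into two signed sums, with signs A and \<open>KK - A\<close>, at two exchanged
  points. By \<open>dep\<close> the exchange acts block by block. Both points have the law
  \<open>PiM J M\<close>, so least majorants of the signed suprema can be integrated along them. The
  two halves give the factor 2.\<close>

lemma (in product_prob_space) outer_symmetrization:
  fixes g :: "'t \<Rightarrow> 'k \<Rightarrow> ('i \<Rightarrow> 'a) \<Rightarrow> real"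
  assumes J: "finite J" and KK: "finite KK"
    and disj: "\<And>k k'. k \<in> KK \<Longrightarrow> k' \<in> KK \<Longrightarrow> k \<noteq> k' \<Longrightarrow> B k \<inter> B k' = {}"
    and dep: "\<And>t k z z'. t \<in> T \<Longrightarrow> k \<in> KK \<Longrightarrow> z \<in> space (PiM J M) \<Longrightarrow> z' \<in> space (PiM J M)
      \<Longrightarrow> (\<And>i. i \<in> B k \<Longrightarrow> z i = z' i) \<Longrightarrow> g t k z = g t k z'"
    and int: "\<And>t k. t \<in> T \<Longrightarrow> k \<in> KK \<Longrightarrow> integrable (PiM J M) (g t k)"
  shows "outer_nn_integral (PiM J M) (\<lambda>z. SUP t\<in>T. ennreal (\<Sum>k\<in>KK. g t k z - (\<integral>z'. g t k z' \<partial>PiM J M)))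
    \<le> ennreal (2 / 2 ^ card KK) *
      (\<Sum>A\<in>Pow KK. outer_nn_integral (PiM J M) (\<lambda>z. SUP t\<in>T. ennreal (\<Sum>k\<in>KK. sign_on A k * g t k z)))"
proof -
  interpret J: finite_product_prob_space M J by standard fact
  let ?P = "PiM J M"
  have P1: "measure ?P (space ?P) = 1" by (rule prob_space.prob_space, rule prob_space_PiM, rule prob_space)
  let ?h = "\<lambda>A z. SUP t\<in>T. ennreal (\<Sum>k\<in>KK. sign_on A k * g t k z)"
  have "\<exists>g. g \<in> borel_measurable ?P \<and> (\<forall>w\<in>space ?P. ?h A w \<le> g w) \<and> (\<integral>\<^sup>+ w. g w \<partial>?P) = outer_nn_integral ?P (?h A)" for A
    by (rule outer_nn_integral_attained[of ?P "?h A"]) blast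
  then obtain H where HH: "\<And>A. H A \<in> borel_measurable ?P \<and> (\<forall>w\<in>space ?P. ?h A w \<le> H A w) \<and> (\<integral>\<^sup>+ w. H A w \<partial>?P) = outer_nn_integral ?P (?h A)"
    by (rule that[OF someI_ex])
  have Hm [measurable]: "H A \<in> borel_measurable ?P" for A using HH by blast
  have H: "ennreal (\<Sum>k\<in>KK. sign_on A k * g t k z) \<le> H A z" if "z \<in> space ?P" "t \<in> T" for A z t
  proof -
    have "ennreal (\<Sum>k\<in>KK. sign_on A k * g t k z) \<le> ?h A z" by (rule SUP_upper) fact
    also have "\<dots> \<le> H A z" using HH that by blast
    finally show ?thesis .
  qed
  have HI: "(\<integral>\<^sup>+ w. H A w \<partial>?P) = outer_nn_integral ?P (?h A)" for A using HH by blast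
  define U where "U A = (\<Union>k\<in>A. B k)" for A
  define c where "c = ennreal (1 / 2 ^ card KK)"
  \<comment> \<open>On a block of A the first point carries z' with sign -1 and the second z with
    sign 1; on the other blocks the first carries z with sign 1 and the second z' with sign -1.
    Either way the block contributes its value at z minus its value at z'.\<close>
  define G where "G z z' = c * (\<Sum>A\<in>Pow KK. H A (override_on z z' (U A)) + H (KK - A) (override_on z z' (- U A)))" for z z'
  have D: "ennreal (\<Sum>k\<in>KK. g t k z - g t k z') \<le> H A (override_on z z' (U A)) + H (KK - A) (override_on z z' (- U A))"
    if A: "A \<in> Pow KK" and z: "z \<in> space ?P" "z' \<in> space ?P" and t: "t \<in> T" for A z z' t
  proof -
    have "g t k z - g t k z' = sign_on A k * g t k (override_on z z' (U A)) + sign_on (KK - A) k * g t k (override_on z z' (- U A))"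
      if k: "k \<in> KK" for k
    proof (cases "k \<in> A")
      case True
      then have "g t k (override_on z z' (U A)) = g t k z'" "g t k (override_on z z' (- U A)) = g t k z"
        using z by (intro dep t k override_on_space; auto simp: override_on_def U_def)+
      then show ?thesis using True by (simp add: sign_on_def)
    next
      case False
      then have "i \<notin> U A" if "i \<in> B k" for i using disj k A that by (auto simp: U_def)
      then have "g t k (override_on z z' (U A)) = g t k z" "g t k (override_on z z' (- U A)) = g t k z'"
        using z by (intro dep t k override_on_space; auto simp: override_on_def)+
      then show ?thesis using False k by (simp add: sign_on_def)
    qed
    then have "(\<Sum>k\<in>KK. g t k z - g t k z') = (\<Sum>k\<in>KK. sign_on A k * g t k (override_on z z' (U A)))
        + (\<Sum>k\<in>KK. sign_on (KK - A) k * g t k (override_on z z' (- U A)))"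
      by (simp add: sum.distrib[symmetric])
    also have "ennreal \<dots> \<le> ennreal (\<Sum>k\<in>KK. sign_on A k * g t k (override_on z z' (U A)))
        + ennreal (\<Sum>k\<in>KK. sign_on (KK - A) k * g t k (override_on z z' (- U A)))"
      by (rule ennreal_add_le)
    also have "\<dots> \<le> H A (override_on z z' (U A)) + H (KK - A) (override_on z z' (- U A))"
      by (intro add_mono H override_on_space z t)
    finally show ?thesis .
  qed
  have DG: "ennreal (\<Sum>k\<in>KK. g t k z - g t k z') \<le> G z z'"
    if z: "z \<in> space ?P" "z' \<in> space ?P" and t: "t \<in> T" for z z' t
  proof -
    let ?d = "ennreal (\<Sum>k\<in>KK. g t k z - g t k z')"
    have "?d = c * (\<Sum>A\<in>Pow KK. ?d)"
    proof -
      have "c * ennreal (2 ^ card KK) = 1"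
        unfolding c_def by (subst ennreal_mult[symmetric]) auto
      then have "c * of_nat (2 ^ card KK) = 1" by (simp add: ennreal_of_nat_eq_real_of_nat)
      then show ?thesis using KK by (simp add: card_Pow mult.assoc[symmetric])
    qed
    also have "\<dots> \<le> G z z'" unfolding G_def
      by (intro mult_left_mono sum_mono D z t) auto
    finally show ?thesis .
  qed
  have Gm [measurable]: "case_prod G \<in> borel_measurable (?P \<Otimes>\<^sub>M ?P)"
    unfolding G_def case_prod_beta by measurable
  have "outer_nn_integral ?P (\<lambda>z. SUP t\<in>T. ennreal (\<Sum>k\<in>KK. g t k z - (\<integral>z'. g t k z' \<partial>?P)))
    \<le> (\<integral>\<^sup>+ z. \<integral>\<^sup>+ z'. G z z' \<partial>?P \<partial>?P)"
  proof (rule outer_nn_integral_le)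
    fix z assume z: "z \<in> space ?P"
    show "(SUP t\<in>T. ennreal (\<Sum>k\<in>KK. g t k z - (\<integral>z'. g t k z' \<partial>?P))) \<le> (\<integral>\<^sup>+ z'. G z z' \<partial>?P)"
    proof (rule SUP_least)
      fix t assume t: "t \<in> T"
      \<comment> \<open>The centring constant is an integral over the second sample, so Jensen
        applies.\<close>
      have "(\<Sum>k\<in>KK. g t k z - (\<integral>z'. g t k z' \<partial>?P)) = (\<integral>z'. (\<Sum>k\<in>KK. g t k z - g t k z') \<partial>?P)"
        using int[OF t] by (simp add: Bochner_Integration.integral_sum P1)
      also have "ennreal \<dots> \<le> (\<integral>\<^sup>+ z'. ennreal (\<Sum>k\<in>KK. g t k z - g t k z') \<partial>?P)"
        using int[OF t] by (intro ennreal_integral_le_nn_integral) auto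
      also have "\<dots> \<le> (\<integral>\<^sup>+ z'. G z z' \<partial>?P)" by (intro nn_integral_mono DG z t)
      finally show "ennreal (\<Sum>k\<in>KK. g t k z - (\<integral>z'. g t k z' \<partial>?P)) \<le> (\<integral>\<^sup>+ z'. G z z' \<partial>?P)" .
    qed
  qed measurable
  also have "\<dots> = (\<integral>\<^sup>+ p. G (fst p) (snd p) \<partial>(?P \<Otimes>\<^sub>M ?P))"
    using J.nn_integral_fst[OF Gm] by (simp add: case_prod_unfold)
  also have "\<dots> = c * (\<Sum>A\<in>Pow KK. (\<integral>\<^sup>+ p. H A (override_on (fst p) (snd p) (U A)) \<partial>(?P \<Otimes>\<^sub>M ?P))
      + (\<integral>\<^sup>+ p. H (KK - A) (override_on (fst p) (snd p) (- U A)) \<partial>(?P \<Otimes>\<^sub>M ?P)))"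
    unfolding G_def by (simp add: nn_integral_cmult nn_integral_sum nn_integral_add)
  also have "\<dots> = c * ((\<Sum>A\<in>Pow KK. \<integral>\<^sup>+ z. H A z \<partial>?P) + (\<Sum>A\<in>Pow KK. \<integral>\<^sup>+ z. H (KK - A) z \<partial>?P))"
    by (simp add: nn_integral_override_on J sum.distrib)
  \<comment> \<open>Complementation permutes \<open>Pow KK\<close>, so both halves have the same
    sum.\<close>
  also have "(\<Sum>A\<in>Pow KK. \<integral>\<^sup>+ z. H (KK - A) z \<partial>?P) = (\<Sum>A\<in>Pow KK. \<integral>\<^sup>+ z. H A z \<partial>?P)"
    by (rule sum.reindex_bij_witness[where i = "\<lambda>A. KK - A" and j = "\<lambda>A. KK - A"]) auto
  also have "c * ((\<Sum>A\<in>Pow KK. \<integral>\<^sup>+ z. H A z \<partial>?P) + (\<Sum>A\<in>Pow KK. \<integral>\<^sup>+ z. H A z \<partial>?P))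
      = ennreal (2 / 2 ^ card KK) * (\<Sum>A\<in>Pow KK. \<integral>\<^sup>+ z. H A z \<partial>?P)"
  proof -
    have "ennreal (2 / 2 ^ card KK) = c + c"
      unfolding c_def by (subst ennreal_plus[symmetric]) auto
    then show ?thesis by (simp add: distrib_left distrib_right)
  qed
  finally show ?thesis unfolding HI .
qed

section \<open>Concentration under block-wise bounded differences\<close>

lemma merge_in_space:
  "u \<in> space (PiM I M) \<Longrightarrow> v \<in> space (PiM J M) \<Longrightarrow> merge I J (u, v) \<in> space (PiM (I \<union> J) M)"
  by (auto simp: space_PiM PiE_iff merge_def extensional_def)

text \<open>McDiarmid's induction: integrate out the last block, whose conditional mean
  \<open>gh\<close> inherits the bounded differences in the other blocks, and apply Hoeffding's
  lemma to the last block around \<open>gh\<close>. The differences are bounded only for almost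
  every \<open>z\<close>, since the function in view is a majorant determined up to null sets. Hence
  the repeated exchange of almost-everywhere quantifiers.\<close>

lemma (in product_prob_space) bounded_difference_mgf:
  assumes "finite KK" and l: "l > 0" and "\<And>k. k \<in> KK \<Longrightarrow> finite (B k)"
    and "\<And>k k'. k \<in> KK \<Longrightarrow> k' \<in> KK \<Longrightarrow> k \<noteq> k' \<Longrightarrow> B k \<inter> B k' = {}"
    and "g \<in> borel_measurable (PiM (\<Union>k\<in>KK. B k) M)"
    and "\<And>z. z \<in> space (PiM (\<Union>k\<in>KK. B k) M) \<Longrightarrow> \<bar>g z\<bar> \<le> C"
    and "\<And>k z'. k \<in> KK \<Longrightarrow> z' \<in> space (PiM (\<Union>k\<in>KK. B k) M) \<Longrightarrow>
      AE z in PiM (\<Union>k\<in>KK. B k) M. g z \<le> g (override_on z z' (B k)) + 1"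
  shows "(\<integral>\<^sup>+ z. ennreal (exp (l * (g z - (\<integral>z. g z \<partial>PiM (\<Union>k\<in>KK. B k) M)))) \<partial>PiM (\<Union>k\<in>KK. B k) M)
    \<le> ennreal (exp (l\<^sup>2 / 2 * real (card KK)))"
  using assms(1,3-)
proof (induction KK arbitrary: g rule: finite_induct)
  case empty
  have s: "space (PiM {} M) = {\<lambda>_. undefined}" by (simp add: space_PiM)
  interpret E: prob_space "PiM {} M" by (rule prob_space_PiM) (rule prob_space)
  have "(\<integral>z. g z \<partial>PiM {} M) = (\<integral>z. g (\<lambda>_. undefined) \<partial>PiM {} M)"
    by (rule Bochner_Integration.integral_cong) (auto simp: s)
  also have "\<dots> = g (\<lambda>_. undefined)" by (simp add: E.prob_space)
  finally have "(\<integral>\<^sup>+ z. ennreal (exp (l * (g z - (\<integral>z. g z \<partial>PiM {} M)))) \<partial>PiM {} M) = (\<integral>\<^sup>+ z. 1 \<partial>PiM {} M)"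
    by (intro nn_integral_cong) (auto simp: s)
  then show ?case by (simp add: E.emeasure_space_1)
next
  case (insert k KK)
  define I where "I = (\<Union>k\<in>KK. B k)"
  define J where "J = I \<union> B k"
  have Jeq: "(\<Union>k\<in>insert k KK. B k) = J" by (auto simp: J_def I_def)
  have fin: "finite I" "finite (B k)" "finite J" using insert by (auto simp: I_def J_def)
  have dis: "I \<inter> B k = {}" using insert(2) insert.prems(2) by (fastforce simp: I_def)
  note prems = insert.prems[unfolded Jeq]
  have gm [measurable]: "g \<in> borel_measurable (PiM J M)" by (rule prems(3))
  interpret PI: prob_space "PiM I M" by (rule prob_space_PiM) (rule prob_space)
  interpret PB: prob_space "PiM (B k) M" by (rule prob_space_PiM) (rule prob_space)
  interpret PJ: prob_space "PiM J M" by (rule prob_space_PiM) (rule prob_space)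
  interpret D: pair_prob_space "PiM I M" "PiM (B k) M" ..
  interpret BB: pair_prob_space "PiM (B k) M" "PiM (B k) M" ..
  interpret DB: pair_prob_space "PiM I M \<Otimes>\<^sub>M PiM (B k) M" "PiM (B k) M" ..
  let ?m = "merge I (B k)"
  have mm [measurable]: "?m \<in> measurable (PiM I M \<Otimes>\<^sub>M PiM (B k) M) (PiM J M)"
    unfolding J_def by (rule measurable_merge)
  have dm: "distr (PiM I M \<Otimes>\<^sub>M PiM (B k) M) (PiM J M) ?m = PiM J M"
    unfolding J_def by (rule distr_merge[OF dis fin(1,2)])
  have ms: "?m (u, v) \<in> space (PiM J M)" if "u \<in> space (PiM I M)" "v \<in> space (PiM (B k) M)" for u v
    unfolding J_def by (rule merge_in_space[OF that])
  define gh where "gh u = (\<integral>v. g (?m (u, v)) \<partial>PiM (B k) M)" for u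
  have gmm [measurable]: "(\<lambda>p. g (?m p)) \<in> borel_measurable (PiM I M \<Otimes>\<^sub>M PiM (B k) M)" by measurable
  have gsec [measurable]: "(\<lambda>v. g (?m (u, v))) \<in> borel_measurable (PiM (B k) M)" if "u \<in> space (PiM I M)" for u
    using measurable_compose[OF measurable_Pair1'[OF that] gmm] .
  have gi: "integrable (PiM (B k) M) (\<lambda>v. g (?m (u, v)))" if u: "u \<in> space (PiM I M)" for u
    by (rule PB.integrable_const_bound[where B = C]) (use prems(4) ms[OF u] gsec[OF u] in auto)
  have gJ: "integrable (PiM J M) g"
    by (rule PJ.integrable_const_bound[where B = C]) (use prems(4) in auto)
  have ghm [measurable]: "gh \<in> borel_measurable (PiM I M)"
    unfolding gh_def by (rule PB.borel_measurable_lebesgue_integral) (simp add: case_prod_beta)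
  have ghb: "\<bar>gh u\<bar> \<le> C" if u: "u \<in> space (PiM I M)" for u
  proof -
    have "\<bar>gh u\<bar> \<le> (\<integral>v. \<bar>g (?m (u, v))\<bar> \<partial>PiM (B k) M)" unfolding gh_def by (rule integral_abs_bound)
    also have "\<dots> \<le> (\<integral>v. C \<partial>PiM (B k) M)"
      by (rule integral_mono) (use gi[OF u] prems(4) ms[OF u] in auto)
    finally show ?thesis by (simp add: PB.prob_space)
  qed
  have Eg: "(\<integral>z. g z \<partial>PiM J M) = (\<integral>u. gh u \<partial>PiM I M)"
    using product_integral_fold[OF dis fin(1,2), of g] gJ by (simp add: J_def gh_def)
  have AEp: "AE p in PiM I M \<Otimes>\<^sub>M PiM (B k) M. g (?m p) \<le> g (override_on (?m p) z' (B k')) + 1"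
    if "k' \<in> insert k KK" "z' \<in> space (PiM J M)" for k' z'
  proof -
    have "(\<lambda>z. override_on (fst (z, z')) (snd (z, z')) (B k')) \<in> measurable (PiM J M) (PiM J M)"
      by (rule measurable_compose[OF measurable_Pair2'[OF that(2)] override_on_measurable])
    then have om [measurable]: "(\<lambda>z. override_on z z' (B k')) \<in> measurable (PiM J M) (PiM J M)" by simp
    have "AE z in distr (PiM I M \<Otimes>\<^sub>M PiM (B k) M) (PiM J M) ?m. g z \<le> g (override_on z z' (B k')) + 1"
      unfolding dm by (rule prems(5)[OF that])
    then show ?thesis by (subst (asm) AE_distr_iff) auto
  qed
  have IH: "(\<integral>\<^sup>+ u. ennreal (exp (l * (gh u - (\<integral>u. gh u \<partial>PiM I M)))) \<partial>PiM I M) \<le> ennreal (exp (l\<^sup>2 / 2 * real (card KK)))"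
    unfolding I_def
  proof (rule insert.IH; (fold I_def)?)
    show "gh \<in> borel_measurable (PiM I M)" by (rule ghm)
    show "\<bar>gh u\<bar> \<le> C" if "u \<in> space (PiM I M)" for u by (rule ghb[OF that])
    fix k' u' assume k': "k' \<in> KK" and u': "u' \<in> space (PiM I M)"
    \<comment> \<open>Any point will do: overriding the block of k' inside \<open>I\<close> never
      reads the last block.\<close>
    obtain v0 where v0: "v0 \<in> space (PiM (B k) M)" using PB.not_empty by (metis ex_in_conv)
    have Bk': "B k' \<subseteq> I" using k' by (auto simp: I_def)
    have "AE p in PiM I M \<Otimes>\<^sub>M PiM (B k) M. g (?m p) \<le> g (override_on (?m p) (?m (u', v0)) (B k')) + 1"
      by (rule AEp) (use k' ms[OF u' v0] in auto)
    from D.AE_pair[OF this]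
    have "AE u in PiM I M. AE v in PiM (B k) M. g (?m (u, v)) \<le> g (override_on (?m (u, v)) (?m (u', v0)) (B k')) + 1" .
    from this AE_space show "AE u in PiM I M. gh u \<le> gh (override_on u u' (B k')) + 1"
    proof eventually_elim
      case (elim u)
      have o: "override_on u u' (B k') \<in> space (PiM I M)" by (rule override_on_space[OF elim(2) u'])
      have "override_on (?m (u, v)) (?m (u', v0)) (B k') = ?m (override_on u u' (B k'), v)" for v
        using Bk' dis by (auto simp: merge_def override_on_def fun_eq_iff)
      then have "AE v in PiM (B k) M. g (?m (u, v)) \<le> g (?m (override_on u u' (B k'), v)) + 1"
        using elim(1) by simp
      then have "gh u \<le> (\<integral>v. g (?m (override_on u u' (B k'), v)) + 1 \<partial>PiM (B k) M)"
        unfolding gh_def using gi[OF elim(2)] gi[OF o] by (intro integral_mono_AE) auto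
      also have "\<dots> = gh (override_on u u' (B k')) + 1"
        unfolding gh_def using gi[OF o] by (simp add: PB.prob_space)
      finally show ?case .
    qed
  qed (use insert in auto)
  have AEk: "AE u in PiM I M. AE v in PiM (B k) M. AE v' in PiM (B k) M. g (?m (u, v)) \<le> g (?m (u, v')) + 1"
  proof -
    \<comment> \<open>Any point will do: overriding the last block keeps the
      \<open>I\<close>-coordinates of \<open>p\<close> and reads only v'.\<close>
    obtain u0 where u0: "u0 \<in> space (PiM I M)" using PI.not_empty by (metis ex_in_conv)
    have "AE p in PiM I M \<Otimes>\<^sub>M PiM (B k) M. g (?m p) \<le> g (?m (fst p, v')) + 1"
      if v': "v' \<in> space (PiM (B k) M)" for v'
    proof -
      have "override_on (?m p) (?m (u0, v')) (B k) = ?m (fst p, v')" if "p \<in> space (PiM I M \<Otimes>\<^sub>M PiM (B k) M)" for p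
        using that dis v' by (auto simp: merge_def override_on_def fun_eq_iff space_pair_measure space_PiM PiE_iff extensional_def)
      then show ?thesis
        using AEp[of k "?m (u0, v')"] ms[OF u0 v'] by (auto elim!: AE_mp intro!: AE_I2)
    qed
    then have "AE v' in PiM (B k) M. AE p in PiM I M \<Otimes>\<^sub>M PiM (B k) M. g (?m p) \<le> g (?m (fst p, v')) + 1"
      by (rule AE_I2)
    then have "AE p in PiM I M \<Otimes>\<^sub>M PiM (B k) M. AE v' in PiM (B k) M. g (?m p) \<le> g (?m (fst p, v')) + 1"
      by (subst DB.AE_commute) measurable
    from D.AE_pair[OF this] show ?thesis by simp
  qed
  have hoeff: "AE u in PiM I M. (\<integral>\<^sup>+ v. ennreal (exp (l * (g (?m (u, v)) - gh u))) \<partial>PiM (B k) M) \<le> ennreal (exp (l\<^sup>2 / 2))"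
    using AEk AE_space
  proof eventually_elim
    case (elim u)
    note [measurable] = gsec[OF elim(2)]
    have a1: "AE v in PiM (B k) M. g (?m (u, v)) \<le> gh u + 1"
      using elim(1)
    proof eventually_elim
      case (elim v)
      have "(\<integral>v'. g (?m (u, v)) \<partial>PiM (B k) M) \<le> (\<integral>v'. g (?m (u, v')) + 1 \<partial>PiM (B k) M)"
        using elim gi[OF \<open>u \<in> _\<close>] by (intro integral_mono_AE) auto
      then show ?case using gi[OF \<open>u \<in> _\<close>] by (simp add: gh_def PB.prob_space)
    qed
    \<comment> \<open>Exchanging the quantifiers and integrating over v turns the same inequality
      into a lower bound at v'.\<close>
    have "AE v' in PiM (B k) M. AE v in PiM (B k) M. g (?m (u, v)) \<le> g (?m (u, v')) + 1"
      using elim(1) by (subst BB.AE_commute) measurable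
    then have a2: "AE v in PiM (B k) M. gh u \<le> g (?m (u, v)) + 1"
    proof eventually_elim
      case (elim v')
      have "(\<integral>v. g (?m (u, v)) \<partial>PiM (B k) M) \<le> (\<integral>v. g (?m (u, v')) + 1 \<partial>PiM (B k) M)"
        using elim gi[OF \<open>u \<in> _\<close>] by (intro integral_mono_AE) auto
      then show ?case by (simp add: gh_def PB.prob_space)
    qed
    \<comment> \<open>The section stays within 1 of its mean. An interval of length 2 in Hoeffding's
      lemma gives l^2 * 4 / 8 = l^2 / 2.\<close>
    interpret X: interval_bounded_random_variable "PiM (B k) M" "\<lambda>v. g (?m (u, v))" "gh u - 1" "gh u + 1"
    proof
      show "AE v in PiM (B k) M. g (?m (u, v)) \<in> {gh u - 1..gh u + 1}"
        using a1 a2 by eventually_elim auto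
    qed measurable
    have "(\<integral>\<^sup>+ v. ennreal (exp (l * (g (?m (u, v)) - gh u))) \<partial>PiM (B k) M)
      \<le> ennreal (exp (l\<^sup>2 * (gh u + 1 - (gh u - 1))\<^sup>2 / 8))"
      using X.Hoeffdings_lemma_nn_integral[OF l] by (simp add: gh_def)
    then show ?case by (simp add: power2_eq_square)
  qed
  have "(\<integral>\<^sup>+ z. ennreal (exp (l * (g z - (\<integral>z. g z \<partial>PiM J M)))) \<partial>PiM J M)
    = (\<integral>\<^sup>+ u. \<integral>\<^sup>+ v. ennreal (exp (l * (g (?m (u, v)) - (\<integral>z. g z \<partial>PiM J M)))) \<partial>PiM (B k) M \<partial>PiM I M)"
    unfolding J_def by (rule product_nn_integral_fold[OF dis fin(1,2)]) (use gm in \<open>simp add: J_def\<close>)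
  also have "\<dots> = (\<integral>\<^sup>+ u. ennreal (exp (l * (gh u - (\<integral>u. gh u \<partial>PiM I M))))
      * (\<integral>\<^sup>+ v. ennreal (exp (l * (g (?m (u, v)) - gh u))) \<partial>PiM (B k) M) \<partial>PiM I M)"
  proof (rule nn_integral_cong)
    fix u assume u: "u \<in> space (PiM I M)"
    note [measurable] = gsec[OF u]
    show "(\<integral>\<^sup>+ v. ennreal (exp (l * (g (?m (u, v)) - (\<integral>z. g z \<partial>PiM J M)))) \<partial>PiM (B k) M)
      = ennreal (exp (l * (gh u - (\<integral>u. gh u \<partial>PiM I M)))) * (\<integral>\<^sup>+ v. ennreal (exp (l * (g (?m (u, v)) - gh u))) \<partial>PiM (B k) M)"
      by (subst nn_integral_cmult[symmetric])
         (auto simp: Eg ennreal_mult[symmetric] exp_add[symmetric] algebra_simps)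
  qed
  also have "\<dots> \<le> (\<integral>\<^sup>+ u. ennreal (exp (l * (gh u - (\<integral>u. gh u \<partial>PiM I M)))) * ennreal (exp (l\<^sup>2 / 2)) \<partial>PiM I M)"
    by (rule nn_integral_mono_AE, use hoeff in eventually_elim) (auto intro: mult_left_mono)
  also have "\<dots> \<le> ennreal (exp (l\<^sup>2 / 2 * real (card KK))) * ennreal (exp (l\<^sup>2 / 2))"
    using mult_right_mono[OF IH, of "ennreal (exp (l\<^sup>2 / 2))"] by (simp add: nn_integral_multc)
  also have "\<dots> = ennreal (exp (l\<^sup>2 / 2 * real (card (insert k KK))))"
    using insert by (simp add: ennreal_mult[symmetric] exp_add[symmetric] algebra_simps add_divide_distrib)
  finally show ?case unfolding Jeq .
qed

text \<open>Chernoff's bound for a least measurable majorant of \<open>S\<close>, whose mean is the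
  outer mean. Where the majorant is small, \<open>S\<close> is small, and that set is measurable.
  The deviation \<open>x\<close> per block also serves as the exponential parameter.\<close>

lemma (in product_prob_space) outer_concentration:
  fixes S :: "('i \<Rightarrow> 'a) \<Rightarrow> ennreal"
  assumes KK: "finite KK" and B: "\<And>k. k \<in> KK \<Longrightarrow> finite (B k)"
    "\<And>k k'. k \<in> KK \<Longrightarrow> k' \<in> KK \<Longrightarrow> k \<noteq> k' \<Longrightarrow> B k \<inter> B k' = {}"
    and J: "J = (\<Union>k\<in>KK. B k)"
    and bound: "\<And>z. z \<in> space (PiM J M) \<Longrightarrow> S z \<le> ennreal C"
    and diff: "\<And>z z' k. z \<in> space (PiM J M) \<Longrightarrow> z' \<in> space (PiM J M) \<Longrightarrow> k \<in> KK
      \<Longrightarrow> S z \<le> S (override_on z z' (B k)) + 1"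
    and mean: "outer_nn_integral (PiM J M) S \<le> ennreal m" and m: "0 \<le> m" and x: "0 < x"
  shows "\<exists>A\<in>sets (PiM J M). measure (PiM J M) A \<ge> 1 - exp (- (x\<^sup>2 / 2 * real (card KK))) \<and>
    (\<forall>z\<in>A. S z < ennreal (m + real (card KK) * x))"
proof (cases "KK = {}")
  case True
  then show ?thesis by auto
next
  case False
  then have n: "real (card KK) > 0" using KK by (simp add: card_gt_0_iff)
  interpret PP: prob_space "PiM J M" by (rule prob_space_PiM) (rule prob_space)
  let ?P = "PiM J M"
  obtain g0 where g0 [measurable]: "g0 \<in> borel_measurable ?P" and g0S: "\<And>z. z \<in> space ?P \<Longrightarrow> S z \<le> g0 z"
    and g0I: "(\<integral>\<^sup>+ z. g0 z \<partial>?P) = outer_nn_integral ?P S"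
    using outer_nn_integral_attained[of ?P S] by blast
  define c where "c = max C 0"
  define g1 where "g1 z = min (g0 z) (ennreal c)" for z
  have g1 [measurable]: "g1 \<in> borel_measurable ?P" unfolding g1_def by measurable
  have g1S: "S z \<le> g1 z" if "z \<in> space ?P" for z
  proof -
    have "S z \<le> ennreal c" using bound[OF that] by (rule order_trans) (auto simp: c_def intro: ennreal_leI)
    then show ?thesis using g0S[OF that] by (simp add: g1_def)
  qed
  have "(\<integral>\<^sup>+ z. g1 z \<partial>?P) \<le> (\<integral>\<^sup>+ z. g0 z \<partial>?P)" by (intro nn_integral_mono) (simp add: g1_def)
  then have g1I: "(\<integral>\<^sup>+ z. g1 z \<partial>?P) = outer_nn_integral ?P S"
    using outer_nn_integral_le[OF g1 g1S] g0I by (intro antisym) auto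
  have g1fin: "(\<integral>\<^sup>+ z. g1 z \<partial>?P) \<noteq> \<infinity>" using mean g1I by (auto simp: top_unique)
  \<comment> \<open>A majorant of minimal integral inherits, almost everywhere, every inequality of this kind:
    otherwise its minimum with the right-hand side would have a smaller integral.\<close>
  have AEg1: "AE z in ?P. g1 z \<le> g1 (override_on z z' (B k)) + 1" if k: "k \<in> KK" and z': "z' \<in> space ?P" for k z'
  proof -
    have "(\<lambda>z. override_on (fst (z, z')) (snd (z, z')) (B k)) \<in> measurable ?P ?P"
      by (rule measurable_compose[OF measurable_Pair2'[OF z'] override_on_measurable])
    then have om [measurable]: "(\<lambda>z. override_on z z' (B k)) \<in> measurable ?P ?P" by simp
    define g2 where "g2 z = min (g1 z) (g1 (override_on z z' (B k)) + 1)" for z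
    have g2 [measurable]: "g2 \<in> borel_measurable ?P" unfolding g2_def by measurable
    have "S z \<le> g2 z" if z: "z \<in> space ?P" for z
    proof -
      have "S z \<le> S (override_on z z' (B k)) + 1" by (rule diff[OF z z' k])
      also have "\<dots> \<le> g1 (override_on z z' (B k)) + 1"
        by (intro add_right_mono g1S override_on_space z z')
      finally show ?thesis using g1S[OF z] by (simp add: g2_def)
    qed
    then have "(\<integral>\<^sup>+ z. g1 z \<partial>?P) \<le> (\<integral>\<^sup>+ z. g2 z \<partial>?P)" unfolding g1I by (intro outer_nn_integral_le) auto
    moreover have "(\<integral>\<^sup>+ z. g2 z \<partial>?P) \<le> (\<integral>\<^sup>+ z. g1 z \<partial>?P)" by (intro nn_integral_mono) (simp add: g2_def)
    ultimately have eq: "(\<integral>\<^sup>+ z. g2 z \<partial>?P) = (\<integral>\<^sup>+ z. g1 z \<partial>?P)" by (rule antisym[rotated])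
    have "(\<integral>\<^sup>+ z. g1 z - g2 z \<partial>?P) = (\<integral>\<^sup>+ z. g1 z \<partial>?P) - (\<integral>\<^sup>+ z. g2 z \<partial>?P)"
      by (rule nn_integral_diff) (use eq g1fin in \<open>auto simp: g2_def\<close>)
    then have "(\<integral>\<^sup>+ z. g1 z - g2 z \<partial>?P) = 0" using eq g1fin by simp
    then have "AE z in ?P. g1 z - g2 z = 0" by (subst (asm) nn_integral_0_iff_AE) measurable
    then show ?thesis
    proof eventually_elim
      case (elim z)
      have "g1 z \<noteq> \<infinity>" using le_less_trans[of "g1 z" "ennreal c" \<top>] by (auto simp: g1_def)
      then have "g1 z \<le> g2 z" using elim by (simp add: diff_eq_0_iff_ennreal ennreal_minus_eq_0) 
      then show ?case by (simp add: g2_def)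
    qed
  qed
  define g where "g z = enn2real (g1 z)" for z
  have gm [measurable]: "g \<in> borel_measurable ?P" unfolding g_def by measurable
  have g1top: "g1 z < \<top>" for z
    by (rule le_less_trans[of _ "ennreal c"]) (simp_all add: g1_def)
  have g1g: "g1 z = ennreal (g z)" for z
    unfolding g_def using g1top[of z] by simp
  have g0: "0 \<le> g z" for z by (simp add: g_def)
  have gc: "\<bar>g z\<bar> \<le> c" for z
  proof -
    have "ennreal (g z) \<le> ennreal c" unfolding g1g[symmetric] by (simp add: g1_def)
    then show ?thesis using g0[of z] by (subst (asm) ennreal_le_iff) (auto simp: c_def)
  qed
  have gi: "integrable ?P g" by (rule PP.integrable_const_bound[where B = c]) (use gc in auto)
  have Eg: "(\<integral>z. g z \<partial>?P) \<le> m"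
  proof -
    have "ennreal (\<integral>z. g z \<partial>?P) = (\<integral>\<^sup>+ z. g1 z \<partial>?P)"
      unfolding g1g by (rule nn_integral_eq_integral[symmetric]) (use gi g0 in auto)
    then have "ennreal (\<integral>z. g z \<partial>?P) \<le> ennreal m" using mean g1I by simp
    then show ?thesis using m by (simp add: ennreal_le_iff)
  qed
  have mgf: "(\<integral>\<^sup>+ z. ennreal (exp (x * (g z - (\<integral>z. g z \<partial>?P)))) \<partial>?P) \<le> ennreal (exp (x\<^sup>2 / 2 * real (card KK)))"
    unfolding J
  proof (rule bounded_difference_mgf[OF KK x B], fold J)
    fix k z' assume "k \<in> KK" "z' \<in> space ?P"
    from AEg1[OF this] show "AE z in ?P. g z \<le> g (override_on z z' (B k)) + 1"
      by eventually_elim (simp add: g1g g0 ennreal_plus[symmetric] ennreal_1[symmetric] del: ennreal_plus ennreal_1)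
  qed (use gc in auto)
  \<comment> \<open>With n blocks the exponent x^2 n / 2 - x t equals - x^2 n / 2 at t = n x, the
    optimal pairing of parameter and deviation.\<close>
  define t where "t = real (card KK) * x"
  define A where "A = {z \<in> space ?P. g z < m + t}"
  have Am: "A \<in> sets ?P" unfolding A_def by measurable
  have "emeasure ?P (space ?P - A) \<le> emeasure ?P {z \<in> space ?P. 1 \<le> ennreal (exp (- (x * t))) * ennreal (exp (x * (g z - (\<integral>z. g z \<partial>?P))))}"
  proof (rule emeasure_mono)
    show "space ?P - A \<subseteq> {z \<in> space ?P. 1 \<le> ennreal (exp (- (x * t))) * ennreal (exp (x * (g z - (\<integral>z. g z \<partial>?P))))}"
    proof
      fix z assume z: "z \<in> space ?P - A"
      then have "t \<le> g z - (\<integral>z. g z \<partial>?P)" using Eg by (auto simp: A_def)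
      then have "x * t \<le> x * (g z - (\<integral>z. g z \<partial>?P))" using x by (intro mult_left_mono) auto
      then have "1 \<le> exp (- (x * t)) * exp (x * (g z - (\<integral>z. g z \<partial>?P)))"
        unfolding exp_add[symmetric] by simp
      then have "ennreal 1 \<le> ennreal (exp (- (x * t))) * ennreal (exp (x * (g z - (\<integral>z. g z \<partial>?P))))"
        unfolding ennreal_mult[symmetric, OF exp_ge_zero exp_ge_zero] by (rule ennreal_leI)
      then show "z \<in> {z \<in> space ?P. 1 \<le> ennreal (exp (- (x * t))) * ennreal (exp (x * (g z - (\<integral>z. g z \<partial>?P))))}"
        using z by simp
    qed
  qed measurable
  also have "\<dots> \<le> ennreal (exp (- (x * t))) * (\<integral>\<^sup>+ z. ennreal (exp (x * (g z - (\<integral>z. g z \<partial>?P)))) \<partial>?P)"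
    using nn_integral_Markov_inequality[of "\<lambda>z. ennreal (exp (x * (g z - (\<integral>z. g z \<partial>?P))))" "space ?P" ?P "ennreal (exp (- (x * t)))"]
    by (simp cong: nn_integral_cong)
  also have "\<dots> \<le> ennreal (exp (- (x * t))) * ennreal (exp (x\<^sup>2 / 2 * real (card KK)))"
    by (intro mult_left_mono mgf) auto
  also have "\<dots> = ennreal (exp (- (x\<^sup>2 / 2 * real (card KK))))"
    by (simp add: ennreal_mult[symmetric] exp_add[symmetric] t_def power2_eq_square algebra_simps)
  finally have "measure ?P (space ?P - A) \<le> exp (- (x\<^sup>2 / 2 * real (card KK)))"
    by (simp add: PP.emeasure_eq_measure)
  then have "measure ?P A \<ge> 1 - exp (- (x\<^sup>2 / 2 * real (card KK)))"
    using PP.prob_compl[OF Am] by simp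
  moreover have "S z < ennreal (m + t)" if "z \<in> A" for z
  proof -
    have "S z \<le> ennreal (g z)" using g1S[of z] that by (simp add: A_def g1g)
    also have "\<dots> < ennreal (m + t)" using that g0[of z] by (simp add: A_def ennreal_less_iff)
    finally show ?thesis .
  qed
  ultimately show ?thesis using Am unfolding t_def by blast
qed

section \<open>Rademacher variables on a product space\<close>

lemma prob_space_rademacher: "prob_space rademacher"
  unfolding rademacher_def by (rule prob_space_measure_pmf)

lemma space_rademacher [simp]: "space rademacher = UNIV"
  by (simp add: rademacher_def)

lemma sets_rademacher [simp, measurable_cong]: "sets rademacher = sets (count_space UNIV)"
  by (simp add: rademacher_def)

lemma nn_integral_rademacher: "(\<integral>\<^sup>+ s. f s \<partial>rademacher) = ennreal (1 / 2) * (f 1 + f (- 1))"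
proof -
  have "(\<integral>\<^sup>+ s. f s \<partial>rademacher) = (\<Sum>s\<in>{-1, 1 :: real}. f s * ennreal (pmf (pmf_of_set {-1, 1}) s))"
    unfolding rademacher_def by (subst nn_integral_measure_pmf_finite) auto
  then show ?thesis by (simp add: distrib_left ac_simps pmf_of_set)
qed

text \<open>Fubini, one coordinate at a time. It connects the joint law of points and signs in
  \<open>complexity_E\<close> with finite sums over sign sets.\<close>

lemma nn_integral_PiM_rademacher:
  fixes mu :: "'i \<Rightarrow> 'x measure"
  assumes mu: "product_prob_space mu" and "finite J"
    and "g \<in> borel_measurable (PiM J (\<lambda>i. mu i \<Otimes>\<^sub>M rademacher))"
  shows "(\<integral>\<^sup>+ w. g w \<partial>PiM J (\<lambda>i. mu i \<Otimes>\<^sub>M rademacher))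
    = ennreal (1 / 2 ^ card J) * (\<Sum>A\<in>Pow J. \<integral>\<^sup>+ x. g (\<lambda>i\<in>J. (x i, sign_on A i)) \<partial>PiM J mu)"
  using assms(2,3)
proof (induction J arbitrary: g rule: finite_induct)
  case empty
  interpret mu: product_prob_space mu by fact
  interpret R: prob_space rademacher by (rule prob_space_rademacher)
  interpret N: product_sigma_finite "\<lambda>i. mu i \<Otimes>\<^sub>M rademacher"
    by (auto simp: product_sigma_finite_def intro!: sigma_finite_pair_measure mu.sigma_finite_measures R.sigma_finite_measure_axioms)
  interpret E: prob_space "PiM {} mu" by (rule prob_space_PiM) simp
  show ?case by (simp add: N.nn_integral_empty restrict_def E.emeasure_space_1)
next
  case (insert j J)
  interpret mu: product_prob_space mu by fact
  interpret R: prob_space rademacher by (rule prob_space_rademacher)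
  interpret N: product_sigma_finite "\<lambda>i. mu i \<Otimes>\<^sub>M rademacher"
    by (auto simp: product_sigma_finite_def intro!: sigma_finite_pair_measure mu.sigma_finite_measures R.sigma_finite_measure_axioms)
  let ?N = "\<lambda>i. mu i \<Otimes>\<^sub>M rademacher"
  note gm [measurable] = insert.prems
  have m1: "(\<lambda>p. g ((fst p)(j := snd p))) \<in> borel_measurable (PiM J ?N \<Otimes>\<^sub>M ?N j)"
    using measurable_compose[OF measurable_add_dim gm] by (simp add: case_prod_beta)
  define h where "h w = (\<integral>\<^sup>+ y. g (w(j := y)) \<partial>?N j)" for w
  have hm: "h \<in> borel_measurable (PiM J ?N)"
    unfolding h_def by (rule sigma_finite_measure.borel_measurable_nn_integral[OF N.sigma_finite_measures]) (use m1 in \<open>simp add: case_prod_beta\<close>)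
  have pm [measurable]: "(\<lambda>x. \<lambda>i\<in>K. (x i, sign_on A i)) \<in> measurable (PiM K mu) (PiM K ?N)" for K A
    by (rule measurable_restrict) measurable
  have hpair: "(\<integral>\<^sup>+ x. h (\<lambda>i\<in>J. (x i, sign_on A i)) \<partial>PiM J mu)
    = ennreal (1 / 2) * ((\<integral>\<^sup>+ x. g (\<lambda>i\<in>insert j J. (x i, sign_on A i)) \<partial>PiM (insert j J) mu)
      + (\<integral>\<^sup>+ x. g (\<lambda>i\<in>insert j J. (x i, sign_on (insert j A) i)) \<partial>PiM (insert j J) mu))"
    if A: "A \<in> Pow J" for A
  proof -
    have jA: "j \<notin> A" using A insert(2) by auto
    \<comment> \<open>The two values of the new sign correspond to the sign sets \<open>A\<close>
      and \<open>insert j A\<close>.\<close>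
    have up: "(\<lambda>i\<in>J. (x i, sign_on A i))(j := (t, 1)) = (\<lambda>i\<in>insert j J. ((x(j := t)) i, sign_on A i))"
      "(\<lambda>i\<in>J. (x i, sign_on A i))(j := (t, - 1)) = (\<lambda>i\<in>insert j J. ((x(j := t)) i, sign_on (insert j A) i))" for x t
      using jA insert(2) by (auto simp: fun_eq_iff sign_on_def)
    have gA [measurable]: "(\<lambda>x. g (\<lambda>i\<in>insert j J. (x i, sign_on A i))) \<in> borel_measurable (PiM (insert j J) mu)" for A
      by measurable
    have gA2 [measurable]: "(\<lambda>p. g (\<lambda>i\<in>insert j J. (((fst p)(j := snd p)) i, sign_on A i))) \<in> borel_measurable (PiM J mu \<Otimes>\<^sub>M mu j)" for A
      using measurable_compose[OF measurable_add_dim gA] by (simp add: case_prod_beta)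
    have gA3: "(\<lambda>t. g (\<lambda>i\<in>insert j J. ((x(j := t)) i, sign_on A i))) \<in> borel_measurable (mu j)" if "x \<in> space (PiM J mu)" for A x
      using measurable_compose[OF measurable_Pair1'[OF that] gA2] by simp
    have gA4: "(\<lambda>x. \<integral>\<^sup>+ t. g (\<lambda>i\<in>insert j J. ((x(j := t)) i, sign_on A i)) \<partial>mu j) \<in> borel_measurable (PiM J mu)" for A
      by (rule sigma_finite_measure.borel_measurable_nn_integral[OF mu.sigma_finite_measures]) (use gA2 in \<open>simp add: case_prod_beta\<close>)
    have "h (\<lambda>i\<in>J. (x i, sign_on A i)) = ennreal (1 / 2) *
      ((\<integral>\<^sup>+ t. g (\<lambda>i\<in>insert j J. ((x(j := t)) i, sign_on A i)) \<partial>mu j)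
      + (\<integral>\<^sup>+ t. g (\<lambda>i\<in>insert j J. ((x(j := t)) i, sign_on (insert j A) i)) \<partial>mu j))"
      if x: "x \<in> space (PiM J mu)" for x
    proof -
      have "(\<lambda>i\<in>J. (x i, sign_on A i)) \<in> space (PiM J ?N)" using measurable_space[OF pm x] .
      from measurable_compose[OF measurable_Pair1'[OF this] m1]
      have "(\<lambda>y. g ((\<lambda>i\<in>J. (x i, sign_on A i))(j := y))) \<in> borel_measurable (?N j)" by simp
      then have "h (\<lambda>i\<in>J. (x i, sign_on A i)) = (\<integral>\<^sup>+ t. \<integral>\<^sup>+ s. g ((\<lambda>i\<in>J. (x i, sign_on A i))(j := (t, s))) \<partial>rademacher \<partial>mu j)"
        unfolding h_def by (rule R.nn_integral_fst[symmetric])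
      then show ?thesis
        unfolding nn_integral_rademacher up
        by (subst (asm) nn_integral_cmult, intro borel_measurable_add gA3 x)
           (subst (asm) nn_integral_add, intro gA3 x, intro gA3 x)
    qed
    then have "(\<integral>\<^sup>+ x. h (\<lambda>i\<in>J. (x i, sign_on A i)) \<partial>PiM J mu) = (\<integral>\<^sup>+ x. ennreal (1 / 2) *
      ((\<integral>\<^sup>+ t. g (\<lambda>i\<in>insert j J. ((x(j := t)) i, sign_on A i)) \<partial>mu j)
      + (\<integral>\<^sup>+ t. g (\<lambda>i\<in>insert j J. ((x(j := t)) i, sign_on (insert j A) i)) \<partial>mu j)) \<partial>PiM J mu)"
      by (rule nn_integral_cong)
    also have "\<dots> = ennreal (1 / 2) * ((\<integral>\<^sup>+ x. \<integral>\<^sup>+ t. g (\<lambda>i\<in>insert j J. ((x(j := t)) i, sign_on A i)) \<partial>mu j \<partial>PiM J mu)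
      + (\<integral>\<^sup>+ x. \<integral>\<^sup>+ t. g (\<lambda>i\<in>insert j J. ((x(j := t)) i, sign_on (insert j A) i)) \<partial>mu j \<partial>PiM J mu))"
      using gA4 by (simp add: nn_integral_cmult nn_integral_add del: fun_upd_apply)
    also have "\<dots> = ennreal (1 / 2) * ((\<integral>\<^sup>+ x. g (\<lambda>i\<in>insert j J. (x i, sign_on A i)) \<partial>PiM (insert j J) mu)
      + (\<integral>\<^sup>+ x. g (\<lambda>i\<in>insert j J. (x i, sign_on (insert j A) i)) \<partial>PiM (insert j J) mu))"
      using mu.product_nn_integral_insert[OF insert(1,2) gA] by presburger
    finally show ?thesis .
  qed
  have "(\<integral>\<^sup>+ w. g w \<partial>PiM (insert j J) ?N) = (\<integral>\<^sup>+ w. h w \<partial>PiM J ?N)"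
    unfolding h_def by (rule N.product_nn_integral_insert[OF insert(1,2) gm])
  also have "\<dots> = ennreal (1 / 2 ^ card J) * (\<Sum>A\<in>Pow J. \<integral>\<^sup>+ x. h (\<lambda>i\<in>J. (x i, sign_on A i)) \<partial>PiM J mu)"
    by (rule insert.IH[OF hm])
  also have "\<dots> = (ennreal (1 / 2 ^ card J) * ennreal (1 / 2)) *
    (\<Sum>A\<in>Pow (insert j J). \<integral>\<^sup>+ x. g (\<lambda>i\<in>insert j J. (x i, sign_on A i)) \<partial>PiM (insert j J) mu)"
    unfolding sum_Pow_insert[OF insert(1,2)] mult.assoc
    by (subst sum_distrib_left, rule arg_cong[where f = "\<lambda>x. _ * x"], rule sum.cong[OF refl], rule hpair)
  also have "ennreal (1 / 2 ^ card J) * ennreal (1 / 2) = ennreal (1 / 2 ^ card (insert j J))"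
    using insert by (subst ennreal_mult[symmetric]) auto
  finally show ?case .
qed

text \<open>A joint majorant restricts, at each fixed sign vector, to a majorant of the section.
  This replaces Fubini for outer integrals in the direction that is needed.\<close>

lemma outer_nn_integral_signs_le:
  fixes mu :: "'i \<Rightarrow> 'x measure"
  assumes mu: "product_prob_space mu" and J: "finite J"
  shows "ennreal (1 / 2 ^ card J) * (\<Sum>A\<in>Pow J. outer_nn_integral (PiM J mu) (\<lambda>x. h (\<lambda>i\<in>J. (x i, sign_on A i))))
    \<le> outer_nn_integral (PiM J (\<lambda>i. mu i \<Otimes>\<^sub>M rademacher)) h"
proof -
  let ?N = "PiM J (\<lambda>i. mu i \<Otimes>\<^sub>M rademacher)"
  obtain g where g: "g \<in> borel_measurable ?N" "\<And>w. w \<in> space ?N \<Longrightarrow> h w \<le> g w"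
    "(\<integral>\<^sup>+ w. g w \<partial>?N) = outer_nn_integral ?N h" using outer_nn_integral_attained by blast
  have pm [measurable]: "(\<lambda>x. \<lambda>i\<in>J. (x i, sign_on A i)) \<in> measurable (PiM J mu) ?N" for A
    by (rule measurable_restrict) measurable
  show ?thesis
    unfolding g(3)[symmetric] nn_integral_PiM_rademacher[OF mu J g(1)]
  proof (intro mult_left_mono sum_mono outer_nn_integral_le)
    show "(\<lambda>x. g (\<lambda>i\<in>J. (x i, sign_on A i))) \<in> borel_measurable (PiM J mu)" for A
      using g(1) by measurable
    show "h (\<lambda>i\<in>J. (x i, sign_on A i)) \<le> g (\<lambda>i\<in>J. (x i, sign_on A i))" if "x \<in> space (PiM J mu)" for x A
      by (rule g(2)) (rule measurable_space[OF pm that])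
  qed simp
qed

section \<open>Medians\<close>

lemma length_filter_sort: "length (filter Q (sort xs)) = length (filter Q xs)"
  by (metis mset_filter mset_sort size_mset)

text \<open>If the median were below \<open>c\<close>, so would be all entries sorted before it. All
  of them lie outside \<open>G\<close>, which leaves too few.\<close>

lemma median_list_ge:
  assumes K: "0 < K" and G: "G \<subseteq> {..<K}" "K < 2 * card G" and ge: "\<And>k. k \<in> G \<Longrightarrow> c \<le> x k"
  shows "c \<le> median_list (map x [0..<K])"
proof (rule ccontr)
  let ?xs = "map x [0..<K]"
  let ?ys = "sort ?xs"
  assume "\<not> c \<le> median_list ?xs"
  then have lt: "?ys ! (K div 2) < c" by (simp add: median_list_def)
  \<comment> \<open>These positions include the median itself, so there are
    \<open>K div 2 + 1\<close> of them.\<close>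
  have "card {..K div 2} \<le> card {i. i < length ?ys \<and> ?ys ! i < c}"
  proof (rule card_mono)
    show "{..K div 2} \<subseteq> {i. i < length ?ys \<and> ?ys ! i < c}"
    proof
      fix i assume "i \<in> {..K div 2}"
      then have i: "i \<le> K div 2" "K div 2 < length ?ys" using K by auto
      then have "?ys ! i \<le> ?ys ! (K div 2)" by (intro sorted_nth_mono sorted_sort) 
      then show "i \<in> {i. i < length ?ys \<and> ?ys ! i < c}" using i lt by simp
    qed
  qed simp
  also have "\<dots> = length (filter (\<lambda>y. y < c) ?xs)"
    unfolding length_filter_sort[of _ ?xs, symmetric] by (rule length_filter_conv_card[symmetric])
  also have "\<dots> = card {i. i < K \<and> x i < c}"
    unfolding length_filter_conv_card by (rule arg_cong[where f = card]) auto
  also have "\<dots> \<le> card ({..<K} - G)" using ge by (intro card_mono) force+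
  also have "\<dots> = K - card G" using G by (simp add: card_Diff_subset finite_subset)
  finally show False using G(2) card_mono[OF _ G(1)] by simp
qed

text \<open>The mirror image, with the \<open>K - K div 2\<close> positions from the median on. For
  even \<open>K\<close> the upper median makes the strict majority indispensable here: with exactly
  half of the blocks in \<open>G\<close> the bound can fail.\<close>

lemma median_list_le:
  assumes K: "0 < K" and G: "G \<subseteq> {..<K}" "K < 2 * card G" and le: "\<And>k. k \<in> G \<Longrightarrow> x k \<le> c"
  shows "median_list (map x [0..<K]) \<le> c"
proof (rule ccontr)
  let ?xs = "map x [0..<K]"
  let ?ys = "sort ?xs"
  assume "\<not> median_list ?xs \<le> c"
  then have lt: "c < ?ys ! (K div 2)" by (simp add: median_list_def)
  have "card {K div 2..<K} \<le> card {i. i < length ?ys \<and> c < ?ys ! i}"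
  proof (rule card_mono)
    show "{K div 2..<K} \<subseteq> {i. i < length ?ys \<and> c < ?ys ! i}"
    proof
      fix i assume "i \<in> {K div 2..<K}"
      then have i: "K div 2 \<le> i" "i < length ?ys" by auto
      then have "?ys ! (K div 2) \<le> ?ys ! i" by (intro sorted_nth_mono sorted_sort)
      then show "i \<in> {i. i < length ?ys \<and> c < ?ys ! i}" using i lt by simp
    qed
  qed simp
  also have "\<dots> = length (filter (\<lambda>y. c < y) ?xs)"
    unfolding length_filter_sort[of _ ?xs, symmetric] by (rule length_filter_conv_card[symmetric])
  also have "\<dots> = card {i. i < K \<and> c < x i}"
    unfolding length_filter_conv_card by (rule arg_cong[where f = card]) auto
  also have "\<dots> \<le> card ({..<K} - G)" using le by (intro card_mono) force+
  also have "\<dots> = K - card G" using G by (simp add: card_Diff_subset finite_subset)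
  finally show False using G(2) card_mono[OF _ G(1)] by simp
qed

section \<open>Lipschitz extension from a countable set\<close>

text \<open>\<open>lb\<close> is only controlled at values taken by the class, whereas the contraction argument
  evaluates it at arbitrary rational points.\<close>

definition lip_ext :: "real \<Rightarrow> real set \<Rightarrow> (real \<Rightarrow> real) \<Rightarrow> real \<Rightarrow> real" where
  "lip_ext L D f v = (INF d\<in>D. f d + L * \<bar>v - d\<bar>)"

context
  fixes L :: real and D :: "real set" and f :: "real \<Rightarrow> real"
  assumes L: "0 \<le> L" and D: "D \<noteq> {}"
    and lip: "\<And>u v. u \<in> D \<Longrightarrow> v \<in> D \<Longrightarrow> \<bar>f u - f v\<bar> \<le> L * \<bar>u - v\<bar>"
begin

lemma lip_ext_bdd: "bdd_below ((\<lambda>d. f d + L * \<bar>v - d\<bar>) ` D)"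
proof -
  obtain d0 where d0: "d0 \<in> D" using D by auto
  have "f d0 - L * \<bar>v - d0\<bar> \<le> f d + L * \<bar>v - d\<bar>" if "d \<in> D" for d
  proof -
    have "f d0 - f d \<le> L * \<bar>d0 - d\<bar>" using lip[OF d0 that] by linarith
    also have "\<dots> \<le> L * (\<bar>v - d0\<bar> + \<bar>v - d\<bar>)" using L by (intro mult_left_mono) auto
    finally show ?thesis by (simp add: algebra_simps)
  qed
  then show ?thesis by (auto simp: bdd_below_def)
qed

lemma lip_ext_lipschitz: "\<bar>lip_ext L D f v - lip_ext L D f w\<bar> \<le> L * \<bar>v - w\<bar>"
proof -
  have "lip_ext L D f v - L * \<bar>v - w\<bar> \<le> lip_ext L D f w" for v w
    unfolding lip_ext_def[of L D f w]
  proof (rule cINF_greatest[OF D])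
    fix d assume d: "d \<in> D"
    have "lip_ext L D f v \<le> f d + L * \<bar>v - d\<bar>"
      unfolding lip_ext_def by (rule cINF_lower[OF lip_ext_bdd d])
    also have "\<dots> \<le> f d + L * (\<bar>v - w\<bar> + \<bar>w - d\<bar>)" using L by (intro add_left_mono mult_left_mono) auto
    finally show "lip_ext L D f v - L * \<bar>v - w\<bar> \<le> f d + L * \<bar>w - d\<bar>" by (simp add: algebra_simps)
  qed
  from this[of v w] this[of w v] show ?thesis by (simp add: abs_minus_commute abs_le_iff)
qed

text \<open>The infimum over a countable \<open>D\<close> keeps the extension measurable in a
  parameter. Agreement with \<open>f\<close> survives at limit points of \<open>D\<close> because
  Lipschitz control between \<open>v\<close> and points of \<open>D\<close> suffices.\<close>

lemma lip_ext_eq: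
  assumes v: "v \<in> closure D" and lipv: "\<And>u. u \<in> D \<Longrightarrow> \<bar>f u - f v\<bar> \<le> L * \<bar>u - v\<bar>"
  shows "lip_ext L D f v = f v"
proof (rule antisym)
  show "f v \<le> lip_ext L D f v"
    unfolding lip_ext_def
    by (rule cINF_greatest[OF D]) (use lipv in \<open>fastforce simp: abs_le_iff abs_minus_commute\<close>)
  show "lip_ext L D f v \<le> f v"
  proof (rule field_le_epsilon)
    fix e :: real assume e: "0 < e"
    then have "e / (2 * L + 1) > 0" using L by simp
    then obtain d where d: "d \<in> D" "dist d v < e / (2 * L + 1)" using v unfolding closure_approachable by blast
    have "lip_ext L D f v \<le> f d + L * \<bar>v - d\<bar>"
      unfolding lip_ext_def by (rule cINF_lower[OF lip_ext_bdd d(1)])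
    also have "f d \<le> f v + L * \<bar>v - d\<bar>" using lipv[OF d(1)] by (simp add: abs_le_iff abs_minus_commute)
    also have "f v + L * \<bar>v - d\<bar> + L * \<bar>v - d\<bar> = f v + 2 * L * dist d v"
      by (simp add: dist_real_def abs_minus_commute)
    also have "\<dots> \<le> f v + (2 * L + 1) * dist d v" by (simp add: algebra_simps)
    also have "\<dots> \<le> f v + e" using d(2) L by (simp add: field_simps)
    finally show "lip_ext L D f v \<le> f v + e" by simp
  qed
qed

end

section \<open>Second moments of sums over a product space\<close>

lemma (in product_prob_space) distr_component:
  assumes "i \<in> J" "finite J"
  shows "distr (PiM J M) (M i) (\<lambda>z. z i) = M i"
  by (rule distr_PiM_component[OF prob_space]) fact+

text \<open>Independence and centring remove all cross terms of the squared sum.\<close>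

lemma (in product_prob_space) sum_second_moment:
  fixes a :: "'i \<Rightarrow> 'a \<Rightarrow> real"
  assumes J: "finite J" "S \<subseteq> J"
    and am: "\<And>i. i \<in> S \<Longrightarrow> a i \<in> borel_measurable (M i)"
    and a2: "\<And>i. i \<in> S \<Longrightarrow> integrable (M i) (\<lambda>x. (a i x)\<^sup>2)"
    and a0: "\<And>i. i \<in> S \<Longrightarrow> (\<integral>x. a i x \<partial>M i) = 0"
  shows "integrable (PiM J M) (\<lambda>z. (\<Sum>i\<in>S. a i (z i))\<^sup>2)"
    and "(\<integral>z. (\<Sum>i\<in>S. a i (z i))\<^sup>2 \<partial>PiM J M) = (\<Sum>i\<in>S. \<integral>x. (a i x)\<^sup>2 \<partial>M i)"
proof -
  have dc: "distr (PiM J M) (M i) (\<lambda>z. z i) = M i" if "i \<in> S" for i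
    using distr_component[of i J] J that by auto
  have cm [measurable]: "(\<lambda>z. z i) \<in> measurable (PiM J M) (M i)" if "i \<in> S" for i
    using J that by (intro measurable_component_singleton) auto
  have comp: "integrable (PiM J M) (\<lambda>z. f (z i)) \<longleftrightarrow> integrable (M i) f"
    "(\<integral>z. f (z i) \<partial>PiM J M) = (\<integral>x. f x \<partial>M i)" if "i \<in> S" "f \<in> borel_measurable (M i)" for i and f :: "'a \<Rightarrow> real"
    using integrable_distr_eq[OF cm[OF that(1)], of f] integral_distr[OF cm[OF that(1)], of f] that(2) by (simp_all add: dc[OF that(1)])
  have azm: "(\<lambda>z. a i (z i)) \<in> borel_measurable (PiM J M)" if "i \<in> S" for i
    using measurable_compose[OF cm[OF that] am[OF that]] .
  have sq: "integrable (PiM J M) (\<lambda>z. (a i (z i))\<^sup>2)" if "i \<in> S" for i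
    using comp(1)[OF that, of "\<lambda>x. (a i x)\<^sup>2"] a2[OF that] am[OF that] by simp
  have ai: "integrable (M i) (a i)" if "i \<in> S" for i
    using M.square_integrable_imp_integrable[OF am[OF that] a2[OF that]] .
  have pint: "integrable (PiM J M) (\<lambda>z. a i (z i) * a j (z j))" if "i \<in> S" "j \<in> S" for i j
  proof (rule Bochner_Integration.integrable_bound)
    show "integrable (PiM J M) (\<lambda>z. (a i (z i))\<^sup>2 + (a j (z j))\<^sup>2)" using sq that by simp
    show "(\<lambda>z. a i (z i) * a j (z j)) \<in> borel_measurable (PiM J M)" using azm that by simp
    have "\<bar>x * y\<bar> \<le> x\<^sup>2 + y\<^sup>2" for x y :: real
      using sum_squares_bound[of "\<bar>x\<bar>" "\<bar>y\<bar>"] mult_nonneg_nonneg[of "\<bar>x\<bar>" "\<bar>y\<bar>"] unfolding abs_mult power2_abs by linarith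
    then show "AE z in PiM J M. norm (a i (z i) * a j (z j)) \<le> norm ((a i (z i))\<^sup>2 + (a j (z j))\<^sup>2)" by simp
  qed
  have cross: "(\<integral>z. a i (z i) * a j (z j) \<partial>PiM J M) = 0" if ij: "i \<in> S" "j \<in> S" "i \<noteq> j" for i j
  proof -
    \<comment> \<open>The product of two coordinates is written as a product over all of
      \<open>J\<close>, with factors 1 elsewhere, so that the integral factorizes.\<close>
    define f where "f l = (if l = i then a i else if l = j then a j else (\<lambda>_. 1))" for l
    have "(\<Prod>l\<in>J. f l (z l)) = a i (z i) * a j (z j)" for z
    proof -
      have "(\<Prod>l\<in>J. f l (z l)) = f i (z i) * (f j (z j) * (\<Prod>l\<in>J - {i} - {j}. f l (z l)))"
        using ij J subsetD[OF J(2) ij(1)] subsetD[OF J(2) ij(2)] prod.remove[of J i "\<lambda>l. f l (z l)"] prod.remove[of "J - {i}" j "\<lambda>l. f l (z l)"] by auto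
      also have "(\<Prod>l\<in>J - {i} - {j}. f l (z l)) = 1" by (rule prod.neutral) (auto simp: f_def)
      finally show ?thesis using ij by (simp add: f_def)
    qed
    then have "(\<integral>z. a i (z i) * a j (z j) \<partial>PiM J M) = (\<integral>z. (\<Prod>l\<in>J. f l (z l)) \<partial>PiM J M)" by simp
    also have "\<dots> = (\<Prod>l\<in>J. \<integral>x. f l x \<partial>M l)"
      by (rule product_integral_prod) (use J ij ai in \<open>auto simp: f_def\<close>)
    also have "\<dots> = 0" using ij J a0 by (intro prod_zero) (auto simp: f_def intro!: bexI[of _ i])
    finally show ?thesis .
  qed
  have ex: "(\<lambda>z. (\<Sum>i\<in>S. a i (z i))\<^sup>2) = (\<lambda>z. \<Sum>i\<in>S. \<Sum>j\<in>S. a i (z i) * a j (z j))"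
    by (simp add: power2_eq_square sum_product)
  show "integrable (PiM J M) (\<lambda>z. (\<Sum>i\<in>S. a i (z i))\<^sup>2)"
    unfolding ex by (intro Bochner_Integration.integrable_sum pint)
  have "(\<integral>z. (\<Sum>i\<in>S. a i (z i))\<^sup>2 \<partial>PiM J M) = (\<Sum>i\<in>S. \<Sum>j\<in>S. \<integral>z. a i (z i) * a j (z j) \<partial>PiM J M)"
    unfolding ex by (simp add: Bochner_Integration.integral_sum pint)
  also have "\<dots> = (\<Sum>i\<in>S. \<integral>x. (a i x)\<^sup>2 \<partial>M i)"
  proof (rule sum.cong[OF refl])
    fix i assume i: "i \<in> S"
    have fin: "finite S" using J finite_subset by blast
    have "(\<Sum>j\<in>S. \<integral>z. a i (z i) * a j (z j) \<partial>PiM J M)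
      = (\<integral>z. a i (z i) * a i (z i) \<partial>PiM J M) + (\<Sum>j\<in>S - {i}. \<integral>z. a i (z i) * a j (z j) \<partial>PiM J M)"
      using i fin by (rule sum.remove[rotated])
    also have "(\<Sum>j\<in>S - {i}. \<integral>z. a i (z i) * a j (z j) \<partial>PiM J M) = 0"
      by (rule sum.neutral) (use cross i in auto)
    finally show "(\<Sum>j\<in>S. \<integral>z. a i (z i) * a j (z j) \<partial>PiM J M) = (\<integral>x. (a i x)\<^sup>2 \<partial>M i)"
      using comp(2)[OF i, of "\<lambda>x. (a i x)\<^sup>2"] am[OF i] by (simp add: power2_eq_square)
  qed
  finally show "(\<integral>z. (\<Sum>i\<in>S. a i (z i))\<^sup>2 \<partial>PiM J M) = (\<Sum>i\<in>S. \<integral>x. (a i x)\<^sup>2 \<partial>M i)" .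
qed

section \<open>Uniform deviations over uncontaminated blocks\<close>

text \<open>A Lipschitz function between the indicator of \<bar>u\<bar> > 1 and the square: its
  sloped piece 2 \<bar>u\<bar> - 1 is the tangent of u^2 at \<bar>u\<bar> = 1. The upper comparison
  gives Chebyshev, the Lipschitz property gives contraction.\<close>

definition ramp :: "real \<Rightarrow> real" where
  "ramp u = max 0 (min 1 (2 * \<bar>u\<bar> - 1))"

lemma ramp_bounds: "0 \<le> ramp u" "ramp u \<le> 1" "ramp 0 = 0" "1 < \<bar>u\<bar> \<Longrightarrow> ramp u = 1"
  by (auto simp: ramp_def)

lemma ramp_le_square: "ramp u \<le> u\<^sup>2"
proof -
  have "0 \<le> (\<bar>u\<bar> - 1)\<^sup>2" by simp
  then have "2 * \<bar>u\<bar> - 1 \<le> u\<^sup>2" by (simp add: power2_diff)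
  then show ?thesis by (auto simp: ramp_def)
qed

lemma ramp_lipschitz: "\<bar>ramp u - ramp v\<bar> \<le> 2 * \<bar>u - v\<bar>"
proof -
  have "\<bar>ramp u - ramp v\<bar> \<le> \<bar>(2 * \<bar>u\<bar> - 1) - (2 * \<bar>v\<bar> - 1)\<bar>" unfolding ramp_def by linarith
  also have "\<dots> = 2 * \<bar>\<bar>u\<bar> - \<bar>v\<bar>\<bar>" by (auto simp: abs_if)
  finally show ?thesis using abs_triangle_ineq3[of u v] by linarith
qed

lemma ramp_measurable [measurable]: "ramp \<in> borel_measurable borel"
  unfolding ramp_def by measurable

lemma sign_on_mult: "sign_on A i * sign_on U i = sign_on (A - U \<union> (U - A)) i"
  by (auto simp: sign_on_def)

text \<open>Multiplying by a fixed sign vector is symmetric difference with its sign set, an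
  involution of \<open>Pow J\<close>. Rademacher averages do not notice it.\<close>

lemma sum_Pow_symdiff:
  assumes "U \<subseteq> J"
  shows "(\<Sum>A\<in>Pow J. f (A - U \<union> (U - A))) = (\<Sum>A\<in>Pow J. f A)"
  by (rule sum.reindex_bij_witness[where i = "\<lambda>A. A - U \<union> (U - A)" and j = "\<lambda>A. A - U \<union> (U - A)"])
     (use assms in auto)

section \<open>Independent clean blocks on their product space, for a fixed class
  \<open>T\<close>\<close>

locale mom_blocks =
  fixes Ps :: "nat \<Rightarrow> ('x \<times> 'y) measure" and MX :: "'x measure" and MY :: "'y measure"
    and Ybar :: "real set" and T :: "('x \<Rightarrow> real) set" and fstar :: "'x \<Rightarrow> real"
    and lb :: "real \<Rightarrow> 'y \<Rightarrow> real" and L r :: real and s :: nat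
    and KK :: "nat set" and B :: "nat \<Rightarrow> nat set" and J :: "nat set"
  assumes prob: "prob_space (Ps i)" and sets_Ps: "sets (Ps i) = sets (MX \<Otimes>\<^sub>M MY)"
    and fstar: "fstar \<in> T"
    and Tvals: "f \<in> T \<Longrightarrow> x \<in> space MX \<Longrightarrow> f x \<in> Ybar"
    and Tmeas: "f \<in> T \<Longrightarrow> f \<in> borel_measurable MX"
    and loss_meas: "f \<in> T \<Longrightarrow> loss lb f \<in> borel_measurable (MX \<Otimes>\<^sub>M MY)"
    and L: "0 < L"
    and lip: "y \<in> space MY \<Longrightarrow> u \<in> Ybar \<Longrightarrow> v \<in> Ybar \<Longrightarrow> \<bar>lb u y - lb v y\<bar> \<le> L * \<bar>u - v\<bar>"
    and L2: "i \<in> J \<Longrightarrow> f \<in> T \<Longrightarrow> integrable (Ps i) (\<lambda>z. (f (fst z))\<^sup>2)"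
    and KK: "finite KK" and B_fin: "k \<in> KK \<Longrightarrow> finite (B k)" and B_card: "k \<in> KK \<Longrightarrow> card (B k) = s"
    and B_disj: "k \<in> KK \<Longrightarrow> k' \<in> KK \<Longrightarrow> k \<noteq> k' \<Longrightarrow> B k \<inter> B k' = {}"
    and J: "J = (\<Union>k\<in>KK. B k)" and s: "0 < s" and r: "0 < r"

sublocale mom_blocks \<subseteq> product_prob_space Ps J
  by (rule product_prob_spaceI) (rule prob)

context mom_blocks
begin

abbreviation "\<Omega> \<equiv> PiM J Ps"

lemma prob_\<Omega>: "prob_space \<Omega>"
  by (rule prob_space_PiM) (rule prob)

definition xloss :: "('x \<Rightarrow> real) \<Rightarrow> 'x \<times> 'y \<Rightarrow> real" where
  "xloss f z = loss lb f z - loss lb fstar z"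

definition dev :: "('x \<Rightarrow> real) \<Rightarrow> nat \<Rightarrow> (nat \<Rightarrow> 'x \<times> 'y) \<Rightarrow> real" where
  "dev f k z = (\<Sum>i\<in>B k. xloss f (z i) - (\<integral>z'. xloss f z' \<partial>Ps i)) / real s"

lemma finJ: "finite J" unfolding J using KK B_fin by auto

lemma BJ: "k \<in> KK \<Longrightarrow> B k \<subseteq> J" unfolding J by auto

lemma cardJ: "real (card J) = real (card KK) * real s"
proof -
  have "card J = (\<Sum>k\<in>KK. card (B k))"
    unfolding J using KK B_fin B_disj by (intro card_UN_disjoint) auto
  then show ?thesis by (simp add: B_card)
qed

lemma space_Ps: "space (Ps i) = space MX \<times> space MY"
  using sets_eq_imp_space_eq[OF sets_Ps] by (simp add: space_pair_measure)

lemma \<Omega>_space: "z \<in> space \<Omega> \<Longrightarrow> i \<in> J \<Longrightarrow> fst (z i) \<in> space MX \<and> snd (z i) \<in> space MY"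
  by (auto simp: space_PiM PiE_iff space_Ps dest: bspec)

lemma coord_measurable: "i \<in> J \<Longrightarrow> (\<lambda>z. z i) \<in> measurable \<Omega> (MX \<Otimes>\<^sub>M MY)"
  using measurable_component_singleton[of i J Ps] by (simp cong: measurable_cong_sets add: measurable_cong_sets[OF refl sets_Ps])

lemma xloss_measurable: "f \<in> T \<Longrightarrow> xloss f \<in> borel_measurable (MX \<Otimes>\<^sub>M MY)"
  unfolding xloss_def using loss_meas fstar by measurable

lemma xloss_measurable': "f \<in> T \<Longrightarrow> xloss f \<in> borel_measurable (Ps i)"
  using xloss_measurable by (simp add: measurable_cong_sets[OF sets_Ps refl])

lemma xloss_bound: "f \<in> T \<Longrightarrow> z \<in> space MX \<times> space MY \<Longrightarrow> \<bar>xloss f z\<bar> \<le> L * \<bar>f (fst z) - fstar (fst z)\<bar>"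
  using lip[of "snd z" "f (fst z)" "fstar (fst z)"] Tvals fstar
  by (auto simp: xloss_def loss_def)

lemma xloss_square_integrable:
  assumes f: "f \<in> T" and i: "i \<in> J"
  shows "integrable (Ps i) (\<lambda>z. (xloss f z)\<^sup>2)"
proof (rule Bochner_Integration.integrable_bound)
  show "integrable (Ps i) (\<lambda>z. L\<^sup>2 * (2 * (f (fst z))\<^sup>2 + 2 * (fstar (fst z))\<^sup>2))"
    using L2[OF i f] L2[OF i fstar] by simp
  show "(\<lambda>z. (xloss f z)\<^sup>2) \<in> borel_measurable (Ps i)" using xloss_measurable'[OF f] by simp
  have "(xloss f z)\<^sup>2 \<le> L\<^sup>2 * (2 * (f (fst z))\<^sup>2 + 2 * (fstar (fst z))\<^sup>2)" if z: "z \<in> space (Ps i)" for z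
  proof -
    have "\<bar>xloss f z\<bar>\<^sup>2 \<le> (L * \<bar>f (fst z) - fstar (fst z)\<bar>)\<^sup>2"
      using xloss_bound[OF f, of z] z by (intro power_mono) (auto simp: space_Ps)
    also have "\<dots> = L\<^sup>2 * (f (fst z) - fstar (fst z))\<^sup>2" by (simp add: power_mult_distrib)
    also have "\<dots> \<le> L\<^sup>2 * (2 * (f (fst z))\<^sup>2 + 2 * (fstar (fst z))\<^sup>2)"
    proof (rule mult_left_mono)
      show "(f (fst z) - fstar (fst z))\<^sup>2 \<le> 2 * (f (fst z))\<^sup>2 + 2 * (fstar (fst z))\<^sup>2"
        using zero_le_power2[of "f (fst z) + fstar (fst z)"] by (simp add: power2_diff power2_sum)
    qed simp
    finally show ?thesis by simp
  qed
  then show "AE z in Ps i. norm ((xloss f z)\<^sup>2) \<le> norm (L\<^sup>2 * (2 * (f (fst z))\<^sup>2 + 2 * (fstar (fst z))\<^sup>2))"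
    by (intro AE_I2) simp
qed

lemma xloss_integrable: "f \<in> T \<Longrightarrow> i \<in> J \<Longrightarrow> integrable (Ps i) (xloss f)"
  using M.square_integrable_imp_integrable[OF xloss_measurable' xloss_square_integrable] .

lemma xloss_coord_measurable: "f \<in> T \<Longrightarrow> i \<in> J \<Longrightarrow> (\<lambda>z. xloss f (z i)) \<in> borel_measurable \<Omega>"
  using measurable_compose[OF coord_measurable xloss_measurable] .

lemma xloss_coord:
  assumes "f \<in> T" "i \<in> J"
  shows "integrable \<Omega> (\<lambda>z. xloss f (z i))" "(\<integral>z. xloss f (z i) \<partial>\<Omega>) = (\<integral>z. xloss f z \<partial>Ps i)"
proof -
  note d = distr_component[OF assms(2) finJ]
  have m: "(\<lambda>z. z i) \<in> measurable \<Omega> (Ps i)" using assms(2) by (rule measurable_component_singleton)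
  show "integrable \<Omega> (\<lambda>z. xloss f (z i))"
    using xloss_integrable[OF assms] integrable_distr_eq[OF m xloss_measurable'[OF assms(1)]] by (simp add: d)
  show "(\<integral>z. xloss f (z i) \<partial>\<Omega>) = (\<integral>z. xloss f z \<partial>Ps i)"
    using integral_distr[OF m xloss_measurable'[OF assms(1)]] by (simp add: d)
qed

lemma dev_measurable: "f \<in> T \<Longrightarrow> k \<in> KK \<Longrightarrow> dev f k \<in> borel_measurable \<Omega>"
  unfolding dev_def using xloss_coord_measurable BJ by (intro borel_measurable_divide borel_measurable_sum borel_measurable_diff) auto

lemma dev_cong: "(\<And>i. i \<in> B k \<Longrightarrow> z i = z' i) \<Longrightarrow> dev f k z = dev f k z'"
  unfolding dev_def by simp

lemma dev_second_moment:
  assumes f: "f \<in> T" and k: "k \<in> KK"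
    and V: "\<And>i. i \<in> J \<Longrightarrow> (\<integral>z. (xloss f z - (\<integral>z'. xloss f z' \<partial>Ps i))\<^sup>2 \<partial>Ps i) \<le> V"
  shows "integrable \<Omega> (\<lambda>z. (dev f k z)\<^sup>2)" "(\<integral>z. (dev f k z)\<^sup>2 \<partial>\<Omega>) \<le> V / real s"
proof -
  define a where "a i z = xloss f z - (\<integral>z'. xloss f z' \<partial>Ps i)" for i z
  have am: "a i \<in> borel_measurable (Ps i)" for i unfolding a_def using xloss_measurable'[OF f] by simp
  have a2: "integrable (Ps i) (\<lambda>z. (a i z)\<^sup>2)" if "i \<in> B k" for i
    using xloss_square_integrable[OF f, of i] xloss_integrable[OF f, of i] that BJ[OF k]
    by (auto simp: a_def power2_diff)
  have a0: "(\<integral>z. a i z \<partial>Ps i) = 0" if "i \<in> B k" for i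
    using xloss_integrable[OF f, of i] that BJ[OF k] by (auto simp: a_def M.prob_space)
  have d: "(dev f k z)\<^sup>2 = (\<Sum>i\<in>B k. a i (z i))\<^sup>2 / (real s)\<^sup>2" for z
    by (simp add: dev_def a_def power_divide)
  note sm = sum_second_moment[OF finJ BJ[OF k] am a2 a0]
  show "integrable \<Omega> (\<lambda>z. (dev f k z)\<^sup>2)" unfolding d using sm(1) by simp
  have "(\<integral>z. (dev f k z)\<^sup>2 \<partial>\<Omega>) = (\<Sum>i\<in>B k. \<integral>x. (a i x)\<^sup>2 \<partial>Ps i) / (real s)\<^sup>2"
    unfolding d using sm(2) by simp
  also have "\<dots> \<le> (\<Sum>i\<in>B k. V) / (real s)\<^sup>2"
    unfolding a_def using BJ[OF k] by (intro divide_right_mono sum_mono V) auto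
  also have "\<dots> = V / real s" using s by (simp add: B_card[OF k] power2_eq_square)
  finally show "(\<integral>z. (dev f k z)\<^sup>2 \<partial>\<Omega>) \<le> V / real s" .
qed

text \<open>A soft indicator of a deviation above r^2 / 4: the factor 4 / r^2 moves that threshold
  to 1.\<close>

definition bad :: "('x \<Rightarrow> real) \<Rightarrow> nat \<Rightarrow> (nat \<Rightarrow> 'x \<times> 'y) \<Rightarrow> real" where
  "bad f k z = ramp (4 / r\<^sup>2 * dev f k z)"

lemma bad_measurable: "f \<in> T \<Longrightarrow> k \<in> KK \<Longrightarrow> bad f k \<in> borel_measurable \<Omega>"
  unfolding bad_def using dev_measurable by measurable

lemma bad_bounds: "0 \<le> bad f k z" "bad f k z \<le> 1"
  by (simp_all add: bad_def ramp_bounds)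

lemma bad_integrable: "f \<in> T \<Longrightarrow> k \<in> KK \<Longrightarrow> integrable \<Omega> (bad f k)"
  using prob_\<Omega> bad_measurable bad_bounds
  by (intro finite_measure.integrable_const_bound[where B = 1] prob_space.finite_measure) auto

text \<open>Chebyshev with the ramp as indicator: 16 / r^4 * V / s is at most 16/1536 =
  1/96.\<close>

lemma bad_expectation:
  assumes f: "f \<in> T" and k: "k \<in> KK"
    and V: "\<And>i. i \<in> J \<Longrightarrow> (\<integral>z. (xloss f z - (\<integral>z'. xloss f z' \<partial>Ps i))\<^sup>2 \<partial>Ps i) \<le> V"
    and Vr: "1536 * V \<le> r ^ 4 * real s"
  shows "(\<integral>z. bad f k z \<partial>\<Omega>) \<le> 1 / 96"
proof -
  note sm = dev_second_moment[OF f k V]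
  have e: "(4 / r\<^sup>2 * dev f k z)\<^sup>2 = 16 / r ^ 4 * (dev f k z)\<^sup>2" for z
    by (simp add: power_mult_distrib power_divide)
  have "(\<integral>z. bad f k z \<partial>\<Omega>) \<le> (\<integral>z. 16 / r ^ 4 * (dev f k z)\<^sup>2 \<partial>\<Omega>)"
    unfolding e[symmetric]
  proof (rule integral_mono)
    show "integrable \<Omega> (\<lambda>z. (4 / r\<^sup>2 * dev f k z)\<^sup>2)" unfolding e using sm(1) by simp
    show "bad f k z \<le> (4 / r\<^sup>2 * dev f k z)\<^sup>2" for z unfolding bad_def by (rule ramp_le_square)
  qed (rule bad_integrable[OF f k])
  also have "\<dots> = 16 / r ^ 4 * (\<integral>z. (dev f k z)\<^sup>2 \<partial>\<Omega>)" by simp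
  also have "\<dots> \<le> 16 / r ^ 4 * (V / real s)" using r by (intro mult_left_mono sm(2)) auto
  also have "\<dots> \<le> 1 / 96" using r s Vr by (simp add: field_simps)
  finally show ?thesis .
qed

section \<open>From block deviations down to the Rademacher complexity\<close>

text \<open>Separability of the line, applied to the set of values of the class. Choosing
  \<open>D\<close> inside that set makes each \<open>lb d\<close> a section of some measurable
  \<open>loss lb f\<close>, hence measurable in the response.\<close>

lemma exists_countable_values:
  "\<exists>D. countable D \<and> D \<noteq> {} \<and> D \<subseteq> Ybar \<and> (\<forall>f\<in>T. \<forall>x\<in>space MX. f x \<in> closure D) \<and>
    (\<forall>d\<in>D. lb d \<in> borel_measurable MY)"
proof -
  define U where "U = (\<Union>f\<in>T. f ` space MX)"
  obtain D where D: "countable D" "D \<subseteq> U" "U \<subseteq> closure D" using separable by blast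
  have "space (Ps 0) \<noteq> {}" using prob prob_space.not_empty by blast
  then have "space MX \<noteq> {}" by (auto simp: space_Ps)
  then have "U \<noteq> {}" using fstar by (auto simp: U_def)
  then have "D \<noteq> {}" using D by auto
  moreover have "D \<subseteq> Ybar" using D(2) Tvals by (auto simp: U_def)
  moreover have "f x \<in> closure D" if "f \<in> T" "x \<in> space MX" for f x using D(3) that by (auto simp: U_def)
  moreover have "lb d \<in> borel_measurable MY" if d: "d \<in> D" for d
  proof -
    obtain f x where fx: "f \<in> T" "x \<in> space MX" "d = f x" using d D(2) by (auto simp: U_def)
    have "(\<lambda>y. loss lb f (x, y)) \<in> borel_measurable MY"
      using measurable_compose[OF measurable_Pair1'[OF fx(2)] loss_meas[OF fx(1)]] .
    then show ?thesis by (simp add: loss_def fx(3))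
  qed
  ultimately show ?thesis using D(1) by blast
qed

text \<open>For fixed data the excess loss is a Lipschitz function of the increment f - fstar at the
  data point and vanishes at increment 0. The extended loss provides this function on the whole
  line.\<close>

lemma loss_contraction:
  "(\<Sum>A\<in>Pow J. outer_nn_integral \<Omega> (\<lambda>z. SUP f\<in>T. ennreal (\<Sum>i\<in>J. sign_on A i * xloss f (z i))))
    \<le> ennreal L * (\<Sum>A\<in>Pow J. outer_nn_integral \<Omega> (\<lambda>z. SUP f\<in>T. ennreal (\<Sum>i\<in>J. sign_on A i * (f (fst (z i)) - fstar (fst (z i))))))"
proof -
  obtain D where D: "countable D" "D \<noteq> {}" "D \<subseteq> Ybar" "\<And>f x. f \<in> T \<Longrightarrow> x \<in> space MX \<Longrightarrow> f x \<in> closure D"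
    "\<And>d. d \<in> D \<Longrightarrow> lb d \<in> borel_measurable MY" using exists_countable_values by blast
  define ext where "ext y = lip_ext L D (\<lambda>d. lb d y)" for y
  have lipD: "\<bar>lb u y - lb v y\<bar> \<le> L * \<bar>u - v\<bar>" if "y \<in> space MY" "u \<in> D" "v \<in> D" for u v y
    using lip that D(3) by auto
  have ext_lip: "\<bar>ext y u - ext y v\<bar> \<le> L * \<bar>u - v\<bar>" if "y \<in> space MY" for y u v
    unfolding ext_def by (rule lip_ext_lipschitz) (use L D(2) lipD that in auto)
  have ext_eq: "ext y (f x) = lb (f x) y" if "f \<in> T" "x \<in> space MX" "y \<in> space MY" for f x y
    unfolding ext_def
    by (rule lip_ext_eq) (use L D(2,3) lipD that D(4) lip Tvals in auto)
  \<comment> \<open>The loss is recentred at the prediction of \<open>fstar\<close>, so that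
    \<open>\<phi>\<close> takes increments and vanishes at 0.\<close>
  define \<phi> where "\<phi> i z u = ext (snd (z i)) (fstar (fst (z i)) + u) - ext (snd (z i)) (fstar (fst (z i)))" for i and z :: "nat \<Rightarrow> 'x \<times> 'y" and u
  have "(\<Sum>A\<in>Pow J. outer_nn_integral \<Omega> (\<lambda>z. SUP f\<in>T. ennreal (\<Sum>i\<in>J. sign_on A i * \<phi> i z (f (fst (z i)) - fstar (fst (z i))))))
    \<le> ennreal L * (\<Sum>A\<in>Pow J. outer_nn_integral \<Omega> (\<lambda>z. SUP f\<in>T. ennreal (\<Sum>i\<in>J. sign_on A i * (f (fst (z i)) - fstar (fst (z i))))))"
  proof (rule outer_contraction[OF prob_\<Omega> finJ])
    fix i z u v assume "i \<in> J" "z \<in> space \<Omega>"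
    then have "snd (z i) \<in> space MY" using \<Omega>_space by blast
    from ext_lip[OF this, of "fstar (fst (z i)) + u" "fstar (fst (z i)) + v"]
    show "\<bar>\<phi> i z u - \<phi> i z v\<bar> \<le> L * \<bar>u - v\<bar>" by (simp add: \<phi>_def)
  next
    fix i u assume i: "i \<in> J"
    note [measurable] = coord_measurable[OF i] D(5) Tmeas[OF fstar]
    \<comment> \<open>Measurable as an infimum over the countable set \<open>D\<close>.\<close>
    have "(\<lambda>z. ext (snd (z i)) (fstar (fst (z i)) + c)) \<in> borel_measurable \<Omega>" for c
      unfolding ext_def lip_ext_def by (rule borel_measurable_cINF_real[OF D(1)]) measurable
    from this[of u] this[of 0] show "(\<lambda>z. \<phi> i z u) \<in> borel_measurable \<Omega>" unfolding \<phi>_def by simp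
  qed (use L in \<open>auto simp: \<phi>_def\<close>)
  moreover have "xloss f (z i) = \<phi> i z (f (fst (z i)) - fstar (fst (z i)))" if "f \<in> T" "i \<in> J" "z \<in> space \<Omega>" for f i z
    using \<Omega>_space[OF that(3,2)] that(1) fstar
    by (simp add: \<phi>_def xloss_def loss_def ext_eq case_prod_beta)
  then have "(\<Sum>A\<in>Pow J. outer_nn_integral \<Omega> (\<lambda>z. SUP f\<in>T. ennreal (\<Sum>i\<in>J. sign_on A i * xloss f (z i))))
    = (\<Sum>A\<in>Pow J. outer_nn_integral \<Omega> (\<lambda>z. SUP f\<in>T. ennreal (\<Sum>i\<in>J. sign_on A i * \<phi> i z (f (fst (z i)) - fstar (fst (z i))))))"
    by (intro sum.cong outer_nn_integral_cong SUP_cong refl arg_cong[where f = ennreal]) auto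
  ultimately show ?thesis by simp
qed

text \<open>Block signs are passed down to the data of the block, and symmetrization is carried out
  over single data points. The fresh signs absorb the inherited ones, so the bound no longer depends
  on \<open>A\<close>.\<close>

lemma deviation_symmetrization:
  assumes A: "A \<in> Pow KK"
  shows "outer_nn_integral \<Omega> (\<lambda>z. SUP f\<in>T. ennreal (\<Sum>k\<in>KK. sign_on A k * dev f k z))
    \<le> ennreal (2 / 2 ^ card J) * (ennreal (1 / real s) *
      (\<Sum>A\<in>Pow J. outer_nn_integral \<Omega> (\<lambda>z. SUP f\<in>T. ennreal (\<Sum>i\<in>J. sign_on A i * xloss f (z i)))))"
proof -
  \<comment> \<open>The data indices that inherit sign -1 from their block.\<close>
  define U where "U = (\<Union>k\<in>A. B k)"
  have UJ: "U \<subseteq> J" using A BJ by (auto simp: U_def)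
  have sgn: "sign_on U i = sign_on A k" if "k \<in> KK" "i \<in> B k" for i k
    using B_disj[OF that(1)] that A by (auto simp: sign_on_def U_def)
  define g where "g f i z = sign_on U i * (xloss f (z i) / real s)" for f and i and z :: "nat \<Rightarrow> 'x \<times> 'y"
  have eq: "(\<Sum>k\<in>KK. sign_on A k * dev f k z) = (\<Sum>i\<in>J. g f i z - (\<integral>z. g f i z \<partial>\<Omega>))" if f: "f \<in> T" for f z
  proof -
    have "(\<Sum>i\<in>J. g f i z - (\<integral>z. g f i z \<partial>\<Omega>))
      = (\<Sum>i\<in>J. sign_on U i * ((xloss f (z i) - (\<integral>z. xloss f z \<partial>Ps i)) / real s))"
      by (intro sum.cong refl) (simp add: xloss_coord(2)[OF f] g_def right_diff_distrib diff_divide_distrib)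
    also have "\<dots> = (\<Sum>k\<in>KK. \<Sum>i\<in>B k. sign_on U i * ((xloss f (z i) - (\<integral>z. xloss f z \<partial>Ps i)) / real s))"
      unfolding J using KK B_fin B_disj by (intro sum.UNION_disjoint) auto
    also have "\<dots> = (\<Sum>k\<in>KK. sign_on A k * dev f k z)"
      by (intro sum.cong refl) (simp add: dev_def sgn sum_divide_distrib sum_distrib_left)
    finally show ?thesis ..
  qed
  have "outer_nn_integral \<Omega> (\<lambda>z. SUP f\<in>T. ennreal (\<Sum>k\<in>KK. sign_on A k * dev f k z))
    = outer_nn_integral \<Omega> (\<lambda>z. SUP f\<in>T. ennreal (\<Sum>i\<in>J. g f i z - (\<integral>z. g f i z \<partial>\<Omega>)))"
    by (intro outer_nn_integral_cong SUP_cong refl) (simp add: eq)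
  also have "\<dots> \<le> ennreal (2 / 2 ^ card J) *
      (\<Sum>A\<in>Pow J. outer_nn_integral \<Omega> (\<lambda>z. SUP f\<in>T. ennreal (\<Sum>i\<in>J. sign_on A i * g f i z)))"
  \<comment> \<open>Here every data point is a block of its own.\<close>
  proof (rule outer_symmetrization[where B = "\<lambda>i. {i}"])
    show "integrable \<Omega> (g f i)" if "f \<in> T" "i \<in> J" for f i
      unfolding g_def using xloss_coord[OF that] by simp
  qed (auto simp: finJ g_def)
  also have "(\<Sum>A\<in>Pow J. outer_nn_integral \<Omega> (\<lambda>z. SUP f\<in>T. ennreal (\<Sum>i\<in>J. sign_on A i * g f i z)))
    \<le> (\<Sum>A\<in>Pow J. ennreal (1 / real s) * outer_nn_integral \<Omega> (\<lambda>z. SUP f\<in>T. ennreal (\<Sum>i\<in>J. sign_on (A - U \<union> (U - A)) i * xloss f (z i))))"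
  proof (intro sum_mono outer_nn_integral_cmult_le SUP_least)
    fix A z f assume f: "f \<in> T"
    have "(\<Sum>i\<in>J. sign_on A i * g f i z) = 1 / real s * (\<Sum>i\<in>J. sign_on (A - U \<union> (U - A)) i * xloss f (z i))"
      by (simp add: g_def sum_divide_distrib mult.assoc sign_on_mult[symmetric])
    also have "ennreal \<dots> = ennreal (1 / real s) * ennreal (\<Sum>i\<in>J. sign_on (A - U \<union> (U - A)) i * xloss f (z i))"
      by (rule ennreal_mult') simp
    also have "\<dots> \<le> ennreal (1 / real s) * (SUP f\<in>T. ennreal (\<Sum>i\<in>J. sign_on (A - U \<union> (U - A)) i * xloss f (z i)))"
      by (intro mult_left_mono SUP_upper f) simp
    finally show "ennreal (\<Sum>i\<in>J. sign_on A i * g f i z)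
      \<le> ennreal (1 / real s) * (SUP f\<in>T. ennreal (\<Sum>i\<in>J. sign_on (A - U \<union> (U - A)) i * xloss f (z i)))" .
  qed
  also have "\<dots> = ennreal (1 / real s) *
      (\<Sum>A\<in>Pow J. outer_nn_integral \<Omega> (\<lambda>z. SUP f\<in>T. ennreal (\<Sum>i\<in>J. sign_on A i * xloss f (z i))))"
    unfolding sum_distrib_left[symmetric]
    by (subst sum_Pow_symdiff[OF UJ, of "\<lambda>A. outer_nn_integral \<Omega> (\<lambda>z. SUP f\<in>T. ennreal (\<Sum>i\<in>J. sign_on A i * xloss f (z i)))"]) simp
  finally show ?thesis by (simp add: mult_left_mono)
qed

text \<open>The integrand of \<open>complexity_E\<close> at the index set \<open>J\<close>, once
  \<open>T\<close> is the sublevel set of the risk.\<close>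

definition rad :: "(nat \<Rightarrow> 'x \<times> real) \<Rightarrow> ennreal" where
  "rad w = (SUP f\<in>T. ennreal \<bar>(1 / real (card J)) * (\<Sum>i\<in>J. snd (w i) * (f (fst (w i)) - fstar (fst (w i))))\<bar>)"

text \<open>The responses are forgotten by pushing the data law forward along \<open>fst\<close>;
  then the fixed-sign outer integrals are collected into the joint one that defines the
  complexity.\<close>

lemma rademacher_average_bound:
  "ennreal (1 / 2 ^ card J) * (\<Sum>A\<in>Pow J. outer_nn_integral \<Omega> (\<lambda>z. SUP f\<in>T. ennreal (\<Sum>i\<in>J. sign_on A i * (f (fst (z i)) - fstar (fst (z i))))))
    \<le> ennreal (real (card J)) * outer_nn_integral (PiM J (\<lambda>i. distr (Ps i) MX fst \<Otimes>\<^sub>M rademacher)) rad"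
proof -
  define mu where "mu i = distr (Ps i) MX fst" for i
  have fm: "fst \<in> measurable (Ps i) MX" for i
    by (simp add: measurable_cong_sets[OF sets_Ps refl])
  have mu_prob: "prob_space (mu i)" for i
    unfolding mu_def by (rule prob_space.prob_space_distr[OF prob fm])
  have MX_mu: "sets (mu i) = sets MX" for i by (simp add: mu_def)
  have dmu: "distr \<Omega> (PiM J mu) (compose J fst) = PiM J mu"
  proof -
    have fm': "fst \<in> measurable (Ps i) (mu i)" for i using fm by (simp add: measurable_cong_sets[OF refl MX_mu])
    have "distr \<Omega> (PiM J mu) (compose J fst) = PiM J (\<lambda>i. distr (Ps i) (mu i) fst)"
      using distr_PiM_finite_prob_space'[OF finJ prob mu_prob fm'] .
    also have "\<dots> = PiM J mu" unfolding mu_def by (intro PiM_cong refl distr_cong) simp_all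
    finally show ?thesis .
  qed
  have cm: "compose J fst \<in> measurable \<Omega> (PiM J mu)"
    unfolding compose_def
    by (rule measurable_restrict, rule measurable_compose[OF measurable_component_singleton])
       (use fm in \<open>auto simp: measurable_cong_sets[OF refl MX_mu]\<close>)
  have "outer_nn_integral \<Omega> (\<lambda>z. SUP f\<in>T. ennreal (\<Sum>i\<in>J. sign_on A i * (f (fst (z i)) - fstar (fst (z i)))))
    \<le> ennreal (real (card J)) * outer_nn_integral (PiM J mu) (\<lambda>x. rad (\<lambda>i\<in>J. (x i, sign_on A i)))" for A
  proof -
    have "outer_nn_integral \<Omega> (\<lambda>z. SUP f\<in>T. ennreal (\<Sum>i\<in>J. sign_on A i * (f (fst (z i)) - fstar (fst (z i)))))
      \<le> ennreal (real (card J)) * outer_nn_integral \<Omega> (\<lambda>z. rad (\<lambda>i\<in>J. (fst (z i), sign_on A i)))"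
    proof (intro outer_nn_integral_cmult_le SUP_least)
      fix z f assume f: "f \<in> T"
      let ?S = "\<Sum>i\<in>J. sign_on A i * (f (fst (z i)) - fstar (fst (z i)))"
      have "?S \<le> real (card J) * \<bar>1 / real (card J) * ?S\<bar>"
        using finJ by (cases "J = {}") (auto simp: abs_mult)
      then have "ennreal ?S \<le> ennreal (real (card J)) * ennreal \<bar>1 / real (card J) * ?S\<bar>"
        by (subst ennreal_mult'[symmetric]) (auto intro: ennreal_leI)
      also have "\<dots> \<le> ennreal (real (card J)) * rad (\<lambda>i\<in>J. (fst (z i), sign_on A i))"
        unfolding rad_def by (intro mult_left_mono SUP_upper2[OF f]) (auto cong: sum.cong)
      finally show "ennreal ?S \<le> ennreal (real (card J)) * rad (\<lambda>i\<in>J. (fst (z i), sign_on A i))" .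
    qed
    also have "outer_nn_integral \<Omega> (\<lambda>z. rad (\<lambda>i\<in>J. (fst (z i), sign_on A i)))
      \<le> outer_nn_integral (PiM J mu) (\<lambda>x. rad (\<lambda>i\<in>J. (x i, sign_on A i)))"
      by (rule outer_nn_integral_distr[OF cm dmu]) (simp add: compose_def cong: restrict_cong)
    finally show ?thesis by (simp add: mult_left_mono)
  qed
  then have "ennreal (1 / 2 ^ card J) * (\<Sum>A\<in>Pow J. outer_nn_integral \<Omega> (\<lambda>z. SUP f\<in>T. ennreal (\<Sum>i\<in>J. sign_on A i * (f (fst (z i)) - fstar (fst (z i))))))
    \<le> ennreal (1 / 2 ^ card J) * (\<Sum>A\<in>Pow J. ennreal (real (card J)) * outer_nn_integral (PiM J mu) (\<lambda>x. rad (\<lambda>i\<in>J. (x i, sign_on A i))))"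
    by (intro mult_left_mono sum_mono) auto
  also have "\<dots> = ennreal (real (card J)) * (ennreal (1 / 2 ^ card J) * (\<Sum>A\<in>Pow J. outer_nn_integral (PiM J mu) (\<lambda>x. rad (\<lambda>i\<in>J. (x i, sign_on A i)))))"
    by (simp add: sum_distrib_left[symmetric] ac_simps)
  also have "\<dots> \<le> ennreal (real (card J)) * outer_nn_integral (PiM J (\<lambda>i. mu i \<Otimes>\<^sub>M rademacher)) rad"
    by (intro mult_left_mono outer_nn_integral_signs_le finJ product_prob_spaceI mu_prob) simp
  finally show ?thesis unfolding mu_def .
qed

definition excess :: "(nat \<Rightarrow> 'x \<times> 'y) \<Rightarrow> ennreal" where
  "excess z = (SUP f\<in>T. ennreal (\<Sum>k\<in>KK. bad f k z - (\<integral>z'. bad f k z' \<partial>\<Omega>)))"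

text \<open>The factors are 2 (blocks), 8 / r^2 (ramp), 2 / s (data) and L (loss), together 32 L /
  (r^2 s). The complexity contributes \<open>card J\<close> times r^2 / (768 L), and
  \<open>card J\<close> is s times the number of blocks, whence 32/768 = 1/24 per block. The 2 ^ n
  block signs cancel because the inner bound is the same for each of them.\<close>

lemma excess_mean:
  assumes comp: "outer_nn_integral (PiM J (\<lambda>i. distr (Ps i) MX fst \<Otimes>\<^sub>M rademacher)) rad \<le> ennreal (r\<^sup>2 / (768 * L))"
  shows "outer_nn_integral \<Omega> excess \<le> ennreal (real (card KK) / 24)"
proof -
  let ?n = "card KK" and ?m = "card J"
  let ?X = "\<Sum>A\<in>Pow J. outer_nn_integral \<Omega> (\<lambda>z. SUP f\<in>T. ennreal (\<Sum>i\<in>J. sign_on A i * xloss f (z i)))"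
  let ?Y = "\<Sum>A\<in>Pow J. outer_nn_integral \<Omega> (\<lambda>z. SUP f\<in>T. ennreal (\<Sum>i\<in>J. sign_on A i * (f (fst (z i)) - fstar (fst (z i)))))"
  have "outer_nn_integral \<Omega> excess \<le> ennreal (2 / 2 ^ ?n) *
      (\<Sum>A\<in>Pow KK. outer_nn_integral \<Omega> (\<lambda>z. SUP f\<in>T. ennreal (\<Sum>k\<in>KK. sign_on A k * bad f k z)))"
    unfolding excess_def
  proof (rule outer_symmetrization[where B = B, OF finJ KK B_disj])
    show "bad f k z = bad f k z'" if "\<And>i. i \<in> B k \<Longrightarrow> z i = z' i" for f k z z'
      unfolding bad_def using dev_cong[OF that] by simp
  qed (auto intro: bad_integrable)
  also have "(\<Sum>A\<in>Pow KK. outer_nn_integral \<Omega> (\<lambda>z. SUP f\<in>T. ennreal (\<Sum>k\<in>KK. sign_on A k * bad f k z)))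
    \<le> ennreal (8 / r\<^sup>2) * (\<Sum>A\<in>Pow KK. outer_nn_integral \<Omega> (\<lambda>z. SUP f\<in>T. ennreal (\<Sum>k\<in>KK. sign_on A k * dev f k z)))"
    unfolding bad_def
  proof (rule outer_contraction[where \<phi> = "\<lambda>k z u. ramp (4 / r\<^sup>2 * u)", OF prob_\<Omega> KK])
    fix u v
    \<comment> \<open>Slope 2 of the ramp times the scale 4 / r^2.\<close>
    have "\<bar>ramp (4 / r\<^sup>2 * u) - ramp (4 / r\<^sup>2 * v)\<bar> \<le> 2 * \<bar>4 / r\<^sup>2 * u - 4 / r\<^sup>2 * v\<bar>" by (rule ramp_lipschitz)
    also have "4 / r\<^sup>2 * u - 4 / r\<^sup>2 * v = 4 / r\<^sup>2 * (u - v)" by (simp only: right_diff_distrib)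
    also have "2 * \<bar>4 / r\<^sup>2 * (u - v)\<bar> = 8 / r\<^sup>2 * \<bar>u - v\<bar>" by (simp only: abs_mult) simp
    finally show "\<bar>ramp (4 / r\<^sup>2 * u) - ramp (4 / r\<^sup>2 * v)\<bar> \<le> 8 / r\<^sup>2 * \<bar>u - v\<bar>" .
  qed (auto simp: ramp_bounds)
  also have "(\<Sum>A\<in>Pow KK. outer_nn_integral \<Omega> (\<lambda>z. SUP f\<in>T. ennreal (\<Sum>k\<in>KK. sign_on A k * dev f k z)))
    \<le> (\<Sum>A\<in>Pow KK. ennreal (2 / 2 ^ ?m) * (ennreal (1 / real s) * ?X))"
    by (intro sum_mono deviation_symmetrization)
  also have "\<dots> = ennreal (2 ^ ?n) * (ennreal (2 / 2 ^ ?m) * (ennreal (1 / real s) * ?X))"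
    using KK by (simp add: card_Pow ennreal_of_nat_eq_real_of_nat)
  also have "?X \<le> ennreal L * ?Y" by (rule loss_contraction)
  finally have "outer_nn_integral \<Omega> excess \<le> ennreal (2 / 2 ^ ?n) * (ennreal (8 / r\<^sup>2) *
      (ennreal (2 ^ ?n) * (ennreal (2 / 2 ^ ?m) * (ennreal (1 / real s) * (ennreal L * ?Y)))))"
    by (simp add: mult_left_mono)
  also have "ennreal (2 / 2 ^ ?m) = ennreal 2 * ennreal (1 / 2 ^ ?m)"
    by (subst ennreal_mult[symmetric]) auto
  also have "ennreal (2 / 2 ^ ?n) * (ennreal (8 / r\<^sup>2) * (ennreal (2 ^ ?n) * (ennreal 2 * ennreal (1 / 2 ^ ?m) * (ennreal (1 / real s) * (ennreal L * ?Y)))))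
    = (ennreal (2 / 2 ^ ?n) * ennreal (8 / r\<^sup>2) * ennreal (2 ^ ?n) * ennreal 2 * ennreal (1 / real s) * ennreal L) * (ennreal (1 / 2 ^ ?m) * ?Y)"
    by (simp only: ac_simps)
  also have "ennreal (2 / 2 ^ ?n) * ennreal (8 / r\<^sup>2) * ennreal (2 ^ ?n) * ennreal 2 * ennreal (1 / real s) * ennreal L
    = ennreal (2 / 2 ^ ?n * (8 / r\<^sup>2) * 2 ^ ?n * 2 * (1 / real s) * L)"
    by (subst ennreal_mult''[symmetric], use L in simp)+ (rule refl)
  also have "2 / 2 ^ ?n * (8 / r\<^sup>2) * 2 ^ ?n * 2 * (1 / real s) * L = 32 * L / (r\<^sup>2 * real s)"
    by (simp add: field_simps)
  also have "ennreal (1 / 2 ^ ?m) * ?Y \<le> ennreal (real ?m) * ennreal (r\<^sup>2 / (768 * L))"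
    using rademacher_average_bound comp by (meson mult_left_mono order_trans zero_le)
  also have "ennreal (32 * L / (r\<^sup>2 * real s)) * (ennreal (real ?m) * ennreal (r\<^sup>2 / (768 * L)))
    = ennreal (32 * L / (r\<^sup>2 * real s) * (real ?m * (r\<^sup>2 / (768 * L))))"
    by (subst ennreal_mult''[symmetric], use L in simp)+ (rule refl)
  also have "32 * L / (r\<^sup>2 * real s) * (real ?m * (r\<^sup>2 / (768 * L))) = real ?n / 24"
    using L r s by (simp add: cardJ field_simps)
  finally show ?thesis by (simp add: mult_left_mono)
qed

text \<open>The count of deviating blocks is at most the sum of ramps, which is the centred sum plus
  the means: 1/24 + 1/16 + 1/96 = 11/96 per block.\<close>

lemma good_event:
  assumes comp: "outer_nn_integral (PiM J (\<lambda>i. distr (Ps i) MX fst \<Otimes>\<^sub>M rademacher)) rad \<le> ennreal (r\<^sup>2 / (768 * L))"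
    and V: "\<And>f i. f \<in> T \<Longrightarrow> i \<in> J \<Longrightarrow> (\<integral>z. (xloss f z - (\<integral>z'. xloss f z' \<partial>Ps i))\<^sup>2 \<partial>Ps i) \<le> V"
    and Vr: "1536 * V \<le> r ^ 4 * real s"
  shows "\<exists>A\<in>sets \<Omega>. measure \<Omega> A \<ge> 1 - exp (- (real (card KK) / 512)) \<and>
    (\<forall>z\<in>A. \<forall>f\<in>T. 96 * real (card {k\<in>KK. r\<^sup>2 / 4 < \<bar>dev f k z\<bar>}) \<le> 11 * real (card KK))"
proof -
  let ?n = "real (card KK)"
  have e0: "0 \<le> (\<integral>z'. bad f k z' \<partial>\<Omega>)" for f k
    by (rule Bochner_Integration.integral_nonneg) (simp add: bad_bounds)
  have bound: "excess z \<le> ennreal ?n" for z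
    unfolding excess_def
  proof (intro SUP_least ennreal_leI)
    fix f
    have "(\<Sum>k\<in>KK. bad f k z - (\<integral>z'. bad f k z' \<partial>\<Omega>)) \<le> (\<Sum>k\<in>KK. 1)"
      using bad_bounds e0 by (intro sum_mono) (smt (verit))
    then show "(\<Sum>k\<in>KK. bad f k z - (\<integral>z'. bad f k z' \<partial>\<Omega>)) \<le> ?n" by simp
  qed
  \<comment> \<open>Changing one block alters one summand, which lies in [0, 1] before centring, and
    the centring does not depend on the data.\<close>
  have diff: "excess z \<le> excess (override_on z z' (B k)) + 1" if k: "k \<in> KK" for z z' k
    unfolding excess_def
  proof (rule SUP_least)
    fix f assume f: "f \<in> T"
    let ?z = "override_on z z' (B k)" and ?E = "\<lambda>k. \<integral>z'. bad f k z' \<partial>\<Omega>"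
    have other: "bad f k' ?z = bad f k' z" if "k' \<in> KK - {k}" for k'
    proof -
      have "dev f k' ?z = dev f k' z"
        using B_disj[OF k, of k'] that by (intro dev_cong) (auto simp: override_on_def)
      then show ?thesis by (simp add: bad_def)
    qed
    have "(\<Sum>k\<in>KK. bad f k z - ?E k) = (bad f k z - ?E k) + (\<Sum>k\<in>KK - {k}. bad f k z - ?E k)"
      using KK k by (rule sum.remove)
    also have "\<dots> \<le> 1 + (bad f k ?z - ?E k) + (\<Sum>k\<in>KK - {k}. bad f k ?z - ?E k)"
    proof -
      have "(\<Sum>k\<in>KK - {k}. bad f k ?z - ?E k) = (\<Sum>k\<in>KK - {k}. bad f k z - ?E k)"
        by (intro sum.cong refl) (simp only: other)
      then show ?thesis using bad_bounds[of f k z] bad_bounds[of f k ?z] by linarith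
    qed
    also have "\<dots> = (\<Sum>k\<in>KK. bad f k ?z - ?E k) + 1"
      using sum.remove[OF KK k, of "\<lambda>k. bad f k ?z - ?E k"] by simp
    finally have "ennreal (\<Sum>k\<in>KK. bad f k z - ?E k) \<le> ennreal ((\<Sum>k\<in>KK. bad f k ?z - ?E k) + 1)"
      by (rule ennreal_leI)
    also have "\<dots> \<le> ennreal (\<Sum>k\<in>KK. bad f k ?z - ?E k) + 1"
      using ennreal_add_le[of _ 1] by simp
    also have "\<dots> \<le> (SUP f\<in>T. ennreal (\<Sum>k\<in>KK. bad f k ?z - (\<integral>z'. bad f k z' \<partial>\<Omega>))) + 1"
      by (intro add_right_mono SUP_upper f)
    finally show "ennreal (\<Sum>k\<in>KK. bad f k z - ?E k) \<le> (SUP f\<in>T. ennreal (\<Sum>k\<in>KK. bad f k ?z - (\<integral>z'. bad f k z' \<partial>\<Omega>))) + 1" .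
  qed
  \<comment> \<open>Deviation 1/16 per block gives the exponent (1/16)^2 / 2 = 1/512 per
    block.\<close>
  obtain A where A: "A \<in> sets \<Omega>" "measure \<Omega> A \<ge> 1 - exp (- ((1 / 16)\<^sup>2 / 2 * ?n))"
    "\<And>z. z \<in> A \<Longrightarrow> excess z < ennreal (?n / 24 + ?n * (1 / 16))"
    using outer_concentration[OF KK B_fin B_disj J bound diff excess_mean[OF comp], of "1 / 16"] by auto
  have "96 * real (card {k\<in>KK. r\<^sup>2 / 4 < \<bar>dev f k z\<bar>}) \<le> 11 * ?n" if z: "z \<in> A" and f: "f \<in> T" for z f
  proof -
    have "ennreal (\<Sum>k\<in>KK. bad f k z - (\<integral>z'. bad f k z' \<partial>\<Omega>)) \<le> excess z"
      unfolding excess_def by (rule SUP_upper[OF f])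
    also have "\<dots> < ennreal (?n / 24 + ?n * (1 / 16))" by (rule A(3)[OF z])
    finally have "ennreal (\<Sum>k\<in>KK. bad f k z - (\<integral>z'. bad f k z' \<partial>\<Omega>)) < ennreal (?n / 24 + ?n * (1 / 16))" .
    then have le: "(\<Sum>k\<in>KK. bad f k z - (\<integral>z'. bad f k z' \<partial>\<Omega>)) \<le> ?n / 24 + ?n * (1 / 16)"
      by (smt (verit) ennreal_leI not_less)
    have "real (card {k\<in>KK. r\<^sup>2 / 4 < \<bar>dev f k z\<bar>}) = (\<Sum>k\<in>{k\<in>KK. r\<^sup>2 / 4 < \<bar>dev f k z\<bar>}. bad f k z)"
    proof -
      have "bad f k z = 1" if "r\<^sup>2 / 4 < \<bar>dev f k z\<bar>" for k
        unfolding bad_def by (rule ramp_bounds(4)) (use that r in \<open>simp add: abs_mult field_simps\<close>)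
      then show ?thesis by simp
    qed
    also have "\<dots> \<le> (\<Sum>k\<in>KK. bad f k z)"
      using KK bad_bounds by (intro sum_mono2) auto
    also have "\<dots> = (\<Sum>k\<in>KK. bad f k z - (\<integral>z'. bad f k z' \<partial>\<Omega>)) + (\<Sum>k\<in>KK. \<integral>z'. bad f k z' \<partial>\<Omega>)"
      by (simp add: sum_subtractf)
    also have "\<dots> \<le> ?n / 24 + ?n * (1 / 16) + (\<Sum>k\<in>KK. 1 / 96)"
      by (intro add_mono le sum_mono bad_expectation[OF f _ V[OF f] Vr])
    finally show ?thesis by simp
  qed
  with A(1,2) show ?thesis by (intro bexI[of _ A]) (auto simp: power2_eq_square)
qed

end

section \<open>From block deviations to the minmax estimator\<close>

text \<open>Makes the risk Lipschitz along a segment of the class, as the intermediate value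
  argument requires.\<close>

lemma (in mom_blocks) xloss_integral_diff:
  assumes f: "f \<in> T" and g: "g \<in> T" and i: "i \<in> J"
  shows "\<bar>(\<integral>z. xloss f z \<partial>Ps i) - (\<integral>z. xloss g z \<partial>Ps i)\<bar> \<le> L * (\<integral>z. \<bar>f (fst z) - g (fst z)\<bar> \<partial>Ps i)"
proof -
  have fst_m: "fst \<in> measurable (Ps i) MX" by (simp add: measurable_cong_sets[OF sets_Ps refl])
  have int: "integrable (Ps i) (\<lambda>z. h (fst z))" if "h \<in> T" for h
    using M.square_integrable_imp_integrable[OF measurable_compose[OF fst_m Tmeas[OF that]] L2[OF i that]] .
  have "\<bar>(\<integral>z. xloss f z \<partial>Ps i) - (\<integral>z. xloss g z \<partial>Ps i)\<bar> = \<bar>\<integral>z. xloss f z - xloss g z \<partial>Ps i\<bar>"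
    using xloss_integrable f g i by simp
  also have "\<dots> \<le> (\<integral>z. \<bar>xloss f z - xloss g z\<bar> \<partial>Ps i)" by (rule integral_abs_bound)
  also have "\<dots> \<le> (\<integral>z. L * \<bar>f (fst z) - g (fst z)\<bar> \<partial>Ps i)"
  proof (rule integral_mono)
    fix z assume z: "z \<in> space (Ps i)"
    then show "\<bar>xloss f z - xloss g z\<bar> \<le> L * \<bar>f (fst z) - g (fst z)\<bar>"
      using lip[of "snd z" "f (fst z)" "g (fst z)"] Tvals f g by (auto simp: space_Ps xloss_def loss_def)
  qed (use xloss_integrable f g i int in auto)
  finally show ?thesis by simp
qed

text \<open>The deterministic part, at one outcome \<open>w\<close>. A function of risk above r^2
  loses to \<open>fstar\<close> by at least 3/4 r^2 on a majority of blocks, and no function beats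
  \<open>fstar\<close> by more than r^2 / 4 in the median. A far \<open>fh\<close> would thus have a
  larger objective than \<open>fstar\<close>. The accurate blocks must lie in \<open>KK\<close>,
  since \<open>shrink\<close> is granted only there: outlying data may leave the sample space on
  which the loss is convex.\<close>

lemma minmax_MOM_risk_bound:
  fixes R :: "('x \<Rightarrow> real) \<Rightarrow> real" and lb :: "real \<Rightarrow> 'y \<Rightarrow> real" and N K :: nat
    and B :: "nat \<Rightarrow> nat set" and Z :: "nat \<Rightarrow> 'w \<Rightarrow> 'x \<times> 'y"
  defines "PB \<equiv> \<lambda>f g w k. real K / real N * (\<Sum>i\<in>B k. loss lb f (Z i w) - loss lb g (Z i w))"
  assumes K: "0 < K" and fstar: "fstar \<in> F" and r: "0 < r" and R: "\<And>f. f \<in> F \<Longrightarrow> 0 \<le> R f"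
    and good: "\<And>f. f \<in> F \<Longrightarrow> R f \<le> r\<^sup>2 \<Longrightarrow>
      \<exists>G\<subseteq>{..<K}. G \<subseteq> KK \<and> K < 2 * card G \<and> (\<forall>k\<in>G. \<bar>PB f fstar w k - R f\<bar> \<le> r\<^sup>2 / 4)"
    and shrink: "\<And>f. f \<in> F \<Longrightarrow> r\<^sup>2 < R f \<Longrightarrow>
      \<exists>f0\<in>F. \<exists>t. 0 < t \<and> t \<le> 1 \<and> R f0 = r\<^sup>2 \<and> (\<forall>k\<in>KK. PB f0 fstar w k \<le> t * PB f fstar w k)"
    and fh: "is_minmax_MOM lb F K N B Z fh w"
  shows "R fh \<le> r\<^sup>2"
proof (rule ccontr)
  assume "\<not> R fh \<le> r\<^sup>2"
  \<comment> \<open>At the boundary point \<open>f0\<close> an accurate block shows at least r^2 -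
    r^2 / 4. This makes t times the value at \<open>f\<close> positive, and removing a factor t
    \<le> 1 from a positive number only enlarges it.\<close>
  have far: "\<exists>G\<subseteq>{..<K}. K < 2 * card G \<and> (\<forall>k\<in>G. 3 / 4 * r\<^sup>2 \<le> PB f fstar w k)"
    if f: "f \<in> F" "r\<^sup>2 < R f" for f
  proof -
    obtain f0 t where f0: "f0 \<in> F" "0 < t" "t \<le> 1" "R f0 = r\<^sup>2" "\<And>k. k \<in> KK \<Longrightarrow> PB f0 fstar w k \<le> t * PB f fstar w k"
      using shrink[OF f] by blast
    obtain G where G: "G \<subseteq> {..<K}" "G \<subseteq> KK" "K < 2 * card G" "\<And>k. k \<in> G \<Longrightarrow> \<bar>PB f0 fstar w k - r\<^sup>2\<bar> \<le> r\<^sup>2 / 4"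
      using good[OF f0(1)] f0(4) by auto
    have "3 / 4 * r\<^sup>2 \<le> PB f fstar w k" if k: "k \<in> G" for k
    proof -
      have "3 / 4 * r\<^sup>2 \<le> PB f0 fstar w k" using G(4)[OF k] by linarith
      also have "\<dots> \<le> t * PB f fstar w k" using f0(5) G(2) k by blast
      finally have le: "3 / 4 * r\<^sup>2 \<le> t * PB f fstar w k" .
      moreover have "0 < r\<^sup>2" using r by simp
      ultimately have "0 < t * PB f fstar w k" by linarith
      then have "0 < PB f fstar w k" using f0(2) by (simp add: zero_less_mult_iff)
      then have "t * PB f fstar w k \<le> 1 * PB f fstar w k" using f0(3) by (intro mult_right_mono) auto
      with le show ?thesis by simp
    qed
    with G show ?thesis by blast
  qed
  have MOM_PB: "MOM K N B Z (\<lambda>z. loss lb f z - loss lb g z) w = median_list (map (PB f g w) [0..<K])" for f g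
    by (simp add: MOM_def PB_def)
  have PB_swap: "PB fstar f w k = - PB f fstar w k" for f k
    by (simp add: PB_def sum_subtractf algebra_simps)
  have fhF: "fh \<in> F" and opt: "minmax_obj lb F K N B Z fh w \<le> minmax_obj lb F K N B Z fstar w"
    using fh fstar by (auto simp: is_minmax_MOM_def)
  obtain G where G: "G \<subseteq> {..<K}" "K < 2 * card G" "\<forall>k\<in>G. 3 / 4 * r\<^sup>2 \<le> PB fh fstar w k"
    using far[OF fhF] \<open>\<not> R fh \<le> r\<^sup>2\<close> by auto
  \<comment> \<open>The supremum at \<open>fh\<close> is tested against the single competitor
    \<open>fstar\<close>.\<close>
  have "ereal (3 / 4 * r\<^sup>2) \<le> ereal (MOM K N B Z (\<lambda>z. loss lb fh z - loss lb fstar z) w)"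
    unfolding MOM_PB ereal_less_eq by (rule median_list_ge[OF K G(1,2)]) (use G(3) in blast)
  also have "\<dots> \<le> minmax_obj lb F K N B Z fh w"
    unfolding minmax_obj_def by (rule SUP_upper[OF fstar])
  also note opt
  also have "minmax_obj lb F K N B Z fstar w \<le> ereal (r\<^sup>2 / 4)"
    unfolding minmax_obj_def
  proof (rule SUP_least)
    fix g assume g: "g \<in> F"
    have "\<exists>G\<subseteq>{..<K}. K < 2 * card G \<and> (\<forall>k\<in>G. PB fstar g w k \<le> r\<^sup>2 / 4)"
    proof (cases "R g \<le> r\<^sup>2")
      case True
      obtain G where G: "G \<subseteq> {..<K}" "K < 2 * card G" "\<And>k. k \<in> G \<Longrightarrow> \<bar>PB g fstar w k - R g\<bar> \<le> r\<^sup>2 / 4"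
        using good[OF g True] by blast
      \<comment> \<open>Here the nonnegative excess risk works in favour of
        \<open>fstar\<close>.\<close>
      have "PB fstar g w k \<le> r\<^sup>2 / 4" if "k \<in> G" for k
        using G(3)[OF that] R[OF g] unfolding PB_swap by linarith
      with G(1,2) show ?thesis by blast
    next
      case False
      then obtain G where G: "G \<subseteq> {..<K}" "K < 2 * card G" "\<And>k. k \<in> G \<Longrightarrow> 3 / 4 * r\<^sup>2 \<le> PB g fstar w k"
        using far[OF g] by (auto simp: not_le)
      have "PB fstar g w k \<le> r\<^sup>2 / 4" if "k \<in> G" for k
        using G(3)[OF that] zero_le_power2[of r] unfolding PB_swap by linarith
      with G(1,2) show ?thesis by blast
    qed
    then obtain G where G: "G \<subseteq> {..<K}" "K < 2 * card G" "\<forall>k\<in>G. PB fstar g w k \<le> r\<^sup>2 / 4" by blast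
    then show "ereal (MOM K N B Z (\<lambda>z. loss lb fstar z - loss lb g z) w) \<le> ereal (r\<^sup>2 / 4)"
      unfolding MOM_PB ereal_less_eq by (intro median_list_le[OF K G(1,2)]) (use G(3) in blast)
  qed
  finally have "3 / 4 * r\<^sup>2 \<le> r\<^sup>2 / 4" by simp
  then show False using r by (simp add: field_simps)
qed

section \<open>The contaminated sample and its reduction to clean blocks\<close>

locale mom_setting =
  fixes MX :: "'x measure" and MY :: "'y measure"
    and Ybar :: "real set" and F :: "('x \<Rightarrow> real) set"
    and lb :: "real \<Rightarrow> 'y \<Rightarrow> real" and L :: real
    and P :: "('x \<times> 'y) measure" and fstar :: "'x \<Rightarrow> real"
    and M :: "'w measure" and Z :: "nat \<Rightarrow> 'w \<Rightarrow> 'x \<times> 'y"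
    and N K :: nat and B :: "nat \<Rightarrow> nat set" and Outs Inls :: "nat set"
  assumes P_prob: "prob_space P" and P_sets: "sets P = sets (MX \<Otimes>\<^sub>M MY)"
    and Ybar_vals: "\<forall>f\<in>F. \<forall>x\<in>space MX. f x \<in> Ybar"
    and F_meas: "\<forall>f\<in>F. f \<in> borel_measurable MX"
    and loss_meas: "\<forall>f\<in>F. loss lb f \<in> borel_measurable (MX \<Otimes>\<^sub>M MY)"
    and loss_int: "\<forall>f\<in>F. integrable P (loss lb f)"
    and fstar_in: "fstar \<in> F"
    and fstar_min: "\<forall>f\<in>F. (\<integral>z. loss lb fstar z \<partial>P) \<le> (\<integral>z. loss lb f z \<partial>P)"
    and L_pos: "L > 0"
    and Lip_Conv: "\<forall>y\<in>space MY. convex_on Ybar (\<lambda>u. lb u y) \<and> L-lipschitz_on Ybar (\<lambda>u. lb u y)"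
    and Conv: "\<forall>f\<in>F. \<forall>g\<in>F. \<forall>t\<in>{0..1}. (\<lambda>x. t * f x + (1 - t) * g x) \<in> F"
    and M_prob: "prob_space M"
    and partition: "Outs \<union> Inls = {..<N}"
    and Inl_meas: "\<forall>i\<in>Inls. Z i \<in> measurable M (MX \<Otimes>\<^sub>M MY)"
    and Inl_indep: "prob_space.indep_vars M (\<lambda>_. MX \<Otimes>\<^sub>M MY) Z Inls"
    and Inl_L2: "\<forall>i\<in>Inls. \<forall>f\<in>F. integrable (distr M MX (\<lambda>w. fst (Z i w))) (\<lambda>x. (f x)\<^sup>2)"
    and Inl_risk: "\<forall>i\<in>Inls. \<forall>f\<in>F.
        excess_risk (distr M (MX \<Otimes>\<^sub>M MY) (Z i)) lb fstar f = excess_risk P lb fstar f"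
    and K_pos: "0 < K" and K_dvd: "K dvd N"
    and blocks_card: "\<forall>k<K. card (B k) = N div K"
    and blocks_disj: "\<forall>k<K. \<forall>k'<K. k \<noteq> k' \<longrightarrow> B k \<inter> B k' = {}"
    and blocks_cover: "(\<Union>k<K. B k) = {..<N}"
    and K_lower: "7 * real (card Outs) / 3 \<le> real K" and K_upper: "K \<le> N"
begin

definition clean_blocks :: "nat set" where
  "clean_blocks = {k. k < K \<and> B k \<subseteq> Inls}"

definition clean_data :: "nat set" where
  "clean_data = (\<Union>k\<in>clean_blocks. B k)"

text \<open>The value at outlying indices is irrelevant, but product measures want a probability
  measure at every index.\<close>
definition law :: "nat \<Rightarrow> ('x \<times> 'y) measure" where
  "law i = (if i \<in> Inls then distr M (MX \<Otimes>\<^sub>M MY) (Z i) else P)"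

lemma law_prob: "prob_space (law i)"
  using P_prob prob_space.prob_space_distr[OF M_prob] Inl_meas by (auto simp: law_def)

lemma law_sets: "sets (law i) = sets (MX \<Otimes>\<^sub>M MY)"
  using P_sets by (auto simp: law_def)

lemma lip: "y \<in> space MY \<Longrightarrow> u \<in> Ybar \<Longrightarrow> v \<in> Ybar \<Longrightarrow> \<bar>lb u y - lb v y\<bar> \<le> L * \<bar>u - v\<bar>"
  using Lip_Conv lipschitz_onD[of L Ybar "\<lambda>u. lb u y" u v] by (auto simp: dist_real_def)

lemma fst_Z: "i \<in> Inls \<Longrightarrow> (\<lambda>w. fst (Z i w)) \<in> measurable M MX"
  using Inl_meas by (auto intro: measurable_compose[OF _ measurable_fst])

lemma law_L2:
  assumes i: "i \<in> Inls" and f: "f \<in> F"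
  shows "integrable (law i) (\<lambda>z. (f (fst z))\<^sup>2)"
proof -
  have fm: "f \<in> borel_measurable MX" using F_meas f by auto
  have "integrable M (\<lambda>w. (f (fst (Z i w)))\<^sup>2)"
    using Inl_L2 i f fm integrable_distr_eq[OF fst_Z[OF i], of "\<lambda>x. (f x)\<^sup>2"] by auto
  moreover have "(\<lambda>z. (f (fst z))\<^sup>2) \<in> borel_measurable (MX \<Otimes>\<^sub>M MY)"
    using fm by measurable
  ultimately show ?thesis
    using integrable_distr_eq[of "Z i" M "MX \<Otimes>\<^sub>M MY" "\<lambda>z. (f (fst z))\<^sup>2"] Inl_meas i by (simp add: law_def)
qed

lemma fin_parts: "finite Outs" "finite Inls"
  using partition by (auto intro: finite_subset[of _ "{..<N}"])

lemma B_sub: "k < K \<Longrightarrow> B k \<subseteq> {..<N}"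
  using blocks_cover by auto

lemma N_eq: "N = K * (N div K)" "0 < N div K"
  using K_dvd K_pos K_upper by (auto simp: div_greater_zero_iff)

lemma clean_finite: "finite clean_blocks"
  by (simp add: clean_blocks_def)

lemma clean_data_sub: "clean_data \<subseteq> Inls"
  by (auto simp: clean_data_def clean_blocks_def)

text \<open>Choosing an outlier from each contaminated block is injective because blocks are
  disjoint. So at most \<open>card Outs\<close>, hence at most 3/7 of \<open>K\<close>, blocks are
  contaminated.\<close>

lemma card_clean: "4 * real K \<le> 7 * real (card clean_blocks)"
proof -
  have "\<exists>j. j \<in> B k \<inter> Outs" if "k \<in> {..<K} - clean_blocks" for k
    using that partition B_sub[of k] by (fastforce simp: clean_blocks_def)
  then obtain j where j: "\<And>k. k \<in> {..<K} - clean_blocks \<Longrightarrow> j k \<in> B k \<inter> Outs" by metis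
  have "inj_on j ({..<K} - clean_blocks)"
  proof (rule inj_onI)
    fix a b assume "a \<in> {..<K} - clean_blocks" "b \<in> {..<K} - clean_blocks" "j a = j b"
    then show "a = b" using j[of a] j[of b] blocks_disj by auto
  qed
  then have "card ({..<K} - clean_blocks) \<le> card Outs"
    using j fin_parts by (intro card_inj_on_le) auto
  moreover have "card ({..<K} - clean_blocks) = K - card clean_blocks"
    using clean_finite by (subst card_Diff_subset) (auto simp: clean_blocks_def)
  ultimately have "K \<le> card Outs + card clean_blocks" by simp
  then have "real K \<le> real (card Outs) + real (card clean_blocks)" by linarith
  then show ?thesis using K_lower by simp
qed

lemma clean_nonempty: "clean_blocks \<noteq> {}"
  using card_clean K_pos by auto

text \<open>The class stays variable because it is used twice: all of \<open>F\<close> for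
  continuity of the risk, and the sublevel set for the deviation bound.\<close>

lemma clean_mom_blocks:
  assumes "T \<subseteq> F" "fstar \<in> T" "0 < r"
  shows "mom_blocks law MX MY Ybar T fstar lb L r (N div K) clean_blocks B clean_data"
proof (rule mom_blocks.intro)
  show "integrable (law i) (\<lambda>z. (f (fst z))\<^sup>2)" if "i \<in> clean_data" "f \<in> T" for i f
    using law_L2 that assms(1) clean_data_sub by blast
  show "finite (B k)" if "k \<in> clean_blocks" for k
    using that finite_subset[OF _ fin_parts(2)] by (auto simp: clean_blocks_def)
  show "B k \<inter> B k' = {}" if "k \<in> clean_blocks" "k' \<in> clean_blocks" "k \<noteq> k'" for k k'
    using that blocks_disj by (auto simp: clean_blocks_def)
  show "f x \<in> Ybar" if "f \<in> T" "x \<in> space MX" for f x using that assms(1) Ybar_vals by blast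
  show "f \<in> borel_measurable MX" "loss lb f \<in> borel_measurable (MX \<Otimes>\<^sub>M MY)" if "f \<in> T" for f
    using that assms(1) F_meas loss_meas by blast+
  show "card (B k) = N div K" if "k \<in> clean_blocks" for k
    using that blocks_card by (simp add: clean_blocks_def)
  show "clean_data = (\<Union>k\<in>clean_blocks. B k)" by (rule clean_data_def)
qed (rule law_prob law_sets assms L_pos lip clean_finite N_eq(2); assumption)+

lemma excess_nonneg: "f \<in> F \<Longrightarrow> 0 \<le> excess_risk P lb fstar f"
  using loss_int fstar_min fstar_in by (simp add: excess_risk_def)

lemma excess_fstar [simp]: "excess_risk P lb fstar fstar = 0"
  by (simp add: excess_risk_def)

lemma excess_law: "i \<in> Inls \<Longrightarrow> f \<in> F \<Longrightarrow> (\<integral>z. loss lb f z - loss lb fstar z \<partial>law i) = excess_risk P lb fstar f"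
  using Inl_risk by (auto simp: law_def excess_risk_def)

text \<open>The intermediate value theorem on the segment from \<open>fstar\<close> to
  \<open>f\<close>. Continuity is obtained under the law of one clean data point, where square
  integrability of \<open>F\<close> is given, and it carries over because excess risks agree there
  with those under \<open>P\<close>.\<close>

lemma shrink_to_level:
  assumes f: "f \<in> F" and rpos: "0 < r" and lev: "r\<^sup>2 < excess_risk P lb fstar f"
  shows "\<exists>t. 0 < t \<and> t \<le> 1 \<and> excess_risk P lb fstar (\<lambda>x. t * f x + (1 - t) * fstar x) = r\<^sup>2"
proof -
  interpret mom_blocks law MX MY Ybar F fstar lb L r "N div K" clean_blocks B clean_data
    by (rule clean_mom_blocks) (use fstar_in rpos in auto)
  \<comment> \<open>Any clean data point serves as the reference law; one exists because some block
    is clean and blocks are nonempty.\<close>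
  obtain k where k: "k \<in> clean_blocks" using clean_nonempty by auto
  have "B k \<noteq> {}" using B_card[OF k] N_eq by auto
  then obtain i where i: "i \<in> clean_data" using k by (auto simp: clean_data_def)
  define h where "h t = excess_risk P lb fstar (\<lambda>x. t * f x + (1 - t) * fstar x)" for t
  define C where "C = L * (\<integral>z. \<bar>f (fst z) - fstar (fst z)\<bar> \<partial>law i)"
  have "\<bar>h t - h u\<bar> \<le> C * \<bar>t - u\<bar>" if "t \<in> {0..1}" "u \<in> {0..1}" for t u
  proof -
    let ?f = "\<lambda>t x. t * f x + (1 - t) * fstar x"
    have F: "?f t \<in> F" "?f u \<in> F" using Conv f fstar_in that by auto
    have iI: "i \<in> Inls" using i clean_data_sub by auto
    have "\<bar>h t - h u\<bar> = \<bar>(\<integral>z. xloss (?f t) z \<partial>law i) - (\<integral>z. xloss (?f u) z \<partial>law i)\<bar>"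
      using excess_law[OF iI F(1)] excess_law[OF iI F(2)] by (simp add: h_def xloss_def)
    also have "\<dots> \<le> L * (\<integral>z. \<bar>?f t (fst z) - ?f u (fst z)\<bar> \<partial>law i)"
      by (rule xloss_integral_diff[OF F i])
    also have "(\<lambda>z. \<bar>?f t (fst z) - ?f u (fst z)\<bar>) = (\<lambda>z. \<bar>t - u\<bar> * \<bar>f (fst z) - fstar (fst z)\<bar>)"
      by (simp add: abs_mult[symmetric] algebra_simps)
    finally show ?thesis by (simp add: C_def ac_simps)
  qed
  moreover have "0 \<le> C" unfolding C_def using L_pos by (intro mult_nonneg_nonneg) auto
  ultimately have "C-lipschitz_on {0..1} h"
    by (intro lipschitz_onI) (auto simp: dist_real_def)
  then have "continuous_on {0..1} h" by (rule lipschitz_on_continuous_on)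
  then obtain t where t: "0 \<le> t" "t \<le> 1" "h t = r\<^sup>2"
    using IVT'[of h 0 "r\<^sup>2" 1] rpos less_imp_le[OF lev] by (auto simp: h_def)
  then have "t \<noteq> 0" using rpos by (auto simp: h_def)
  with t show ?thesis unfolding h_def by (intro exI[of _ t]) auto
qed

lemma loss_convex:
  assumes f: "f \<in> F" and t: "0 \<le> t" "t \<le> 1" and z: "z \<in> space MX \<times> space MY"
  shows "loss lb (\<lambda>x. t * f x + (1 - t) * fstar x) z - loss lb fstar z \<le> t * (loss lb f z - loss lb fstar z)"
proof -
  have "convex_on Ybar (\<lambda>u. lb u (snd z))" using Lip_Conv z by auto
  from convex_onD[OF this t, of "fstar (fst z)" "f (fst z)"]
  have "lb (t * f (fst z) + (1 - t) * fstar (fst z)) (snd z)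
    \<le> (1 - t) * lb (fstar (fst z)) (snd z) + t * lb (f (fst z)) (snd z)"
    using Ybar_vals f fstar_in z by (auto simp: add.commute)
  then show ?thesis by (simp add: loss_def case_prod_beta algebra_simps)
qed

text \<open>Independence of the inliers as an identity of laws; it transports events from the
  product space back to \<open>M\<close>.\<close>

lemma data_law:
  "distr M (PiM clean_data law) (\<lambda>w. \<lambda>i\<in>clean_data. Z i w) = PiM clean_data law"
proof -
  interpret M: prob_space M by (rule M_prob)
  let ?S = "MX \<Otimes>\<^sub>M MY"
  have ne: "clean_data \<noteq> {}"
  proof -
    obtain k where k: "k \<in> clean_blocks" using clean_nonempty by auto
    then have "B k \<noteq> {}" using blocks_card N_eq by (auto simp: clean_blocks_def)
    then show ?thesis using k by (auto simp: clean_data_def)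
  qed
  have "M.indep_vars (\<lambda>_. ?S) Z clean_data"
    using M.indep_vars_subset[OF Inl_indep clean_data_sub] .
  then have "distr M (PiM clean_data (\<lambda>_. ?S)) (\<lambda>w. \<lambda>i\<in>clean_data. Z i w) = PiM clean_data (\<lambda>i. distr M ?S (Z i))"
    using M.indep_vars_iff_distr_eq_PiM'[OF ne, of Z "\<lambda>_. ?S"] Inl_meas clean_data_sub by auto
  also have "PiM clean_data (\<lambda>i. distr M ?S (Z i)) = PiM clean_data law"
    using clean_data_sub by (intro PiM_cong) (auto simp: law_def)
  also have "distr M (PiM clean_data (\<lambda>_. ?S)) (\<lambda>w. \<lambda>i\<in>clean_data. Z i w) = distr M (PiM clean_data law) (\<lambda>w. \<lambda>i\<in>clean_data. Z i w)"
    by (intro distr_cong refl sets_PiM_cong) (simp add: law_sets)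
  finally show ?thesis .
qed

text \<open>The bound for a radius that satisfies both complexity conditions itself. The good event
  of the product space is pulled back along the clean data, and on it the deterministic comparison
  applies.\<close>

lemma minmax_event:
  assumes r: "0 < r"
    and E: "complexity_E P lb F fstar Inls N (\<lambda>i. distr M MX (\<lambda>w. fst (Z i w))) r \<le> ennreal (r\<^sup>2 / (768 * L))"
    and V: "ennreal (sqrt 1536) * complexity_V P lb F fstar Inls N K (\<lambda>i. distr M (MX \<Otimes>\<^sub>M MY) (Z i)) r \<le> ennreal (r\<^sup>2)"
  shows "\<exists>A\<in>sets M. measure M A \<ge> 1 - exp (- real K / 2016) \<and>
    (\<forall>w\<in>A. \<forall>fh. is_minmax_MOM lb F K N B Z fh w \<longrightarrow> excess_risk P lb fstar fh \<le> r\<^sup>2)"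
proof -
  define T where "T = {f \<in> F. excess_risk P lb fstar f \<le> r\<^sup>2}"
  define s where "s = N div K"
  have sN: "0 < s" "real N = real K * real s" using N_eq by (simp_all add: s_def flip: of_nat_mult)
  interpret mom_blocks law MX MY Ybar T fstar lb L r s clean_blocks B clean_data
    unfolding s_def by (rule clean_mom_blocks) (use fstar_in r in \<open>auto simp: T_def\<close>)
  have comp: "outer_nn_integral (PiM clean_data (\<lambda>i. distr (law i) MX fst \<Otimes>\<^sub>M rademacher)) rad \<le> ennreal (r\<^sup>2 / (768 * L))"
  proof -
    have radE: "rad = (\<lambda>w. SUP f\<in>{f \<in> F. excess_risk P lb fstar f \<le> r\<^sup>2}.
        ennreal \<bar>(1 / real (card clean_data)) * (\<Sum>i\<in>clean_data. snd (w i) * (f (fst (w i)) - fstar (fst (w i))))\<bar>)"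
      by (rule ext, subst rad_def) (simp only: T_def)
    have "distr (law i) MX fst = distr M MX (\<lambda>w. fst (Z i w))" if "i \<in> clean_data" for i
      using that clean_data_sub Inl_meas by (auto simp: law_def distr_distr comp_def)
    then have "PiM clean_data (\<lambda>i. distr (law i) MX fst \<Otimes>\<^sub>M rademacher)
      = PiM clean_data (\<lambda>i. distr M MX (\<lambda>w. fst (Z i w)) \<Otimes>\<^sub>M rademacher)"
      by (intro PiM_cong) auto
    \<comment> \<open>Clean blocks hold at least 4/7 of the sample, so this index set is admissible
      in the supremum over sets of at least half the sample.\<close>
    moreover have "clean_data \<in> {J. J \<subseteq> Inls \<and> real N \<le> 2 * real (card J)}"
    proof -
      have "4 * real N = 4 * real K * real s" by (simp add: sN)
      also have "\<dots> \<le> 7 * real (card clean_blocks) * real s" by (intro mult_right_mono card_clean) simp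
      finally have "4 * real N \<le> 7 * real (card clean_data)" by (simp add: cardJ)
      then show ?thesis using clean_data_sub by simp
    qed
    ultimately have "outer_nn_integral (PiM clean_data (\<lambda>i. distr (law i) MX fst \<Otimes>\<^sub>M rademacher)) rad
      \<le> complexity_E P lb F fstar Inls N (\<lambda>i. distr M MX (\<lambda>w. fst (Z i w))) r"
      unfolding complexity_E_def radE by (intro SUP_upper2) auto
    then show ?thesis using E by (rule order_trans)
  qed
  \<comment> \<open>The squared form of the condition on \<open>complexity_V\<close>, with K / N = 1
    / s.\<close>
  have Vb: "(\<integral>z. (xloss f z - (\<integral>z'. xloss f z' \<partial>law i))\<^sup>2 \<partial>law i) \<le> r ^ 4 * real s / 1536"
    if f: "f \<in> T" and i: "i \<in> clean_data" for f i
  proof -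
    let ?v = "\<integral>z. (xloss f z - (\<integral>z'. xloss f z' \<partial>law i))\<^sup>2 \<partial>law i"
    have iI: "i \<in> Inls" using i clean_data_sub by auto
    have v0: "0 \<le> ?v" by simp
    have "ennreal (sqrt ?v) * ennreal (sqrt (real K / real N)) \<le> complexity_V P lb F fstar Inls N K (\<lambda>i. distr M (MX \<Otimes>\<^sub>M MY) (Z i)) r"
      unfolding complexity_V_def
    proof (rule mult_right_mono)
      show "ennreal (sqrt ?v) \<le> (SUP i\<in>Inls. SUP f\<in>{f \<in> F. excess_risk P lb fstar f \<le> r\<^sup>2}.
        ennreal (sqrt (\<integral>z. ((loss lb f z - loss lb fstar z)
          - (\<integral>z'. loss lb f z' - loss lb fstar z' \<partial>distr M (MX \<Otimes>\<^sub>M MY) (Z i)))\<^sup>2 \<partial>distr M (MX \<Otimes>\<^sub>M MY) (Z i))))"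
        using f iI by (intro SUP_upper2[OF iI] SUP_upper2[of f]) (auto simp: T_def law_def xloss_def)
    qed simp
    then have "ennreal (sqrt 1536) * (ennreal (sqrt ?v) * ennreal (sqrt (real K / real N))) \<le> ennreal (r\<^sup>2)"
      using V by (meson mult_left_mono order_trans zero_le)
    then have "ennreal (sqrt 1536 * (sqrt ?v * sqrt (real K / real N))) \<le> ennreal (r\<^sup>2)"
      using v0 by (simp add: ennreal_mult)
    then have "sqrt 1536 * (sqrt ?v * sqrt (real K / real N)) \<le> r\<^sup>2" by (subst (asm) ennreal_le_iff) auto
    then have "(sqrt 1536 * (sqrt ?v * sqrt (real K / real N)))\<^sup>2 \<le> (r\<^sup>2)\<^sup>2"
      using v0 by (intro power_mono) auto
    moreover have "(sqrt 1536 * (sqrt ?v * sqrt (real K / real N)))\<^sup>2 = 1536 * (?v * (real K / real N))"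
      unfolding power_mult_distrib using v0 by (simp add: real_sqrt_pow2)
    ultimately have "1536 * (?v * (real K / real N)) \<le> r ^ 4" by simp
    then show ?thesis using sN K_pos by (simp add: field_simps)
  qed
  obtain A' where A': "A' \<in> sets \<Omega>" "measure \<Omega> A' \<ge> 1 - exp (- (real (card clean_blocks) / 512))"
    "\<And>z f. z \<in> A' \<Longrightarrow> f \<in> T \<Longrightarrow> 96 * real (card {k\<in>clean_blocks. r\<^sup>2 / 4 < \<bar>dev f k z\<bar>}) \<le> 11 * real (card clean_blocks)"
    using good_event[OF comp Vb] by auto
  define \<psi> where "\<psi> w = (\<lambda>i\<in>clean_data. Z i w)" for w
  have \<psi>: "\<psi> \<in> measurable M \<Omega>"
    unfolding \<psi>_def using Inl_meas clean_data_sub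
    by (intro measurable_restrict) (auto simp: measurable_cong_sets[OF refl law_sets])
  define A where "A = \<psi> -` A' \<inter> space M"
  have "measure M A = measure \<Omega> A'"
    using measure_distr[OF \<psi> A'(1)] data_law by (simp add: A_def \<psi>_def[abs_def])
  also have "\<dots> \<ge> 1 - exp (- real K / 2016)"
  proof -
    \<comment> \<open>At least 4 K / 7 clean blocks give an exponent of K / 896 or better, so K /
      2016 is reached with room to spare.\<close>
    have "real K / 2016 \<le> real (card clean_blocks) / 512" using card_clean by simp
    then have "exp (- (real (card clean_blocks) / 512)) \<le> exp (- real K / 2016)" by simp
    then show ?thesis using A'(2) by linarith
  qed
  finally have mA: "1 - exp (- real K / 2016) \<le> measure M A" .
  have AM: "A \<in> sets M" unfolding A_def using \<psi> A'(1) by (rule measurable_sets)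
  have "excess_risk P lb fstar fh \<le> r\<^sup>2" if w: "w \<in> A" and fh: "is_minmax_MOM lb F K N B Z fh w" for w fh
  proof (rule minmax_MOM_risk_bound[OF K_pos fstar_in r excess_nonneg _ _ fh])
    have wA: "\<psi> w \<in> A'" using w by (auto simp: A_def)
    let ?PB = "\<lambda>f k. real K / real N * (\<Sum>i\<in>B k. loss lb f (Z i w) - loss lb fstar (Z i w))"
    fix f assume f: "f \<in> F" "excess_risk P lb fstar f \<le> r\<^sup>2"
    then have fT: "f \<in> T" by (simp add: T_def)
    have dev: "dev f k (\<psi> w) = ?PB f k - excess_risk P lb fstar f" if k: "k \<in> clean_blocks" for k
    proof -
      have "dev f k (\<psi> w) = (\<Sum>i\<in>B k. (loss lb f (Z i w) - loss lb fstar (Z i w)) - excess_risk P lb fstar f) / real s"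
        unfolding dev_def
      proof (intro arg_cong[where f = "\<lambda>x. x / real s"] sum.cong refl)
        fix i assume "i \<in> B k"
        then have "i \<in> clean_data" "i \<in> Inls" using k clean_data_sub by (auto simp: clean_data_def)
        then show "xloss f (\<psi> w i) - (\<integral>z'. xloss f z' \<partial>law i)
          = loss lb f (Z i w) - loss lb fstar (Z i w) - excess_risk P lb fstar f"
          using excess_law[of i f] f by (simp add: \<psi>_def xloss_def)
      qed
      also have "\<dots> = (\<Sum>i\<in>B k. loss lb f (Z i w) - loss lb fstar (Z i w)) / real s - excess_risk P lb fstar f"
        using sN B_card[OF k] by (simp add: sum_subtractf diff_divide_distrib)
      also have "\<dots> = ?PB f k - excess_risk P lb fstar f" using sN K_pos by (simp add: field_simps)
      finally show ?thesis .
    qed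
    define G where "G = {k\<in>clean_blocks. \<bar>dev f k (\<psi> w)\<bar> \<le> r\<^sup>2 / 4}"
    have "clean_blocks = G \<union> {k\<in>clean_blocks. r\<^sup>2 / 4 < \<bar>dev f k (\<psi> w)\<bar>}" by (auto simp: G_def)
    then have "card clean_blocks \<le> card G + card {k\<in>clean_blocks. r\<^sup>2 / 4 < \<bar>dev f k (\<psi> w)\<bar>}"
      by (metis card_Un_le)
    then have "real (card clean_blocks) \<le> real (card G) + real (card {k\<in>clean_blocks. r\<^sup>2 / 4 < \<bar>dev f k (\<psi> w)\<bar>})"
      by linarith
    \<comment> \<open>With 7 * \<open>card clean_blocks\<close> at least 4 K this yields
      \<open>card G\<close> at least 340 K / 672, above K / 2.\<close>
    then have "85 * real (card clean_blocks) \<le> 96 * real (card G)" using A'(3)[OF wA fT] by linarith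
    then have "real K < 2 * real (card G)" using card_clean K_pos by linarith
    then have "K < 2 * card G" by linarith
    moreover have "G \<subseteq> {..<K}" "G \<subseteq> clean_blocks" by (auto simp: G_def clean_blocks_def)
    ultimately show "\<exists>G\<subseteq>{..<K}. G \<subseteq> clean_blocks \<and> K < 2 * card G \<and> (\<forall>k\<in>G. \<bar>?PB f k - excess_risk P lb fstar f\<bar> \<le> r\<^sup>2 / 4)"
      using dev by (intro exI[of _ G]) (auto simp: G_def)
  next
    \<comment> \<open>Places the clean data in the sample space, where convexity of the loss is
      assumed.\<close>
    have wM: "w \<in> space M" using w by (auto simp: A_def)
    let ?PB = "\<lambda>f k. real K / real N * (\<Sum>i\<in>B k. loss lb f (Z i w) - loss lb fstar (Z i w))"
    fix f assume f: "f \<in> F" "r\<^sup>2 < excess_risk P lb fstar f"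
    obtain t where t: "0 < t" "t \<le> 1" "excess_risk P lb fstar (\<lambda>x. t * f x + (1 - t) * fstar x) = r\<^sup>2"
      using shrink_to_level[OF f(1) r f(2)] by blast
    let ?f = "\<lambda>x. t * f x + (1 - t) * fstar x"
    have "?PB ?f k \<le> t * ?PB f k" if k: "k \<in> clean_blocks" for k
    proof -
      have "(\<Sum>i\<in>B k. loss lb ?f (Z i w) - loss lb fstar (Z i w)) \<le> (\<Sum>i\<in>B k. t * (loss lb f (Z i w) - loss lb fstar (Z i w)))"
      proof (intro sum_mono loss_convex f)
        fix i assume "i \<in> B k"
        then have "i \<in> Inls" using k by (auto simp: clean_blocks_def)
        then show "Z i w \<in> space MX \<times> space MY"
          using Inl_meas measurable_space[of "Z i" M "MX \<Otimes>\<^sub>M MY" w] wM by (auto simp: space_pair_measure)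
      qed (use t in auto)
      then have "?PB ?f k \<le> real K / real N * (t * (\<Sum>i\<in>B k. loss lb f (Z i w) - loss lb fstar (Z i w)))"
        by (intro mult_left_mono) (auto simp: sum_distrib_left)
      then show ?thesis by (simp add: ac_simps)
    qed
    moreover have "?f \<in> F" using Conv f fstar_in t by auto
    ultimately show "\<exists>f0\<in>F. \<exists>t. 0 < t \<and> t \<le> 1 \<and> excess_risk P lb fstar f0 = r\<^sup>2 \<and> (\<forall>k\<in>clean_blocks. ?PB f0 k \<le> t * ?PB f k)"
      using t by (intro bexI[of _ ?f] exI[of _ t]) auto
  qed
  with AM mA show ?thesis by blast
qed

end

text \<open>The probability statement is made through one measurable event that is good for every
  minimizer at once, so \<open>fh\<close> may be selected from the minimizers in any, even
  non-measurable, way.\<close>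

theorem theorem4:
  fixes MX :: "'x measure" and MY :: "'y measure"
    and Ybar :: "real set" and F :: "('x \<Rightarrow> real) set"
    and lb :: "real \<Rightarrow> 'y \<Rightarrow> real" and L :: real
    and P :: "('x \<times> 'y) measure" and fstar :: "'x \<Rightarrow> real"
    and M :: "'w measure" and Z :: "nat \<Rightarrow> 'w \<Rightarrow> 'x \<times> 'y"
    and N K :: nat and B :: "nat \<Rightarrow> nat set" and Outs Inls :: "nat set"
    and \<gamma> rbar :: real
  assumes P_prob: "prob_space P" and P_sets: "sets P = sets (MX \<Otimes>\<^sub>M MY)"
    and Ybar_conv: "convex Ybar" and Ybar_vals: "\<forall>f\<in>F. \<forall>x\<in>space MX. f x \<in> Ybar"
    and F_meas: "\<forall>f\<in>F. f \<in> borel_measurable MX"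
    and loss_meas: "\<forall>f\<in>F. loss lb f \<in> borel_measurable (MX \<Otimes>\<^sub>M MY)"
    and loss_int: "\<forall>f\<in>F. integrable P (loss lb f)"
    and fstar_in: "fstar \<in> F"
    and fstar_min: "\<forall>f\<in>F. (\<integral>z. loss lb fstar z \<partial>P) \<le> (\<integral>z. loss lb f z \<partial>P)"
    and fstar_unique: "\<forall>f\<in>F. (\<integral>z. loss lb f z \<partial>P) = (\<integral>z. loss lb fstar z \<partial>P) \<longrightarrow> f = fstar"
    and Lip_Conv: "L > 0"
      "\<forall>y\<in>space MY. convex_on Ybar (\<lambda>u. lb u y) \<and> L-lipschitz_on Ybar (\<lambda>u. lb u y)"
    and Conv: "\<forall>f\<in>F. \<forall>g\<in>F. \<forall>t\<in>{0..1}. (\<lambda>x. t * f x + (1 - t) * g x) \<in> F"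
    and M_prob: "prob_space M"
    and partition: "Outs \<union> Inls = {..<N}" "Outs \<inter> Inls = {}"
    and Inl_meas: "\<forall>i\<in>Inls. Z i \<in> measurable M (MX \<Otimes>\<^sub>M MY)"
    and Inl_indep: "prob_space.indep_vars M (\<lambda>_. MX \<Otimes>\<^sub>M MY) Z Inls"
    and Inl_L2: "\<forall>i\<in>Inls. \<forall>f\<in>F. integrable (distr M MX (\<lambda>w. fst (Z i w))) (\<lambda>x. (f x)\<^sup>2)"
    and Inl_risk: "\<forall>i\<in>Inls. \<forall>f\<in>F.
        excess_risk (distr M (MX \<Otimes>\<^sub>M MY) (Z i)) lb fstar f = excess_risk P lb fstar f"
    and K_pos: "0 < K" and K_dvd: "K dvd N"
    and blocks_card: "\<forall>k<K. card (B k) = N div K"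
    and blocks_disj: "\<forall>k<K. \<forall>k'<K. k \<noteq> k' \<longrightarrow> B k \<inter> B k' = {}"
    and blocks_cover: "(\<Union>k<K. B k) = {..<N}"
    and outliers: "7 * real (card Outs) \<le> 3 * real N"
    and K_lower: "7 * real (card Outs) / 3 \<le> real K" and K_upper: "K \<le> N"
    and gamma_def: "\<gamma> = 1 / (768 * L)"
    and rbar_pos: "0 < rbar"
    and rbar_ge: "(INF r \<in> {r. 0 < r \<and>
          max (complexity_E P lb F fstar Inls N (\<lambda>i. distr M MX (\<lambda>w. fst (Z i w))) r / ennreal \<gamma>)
              (ennreal (sqrt 1536) *
                 complexity_V P lb F fstar Inls N K (\<lambda>i. distr M (MX \<Otimes>\<^sub>M MY) (Z i)) r)
          \<le> ennreal (r\<^sup>2)}. ereal r) \<le> ereal rbar"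
  shows "\<exists>A\<in>sets M. measure M A \<ge> 1 - exp (- real K / 2016) \<and>
           (\<forall>w\<in>A. \<forall>fh. is_minmax_MOM lb F K N B Z fh w \<longrightarrow>
                excess_risk P lb fstar fh \<le> rbar\<^sup>2)"
proof -
  interpret mom_setting MX MY Ybar F lb L P fstar M Z N K B Outs Inls
    by (rule mom_setting.intro; fact)
  interpret prob_space M by (rule M_prob)
  define good where "good r A \<longleftrightarrow> A \<in> sets M \<and> measure M A \<ge> 1 - exp (- real K / 2016) \<and>
    (\<forall>w\<in>A. \<forall>fh. is_minmax_MOM lb F K N B Z fh w \<longrightarrow> excess_risk P lb fstar fh \<le> r\<^sup>2)" for r A
  have ex: "\<exists>r A. 0 < r \<and> r < rbar + 1 / real (Suc m) \<and> good r A" for m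
  proof -
    \<comment> \<open>The strict margin produces an admissible radius below it. An empty set of
      radii would have infinite infimum, which \<open>rbar_ge\<close> excludes.\<close>
    have "ereal rbar < ereal (rbar + 1 / real (Suc m))" by simp
    from le_less_trans[OF rbar_ge this] obtain r where r: "0 < r" "r < rbar + 1 / real (Suc m)"
      and le: "max (complexity_E P lb F fstar Inls N (\<lambda>i. distr M MX (\<lambda>w. fst (Z i w))) r / ennreal \<gamma>)
        (ennreal (sqrt 1536) * complexity_V P lb F fstar Inls N K (\<lambda>i. distr M (MX \<Otimes>\<^sub>M MY) (Z i)) r) \<le> ennreal (r\<^sup>2)"
      unfolding INF_less_iff by auto
    let ?E = "complexity_E P lb F fstar Inls N (\<lambda>i. distr M MX (\<lambda>w. fst (Z i w))) r"
    have \<gamma>: "0 < \<gamma>" using L_pos by (simp add: gamma_def)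
    have "?E = ?E / ennreal \<gamma> * ennreal \<gamma>"
      using \<gamma> by (simp add: ennreal_divide_times ennreal_divide_self)
    also have "\<dots> \<le> ennreal (r\<^sup>2) * ennreal \<gamma>" using le by (intro mult_right_mono) auto
    also have "\<dots> = ennreal (r\<^sup>2 / (768 * L))"
      using L_pos by (subst ennreal_mult[symmetric]) (auto simp: gamma_def)
    finally have "\<exists>A. good r A" using minmax_event[OF r(1)] le unfolding good_def by (auto simp: Bex_def)
    with r show ?thesis by blast
  qed
  then obtain r A where r: "\<And>m. 0 < r m" "\<And>m. r m < rbar + 1 / real (Suc m)" and A: "\<And>m. good (r m) (A m)"
    by metis
  \<comment> \<open>The infimum in \<open>rbar_ge\<close> need not be attained, and the condition on \<open>complexity_V\<close> is not
    stable under increasing \<open>r\<close>: hence a limsup of events for radii approaching \<open>rbar\<close>.\<close>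
  define D where "D n = (\<Union>m\<in>{n..}. A m)" for n
  have Am: "A m \<in> sets M" "1 - exp (- real K / 2016) \<le> measure M (A m)" for m
    using A[of m] by (auto simp: good_def)
  have Dm: "D n \<in> sets M" for n unfolding D_def using Am(1) by auto
  have "1 - exp (- real K / 2016) \<le> measure M (D n)" for n
  proof -
    have "A n \<subseteq> D n" by (auto simp: D_def)
    from order_trans[OF Am(2) finite_measure_mono[OF this Dm]] show ?thesis .
  qed
  moreover have "decseq D" unfolding D_def decseq_def by (intro allI impI UN_mono) auto
  then have "(\<lambda>n. measure M (D n)) \<longlonglongrightarrow> measure M (\<Inter>n. D n)"
    using Dm by (intro finite_Lim_measure_decseq) auto
  ultimately have "1 - exp (- real K / 2016) \<le> measure M (\<Inter>n. D n)"
    by (intro LIMSEQ_le_const) auto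
  moreover have "(\<Inter>n. D n) \<in> sets M" using Dm by auto
  moreover have "excess_risk P lb fstar fh \<le> rbar\<^sup>2"
    if w: "w \<in> (\<Inter>n. D n)" and fh: "is_minmax_MOM lb F K N B Z fh w" for w fh
  proof (rule LIMSEQ_le_const)
    show "(\<lambda>n. (rbar + 1 / real (Suc n))\<^sup>2) \<longlonglongrightarrow> rbar\<^sup>2"
      using tendsto_power[OF tendsto_add[OF tendsto_const[of rbar] LIMSEQ_inverse_real_of_nat], of 2]
      by (simp add: inverse_eq_divide)
    have "excess_risk P lb fstar fh \<le> (rbar + 1 / real (Suc n))\<^sup>2" for n
    proof -
      obtain m where m: "n \<le> m" "w \<in> A m" using w by (auto simp: D_def)
      then have "excess_risk P lb fstar fh \<le> (r m)\<^sup>2" using A[of m] fh by (auto simp: good_def)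
      also have "\<dots> \<le> (rbar + 1 / real (Suc n))\<^sup>2"
      proof (rule power_mono)
        have "1 / real (Suc m) \<le> 1 / real (Suc n)" using m by (simp add: frac_le)
        then show "r m \<le> rbar + 1 / real (Suc n)" using r(2)[of m] by linarith
      qed (use r(1)[of m] in simp)
      finally show ?thesis .
    qed
    then show "\<exists>n0. \<forall>n\<ge>n0. excess_risk P lb fstar fh \<le> (rbar + 1 / real (Suc n))\<^sup>2" by blast
  qed
  ultimately show ?thesis by blast
qed

end
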